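(* Let $r\ge1$ be an integer, $J>0$, and consider the Ising model on the free group $\mathbb{F}_r$ with interaction strength $J$ and zero external field. Then the plus and minus Ising states have the same sofic entropy over every sofic approximation: for any two sofic approximations $\Sigma_1,\Sigma_2$ to $\mathbb{F}_r$, $$\mathrm{h}_{\Sigma_1}(\mu^+)=\mathrm{h}_{\Sigma_2}(\mu^+)\qquad\text{and}\qquad \mathrm{h}_{\Sigma_1}(\mu^-)=\mathrm{h}_{\Sigma_2}(\mu^-).$$
   Context: Let $\mathbb{F}_r=\langle s_1,\dots,s_r\rangle$ be the free group of rank $r$; its Cayley graph (edges $\{\gamma,s_i\gamma\}$) is the $2r$-regular tree. For $t\in\mathbb{R}$ let $\alpha(t)=\frac{e^{-2J}+e^{-2t}}{2e^{-2J}+2\cosh(2t)}$ and $\beta(t)=\frac{1}{e^{2(J+t)}+1}$. Let $\mu_t$ be the tree-indexed Markov chain on $\{-1,+1\}^{\mathbb{F}_r}$, invariant under all automorphisms of the Cayley tree, with single-site marginal $\mathbb{P}\{-1\}=\alpha(t)$, $\mathbb{P}\{+1\}=1-\alpha(t)$, and with transition probabilities across each edge $\mathbb{P}\{-1\to+1\}=\beta(-t)$, $\mathbb{P}\{-1\to-1\}=1-\beta(-t)$, $\mathbb{P}\{+1\to-1\}=\beta(t)$, $\mathbb{P}\{+1\to+1\}=1-\beta(t)$. Let $J_{uniq}(r)=\operatorname{arctanh}\frac1{2r-1}$ (with $J_{uniq}(1)=+\infty$). If $J>J_{uniq}(r)$, the equation $t=\frac{2r-1}{2}\log\frac{\cosh(t+J)}{\cosh(t-J)}$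 has exactly three solutions $0$, $t_+>0$ and $t_-=-t_+$, and the plus and minus states are $\mu^+=\mu_{t_+}$, $\mu^-=\mu_{t_-}$. If $J\le J_{uniq}(r)$ then $t=0$ is the only solution and $\mu^+=\mu^-=\mu_0$ (the unique Gibbs state). For a finite set $V$, a map $\sigma:\mathbb{F}_r\to\operatorname{Sym}(V)$ and $\mathbf{x}\in\{-1,+1\}^V$, let $\Pi_v^\sigma\mathbf{x}(\gamma)=\mathbf{x}(\sigma(\gamma)(v))$ and $P^\sigma_{\mathbf{x}}=\frac1{|V|}\sum_{v\in V}\delta_{\Pi_v^\sigma\mathbf{x}}$. For a set $\mathcal{O}$ of Borel probability measures on $\{-1,+1\}^{\mathbb{F}_r}$ let $\Omega(\sigma,\mathcal{O})=\{\mathbf{x}: P^\sigma_{\mathbf{x}}\in\mathcal{O}\}$. For finite $F\subset\mathbb{F}_r$ and $\delta>0$, $\sigma$ is $(F,\delta)$-sofic if $\frac1{|V|}|\{v:\sigma(\gamma)(v)\ne v\ \forall\gamma\in F\setminus\{e\}\}|>1-\delta$ and $\frac1{|V|}|\{v:\sigma(\gamma_1\gamma_2)(v)=\sigma(\gamma_1)(\sigma(\gamma_2)(v))\ \forall\gamma_1,\gamma_2\in F\}|>1-\delta$. A sequence $\Sigma=\{\sigma_n:\mathbb{F}_r\to\operatorname{Sym}(V_n)\}$ is a sofic approximation if $|V_n|\to\infty$ and for all $F,\delta$ the map $\sigma_n$ is $(F,\delta)$-sofic for all large $n$. Sofic entropy: $\mathrm{h}_\Sigma(\mu)=\inf_{\mathcal{O}\ni\mu}\limsup_{n\to\infty}\frac1{|V_n|}\log|\Omega(\sigma_n,\mathcal{O})|$,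 with $\mathcal{O}$ ranging over weak*-open neighborhoods of $\mu$. *)

theory Defs
  imports "HOL-Probability.Probability" "HOL-Algebra.Group"
begin

section \<open>The free group of rank r\<close>

text \<open>The letter \<open>(i, True)\<close> stands for the generator \<open>s\<^sub>i\<close> and \<open>(i, False)\<close> for its inverse;
  the elements of the free group are the reduced words in these letters.\<close>

type_synonym letter = "nat \<times> bool"

definition inv_letter :: "letter \<Rightarrow> letter" where
  "inv_letter a = (fst a, \<not> snd a)"

definition reduced :: "letter list \<Rightarrow> bool" where
  "reduced w \<longleftrightarrow> successively (\<lambda>a b. b \<noteq> inv_letter a) w"

fun push_letter :: "letter \<Rightarrow> letter list \<Rightarrow> letter list" where
  "push_letter a [] = [a]"
| "push_letter a (b # w) = (if b = inv_letter a then w else a # b # w)"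

definition free_group :: "nat \<Rightarrow> letter list monoid" where
  "free_group r =
    \<lparr>carrier = {w. set w \<subseteq> {..<r} \<times> UNIV \<and> reduced w},
     mult = (\<lambda>u v. foldr push_letter u v),
     one = []\<rparr>"

definition free_gen :: "nat \<Rightarrow> letter list" where
  "free_gen i = [(i, True)]"

lemma inv_letter_inv_letter [simp]: "inv_letter (inv_letter a) = a"
  by (simp add: inv_letter_def)

lemma inv_letter_neq [simp]: "inv_letter a \<noteq> a" "a \<noteq> inv_letter a"
  by (cases a, auto simp: inv_letter_def)+

lemma reduced_tl: "reduced (a # w) \<Longrightarrow> reduced w"
  by (cases w) (auto simp: reduced_def)

lemma reduced_push: "reduced w \<Longrightarrow> reduced (push_letter a w)"
  by (cases w) (auto simp: reduced_def elim: successively.elims)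

lemma push_letter_cancel: "reduced w \<Longrightarrow> push_letter (inv_letter a) (push_letter a w) = w"
proof (cases w)
  case (Cons b v)
  assume "reduced w"
  then show ?thesis
    using Cons by (cases v) (auto simp: reduced_def)
qed simp

lemma push_letter_cancel': "reduced w \<Longrightarrow> push_letter a (push_letter (inv_letter a) w) = w"
  using push_letter_cancel[of w "inv_letter a"] by simp

lemma reduced_foldr_push: "reduced v \<Longrightarrow> reduced (foldr push_letter u v)"
  by (induction u) (auto intro: reduced_push)

lemma set_push_letter: "set (push_letter a w) \<subseteq> insert a (set w)"
  by (cases w) auto

lemma set_foldr_push: "set (foldr push_letter u v) \<subseteq> set u \<union> set v"
  by (induction u) (use set_push_letter in fastforce)+

lemma foldr_push_push:
  "reduced w \<Longrightarrow> foldr push_letter (push_letter a v) w = push_letter a (foldr push_letter v w)"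
  by (cases v) (auto simp: push_letter_cancel' reduced_foldr_push)

lemma foldr_push_assoc:
  "reduced w \<Longrightarrow>
    foldr push_letter (foldr push_letter u v) w = foldr push_letter u (foldr push_letter v w)"
  by (induction u) (auto simp: foldr_push_push)

lemma foldr_push_reduced: "reduced w \<Longrightarrow> foldr push_letter w [] = w"
proof (induction w)
  case (Cons a w)
  then show ?case by (cases w) (auto simp: reduced_def)
qed simp

lemma push_inverse:
  "reduced w \<Longrightarrow> foldr push_letter (map inv_letter (rev w)) w = []"
proof (induction w)
  case (Cons a w)
  then show ?case using reduced_tl[OF Cons.prems] by simp
qed simp

lemma reduced_inverse: "reduced w \<Longrightarrow> reduced (map inv_letter (rev w))"
  unfolding reduced_def successively_map successively_rev
  by (erule successively_mono) auto

lemma group_free_group: "group (free_group r)"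
proof (rule groupI)
  fix x assume x: "x \<in> carrier (free_group r)"
  let ?y = "map inv_letter (rev x)"
  have "?y \<in> carrier (free_group r)"
    using x by (auto simp: free_group_def reduced_inverse inv_letter_def)
  moreover have "?y \<otimes>\<^bsub>free_group r\<^esub> x = \<one>\<^bsub>free_group r\<^esub>"
    using x by (simp add: free_group_def push_inverse)
  ultimately show "\<exists>y\<in>carrier (free_group r). y \<otimes>\<^bsub>free_group r\<^esub> x = \<one>\<^bsub>free_group r\<^esub>"
    by blast
next
  fix x y assume "x \<in> carrier (free_group r)" "y \<in> carrier (free_group r)"
  then show "x \<otimes>\<^bsub>free_group r\<^esub> y \<in> carrier (free_group r)"
    using set_foldr_push[of x y] by (auto simp: free_group_def reduced_foldr_push)
qed (auto simp: free_group_def foldr_push_assoc, simp add: reduced_def)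

definition cayley_edge :: "nat \<Rightarrow> (letter list \<times> letter list) set" where
  "cayley_edge r = {(g, h). g \<in> carrier (free_group r) \<and> h \<in> carrier (free_group r) \<and>
     (\<exists>i<r. h = free_gen i \<otimes>\<^bsub>free_group r\<^esub> g \<or> g = free_gen i \<otimes>\<^bsub>free_group r\<^esub> h)}"

definition cayley_automorphism :: "nat \<Rightarrow> (letter list \<Rightarrow> letter list) \<Rightarrow> bool" where
  "cayley_automorphism r \<phi> \<longleftrightarrow>
     bij_betw \<phi> (carrier (free_group r)) (carrier (free_group r)) \<and>
     (\<forall>g\<in>carrier (free_group r). \<forall>h\<in>carrier (free_group r).
        (\<phi> g, \<phi> h) \<in> cayley_edge r \<longleftrightarrow> (g, h) \<in> cayley_edge r)"

text \<open>The vertices on the side of \<open>g\<close> of the edge \<open>{g, h}\<close>: the connected component of \<open>g\<close>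
  after the edge has been removed from the tree.\<close>

definition edge_side :: "nat \<Rightarrow> letter list \<Rightarrow> letter list \<Rightarrow> letter list set" where
  "edge_side r g h = {k. (g, k) \<in> (cayley_edge r - {(g, h), (h, g)})\<^sup>*}"

section \<open>Spin configurations and the weak* topology\<close>

type_synonym config = "letter list \<Rightarrow> int"

definition config_top :: "nat \<Rightarrow> config topology" where
  "config_top r = product_topology (\<lambda>_. discrete_topology {-1, 1}) (carrier (free_group r))"

definition config_borel :: "nat \<Rightarrow> config measure" where
  "config_borel r = sigma (topspace (config_top r)) {U. openin (config_top r) U}"

definition borel_probs :: "nat \<Rightarrow> config measure set" where
  "borel_probs r = {\<mu>. prob_space \<mu> \<and> sets \<mu> = sets (config_borel r)}"

definition weak_star_top :: "nat \<Rightarrow> config measure topology" where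
  "weak_star_top r = topology_generated_by
     {{\<mu> \<in> borel_probs r. (\<integral>x. f x \<partial>\<mu>) \<in> U} | f U.
        continuous_map (config_top r) euclideanreal f \<and> open (U :: real set)}"

section \<open>Ising states\<close>

definition ising_alpha :: "real \<Rightarrow> real \<Rightarrow> real" where
  "ising_alpha J t =
     (exp (- 2 * J) + exp (- 2 * t)) / (2 * exp (- 2 * J) + 2 * cosh (2 * t))"

definition ising_beta :: "real \<Rightarrow> real \<Rightarrow> real" where
  "ising_beta J t = 1 / (exp (2 * (J + t)) + 1)"

definition spin_event :: "nat \<Rightarrow> letter list \<Rightarrow> int \<Rightarrow> config set" where
  "spin_event r g a = {x \<in> topspace (config_top r). x g = a}"

text \<open>Tree-indexed Markov chain: for every oriented edge \<open>(g, h)\<close>, the spin at \<open>h\<close> is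
  conditionally independent, given the spin at \<open>g\<close>, of all the spins on the side of \<open>g\<close>.\<close>

definition tree_markov_chain :: "nat \<Rightarrow> config measure \<Rightarrow> bool" where
  "tree_markov_chain r \<mu> \<longleftrightarrow> \<mu> \<in> borel_probs r \<and>
     (\<forall>(g, h)\<in>cayley_edge r. \<forall>a\<in>{-1, 1}. \<forall>b\<in>{-1, 1}.
      \<forall>A\<in>sigma_sets (topspace (config_top r)) {spin_event r k c | k c. k \<in> edge_side r g h \<and> c \<in> {-1, 1}}.
        measure \<mu> (spin_event r h b \<inter> spin_event r g a \<inter> A) * measure \<mu> (spin_event r g a) =
        measure \<mu> (spin_event r h b \<inter> spin_event r g a) * measure \<mu> (spin_event r g a \<inter> A))"

definition automorphism_invariant :: "nat \<Rightarrow> config measure \<Rightarrow> bool" where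
  "automorphism_invariant r \<mu> \<longleftrightarrow>
     (\<forall>\<phi>. cayley_automorphism r \<phi> \<longrightarrow>
        distr \<mu> (config_borel r) (\<lambda>x. \<lambda>g\<in>carrier (free_group r). x (\<phi> g)) = \<mu>)"

definition ising_chain :: "nat \<Rightarrow> real \<Rightarrow> real \<Rightarrow> config measure \<Rightarrow> bool" where
  "ising_chain r J t \<mu> \<longleftrightarrow>
     tree_markov_chain r \<mu> \<and> automorphism_invariant r \<mu> \<and>
     (\<forall>g\<in>carrier (free_group r).
        \<P>(x in \<mu>. x g = -1) = ising_alpha J t \<and>
        \<P>(x in \<mu>. x g = 1) = 1 - ising_alpha J t) \<and>
     (\<forall>(g, h)\<in>cayley_edge r.
        \<P>(x in \<mu>. x h = 1 \<bar> x g = -1) = ising_beta J (- t) \<and>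
        \<P>(x in \<mu>. x h = -1 \<bar> x g = -1) = 1 - ising_beta J (- t) \<and>
        \<P>(x in \<mu>. x h = -1 \<bar> x g = 1) = ising_beta J t \<and>
        \<P>(x in \<mu>. x h = 1 \<bar> x g = 1) = 1 - ising_beta J t)"

text \<open>The case distinction is needed because \<open>artanh 1\<close> is a junk value.\<close>

definition J_uniq :: "nat \<Rightarrow> ereal" where
  "J_uniq r = (if r = 1 then \<infinity> else ereal (artanh (1 / (2 * real r - 1))))"

definition ising_fixed_point :: "nat \<Rightarrow> real \<Rightarrow> real \<Rightarrow> bool" where
  "ising_fixed_point r J t \<longleftrightarrow> t = (2 * real r - 1) / 2 * ln (cosh (t + J) / cosh (t - J))"

text \<open>Above the threshold the nonzero fixed points are one positive number and its negative,
  so these predicates pin down the parameters of the plus and the minus state.\<close>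

definition plus_param :: "nat \<Rightarrow> real \<Rightarrow> real \<Rightarrow> bool" where
  "plus_param r J t \<longleftrightarrow> (if ereal J > J_uniq r then t > 0 \<and> ising_fixed_point r J t else t = 0)"

definition plus_state :: "nat \<Rightarrow> real \<Rightarrow> config measure \<Rightarrow> bool" where
  "plus_state r J \<mu> \<longleftrightarrow> (\<exists>t. plus_param r J t \<and> ising_chain r J t \<mu>)"

definition minus_state :: "nat \<Rightarrow> real \<Rightarrow> config measure \<Rightarrow> bool" where
  "minus_state r J \<mu> \<longleftrightarrow> (\<exists>t. plus_param r J t \<and> ising_chain r J (- t) \<mu>)"

section \<open>Sofic approximations and sofic entropy\<close>

text \<open>A map \<open>\<sigma>\<close> from the free group to \<open>Sym(V)\<close> is a function whose values on the carrier permute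
  \<open>V\<close>; only these values matter.\<close>

definition sofic_map ::
  "nat \<Rightarrow> letter list set \<Rightarrow> real \<Rightarrow> 'v set \<Rightarrow> (letter list \<Rightarrow> 'v \<Rightarrow> 'v) \<Rightarrow> bool" where
  "sofic_map r F \<delta> V \<sigma> \<longleftrightarrow>
     real (card {v \<in> V. \<forall>g\<in>F - {\<one>\<^bsub>free_group r\<^esub>}. \<sigma> g v \<noteq> v}) / real (card V) > 1 - \<delta> \<and>
     real (card {v \<in> V. \<forall>g\<in>F. \<forall>h\<in>F. \<sigma> (g \<otimes>\<^bsub>free_group r\<^esub> h) v = \<sigma> g (\<sigma> h v)})
       / real (card V) > 1 - \<delta>"

definition sofic_approximation ::
  "nat \<Rightarrow> (nat \<Rightarrow> 'v set) \<Rightarrow> (nat \<Rightarrow> letter list \<Rightarrow> 'v \<Rightarrow> 'v) \<Rightarrow> bool" where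
  "sofic_approximation r V \<sigma> \<longleftrightarrow>
     (\<forall>n. finite (V n)) \<and>
     (\<forall>n. \<forall>g\<in>carrier (free_group r). \<sigma> n g permutes V n) \<and>
     filterlim (\<lambda>n. card (V n)) at_top sequentially \<and>
     (\<forall>F \<delta>. finite F \<and> F \<subseteq> carrier (free_group r) \<and> \<delta> > 0 \<longrightarrow>
        (\<forall>\<^sub>F n in sequentially. sofic_map r F \<delta> (V n) (\<sigma> n)))"

definition pullback_name ::
  "nat \<Rightarrow> (letter list \<Rightarrow> 'v \<Rightarrow> 'v) \<Rightarrow> ('v \<Rightarrow> int) \<Rightarrow> 'v \<Rightarrow> config" where
  "pullback_name r \<sigma> x v = (\<lambda>g\<in>carrier (free_group r). x (\<sigma> g v))"

text \<open>The average of the Dirac masses at the pullback names, written as the image of the uniform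
  distribution on \<open>V\<close>.\<close>

definition empirical ::
  "nat \<Rightarrow> 'v set \<Rightarrow> (letter list \<Rightarrow> 'v \<Rightarrow> 'v) \<Rightarrow> ('v \<Rightarrow> int) \<Rightarrow> config measure" where
  "empirical r V \<sigma> x = distr (uniform_count_measure V) (config_borel r) (pullback_name r \<sigma> x)"

definition good_models ::
  "nat \<Rightarrow> 'v set \<Rightarrow> (letter list \<Rightarrow> 'v \<Rightarrow> 'v) \<Rightarrow> config measure set \<Rightarrow> ('v \<Rightarrow> int) set" where
  "good_models r V \<sigma> \<O> = {x \<in> V \<rightarrow>\<^sub>E {-1, 1}. empirical r V \<sigma> x \<in> \<O>}"

text \<open>\<open>log\<close> takes the value \<open>-\<infinity>\<close> at \<open>0\<close>, so that the entropy is \<open>-\<infinity>\<close> for a measure that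
  has no good models.\<close>

definition log_card :: "'b set \<Rightarrow> ereal" where
  "log_card A = (if card A = 0 then -\<infinity> else ereal (ln (real (card A))))"

definition sofic_entropy ::
  "nat \<Rightarrow> (nat \<Rightarrow> 'v set) \<Rightarrow> (nat \<Rightarrow> letter list \<Rightarrow> 'v \<Rightarrow> 'v) \<Rightarrow> config measure \<Rightarrow> ereal" where
  "sofic_entropy r V \<sigma> \<mu> =
     (INF \<O> \<in> {\<O>. openin (weak_star_top r) \<O> \<and> \<mu> \<in> \<O>}.
        limsup (\<lambda>n. log_card (good_models r (V n) (\<sigma> n) \<O>) / ereal (real (card (V n)))))"

end

theory Submission
  imports Defs
begin

text \<open>
  Put the Ising model with coupling \<open>s \<le> J\<close> and a uniform external field on the graph defined by the
  sofic map, and choose the field as a function of \<open>s\<close> so that the cavity field \<open>t\<close> of the plus state at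
  \<open>J\<close> solves the fixed-point equation at every \<open>s\<close>. For \<open>s < J\<close> this field is nonnegative, and \<open>t\<close>
  attracts the cavity recursion from the free and from the plus boundary condition. By Griffiths'
  inequality every correlation of a tree-like neighbourhood lies between the two boundary
  conditions, hence converges to the correlation of a chain on the tree; a second-moment bound of the
  same kind shows that the empirical measures concentrate. Since the derivative of the log partition
  function along the path is a sum of such correlations, the free energy per vertex converges to a
  limit that does not depend on the sofic approximation. Comparing the partition function with the
  number of good models bounds that number from both sides, up to an error that vanishes as \<open>s\<close> tends
  to \<open>J\<close>. The minus state follows by flipping all spins.
\<close>

section \<open>Griffiths inequality\<close>

text \<open>The zero-field model at \<open>J\<close> itself is of no use above the threshold: the
  free boundary then starts the cavity recursion at the fixed point \<open>0\<close>, and the lower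
  comparison never reaches \<open>t\<close>. Lowering the coupling with \<open>t\<close> held fixed
  makes the compensating field strictly positive, and concavity of the cavity map on the half-line
  makes \<open>t\<close> its only nonnegative fixed point. The path of couplings begins at
  \<open>0\<close>, where the spins are independent and the partition function is explicit.

  The entropy is never evaluated. Models are selected by the correlations at \<open>J\<close> but
  weighted at \<open>s\<close>. This bounds their number from above for every \<open>s < J\<close>
  and from below, with the same exponent, for a suitable \<open>s\<close> near \<open>J\<close>.
  Using the \<open>s\<close> of one approximation's lower bound in the other's upper bound cancels
  the exponent, whose limit is not computed.

  Griffiths' inequality yields one-sided bounds only. In the expanded square deviation the second
  moment carries a plus sign and the first a minus sign, the tree correlations being nonnegative, so
  these bounds are the ones required.\<close>

abbreviation spin :: "('a \<Rightarrow> int) \<Rightarrow> 'a \<Rightarrow> real" where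
  "spin x v \<equiv> real_of_int (x v)"

definition spins :: "'a set \<Rightarrow> ('a \<Rightarrow> int) set" where
  "spins V = V \<rightarrow>\<^sub>E {-1, 1}"

text \<open>\<open>spins V\<close> is the group {-1,1}^V under this product; its translations are
  the substitutions behind the positivity arguments.\<close>

definition spin_mult :: "'a set \<Rightarrow> ('a \<Rightarrow> int) \<Rightarrow> ('a \<Rightarrow> int) \<Rightarrow> 'a \<Rightarrow> int" where
  "spin_mult V x y = (\<lambda>v\<in>V. x v * y v)"

definition spin_char :: "'a set \<Rightarrow> (('a \<Rightarrow> int) \<Rightarrow> real) \<Rightarrow> bool" where
  "spin_char V \<psi> \<longleftrightarrow> (\<forall>x\<in>spins V. \<psi> x = 1 \<or> \<psi> x = -1) \<and>
     (\<forall>x\<in>spins V. \<forall>y\<in>spins V. \<psi> (spin_mult V x y) = \<psi> x * \<psi> y)"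

text \<open>The convex cone generated by the characters of {-1,1}^V, i.e. the functions with
  nonnegative Fourier coefficients. The inductive form gives closure under products by two nested
  inductions.\<close>

inductive pos_def :: "'a set \<Rightarrow> (('a \<Rightarrow> int) \<Rightarrow> real) \<Rightarrow> bool" for V where
  char: "spin_char V \<psi> \<Longrightarrow> pos_def V \<psi>"
| add: "pos_def V f \<Longrightarrow> pos_def V g \<Longrightarrow> pos_def V (\<lambda>x. f x + g x)"
| scale: "pos_def V f \<Longrightarrow> 0 \<le> c \<Longrightarrow> pos_def V (\<lambda>x. c * f x)"

text \<open>Ferromagnetic Boltzmann weights as products: \<open>a = cosh J\<close>,
  \<open>b = sinh J\<close> is an interaction with \<open>0 \<le> J\<close>, and the limiting case
  \<open>a = b\<close> is the hard constraint \<open>\<psi> x = 1\<close>, which is how plus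
  boundaries enter. Such weights may vanish.\<close>

inductive ferro_weight :: "'a set \<Rightarrow> (('a \<Rightarrow> int) \<Rightarrow> real) \<Rightarrow> bool" for V where
  one: "ferro_weight V (\<lambda>x. 1)"
| mult: "ferro_weight V w \<Longrightarrow> spin_char V \<psi> \<Longrightarrow> 0 \<le> b \<Longrightarrow> b \<le> a \<Longrightarrow>
    ferro_weight V (\<lambda>x. w x * (a + b * \<psi> x))"

lemma finite_spins [simp]: "finite V \<Longrightarrow> finite (spins V)"
  unfolding spins_def by (intro finite_PiE) auto

lemma spins_cases: "x \<in> spins V \<Longrightarrow> v \<in> V \<Longrightarrow> x v = -1 \<or> x v = 1"
  by (auto simp: spins_def)

lemma spins_square: "x \<in> spins V \<Longrightarrow> v \<in> V \<Longrightarrow> x v * x v = 1"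
  by (auto simp: spins_def dest!: PiE_mem)

lemma spins_nonempty: "spins V \<noteq> {}"
  by (auto simp: spins_def PiE_eq_empty_iff)

lemma spin_mult_in: "x \<in> spins V \<Longrightarrow> y \<in> spins V \<Longrightarrow> spin_mult V x y \<in> spins V"
  unfolding spins_def spin_mult_def by (rule restrict_PiE_iff[THEN iffD2]) (auto dest!: PiE_mem)

lemma spin_mult_cancel: "x \<in> spins V \<Longrightarrow> y \<in> spins V \<Longrightarrow> spin_mult V x (spin_mult V x y) = y"
  by (rule ext) (auto simp: spin_mult_def restrict_def spins_square mult.assoc[symmetric],
      auto simp: spins_def PiE_def extensional_def)

lemma sum_spin_mult:
  assumes "z \<in> spins V"
  shows "(\<Sum>x\<in>spins V. f (spin_mult V z x)) = (\<Sum>x\<in>spins V. f x)"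
  by (rule sum.reindex_bij_witness[of _ "spin_mult V z" "spin_mult V z"])
    (use assms in \<open>auto simp: spin_mult_cancel spin_mult_in\<close>)

lemma spin_char_one: "spin_char V (\<lambda>x. 1)"
  by (simp add: spin_char_def)

lemma spin_char_mult: "spin_char V f \<Longrightarrow> spin_char V g \<Longrightarrow> spin_char V (\<lambda>x. f x * g x)"
  unfolding spin_char_def by (fastforce simp: algebra_simps)

lemma spin_char_spin: "v \<in> V \<Longrightarrow> spin_char V (\<lambda>x. spin x v)"
  by (auto simp: spin_char_def spin_mult_def dest: spins_cases)

lemma spin_char_prod: "(\<And>i. i \<in> I \<Longrightarrow> spin_char V (f i)) \<Longrightarrow> spin_char V (\<lambda>x. \<Prod>i\<in>I. f i x)"
  by (induction I rule: infinite_finite_induct) (auto intro: spin_char_one spin_char_mult)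

lemma pos_def_const: "0 \<le> c \<Longrightarrow> pos_def V (\<lambda>x. c)"
  using pos_def.scale[OF pos_def.char[OF spin_char_one], of c] by simp

lemma pos_def_mult:
  assumes "pos_def V f" "pos_def V g"
  shows "pos_def V (\<lambda>x. f x * g x)"
  using assms
proof (induction rule: pos_def.induct)
  case (char \<psi>)
  from char(2) show ?case
  proof (induction rule: pos_def.induct)
    case (char \<psi>')
    then show ?case using \<open>spin_char V \<psi>\<close> by (intro pos_def.char spin_char_mult)
  next
    case (add f g)
    then show ?case using pos_def.add by (fastforce simp: distrib_left)
  next
    case (scale f c)
    from pos_def.scale[OF scale(3) scale(2)] show ?case by (simp add: mult.left_commute)
  qed
next
  case (add f g)
  then show ?case using pos_def.add by (fastforce simp: distrib_right)
next
  case (scale f c)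
  from pos_def.scale[OF scale(3)[OF scale(4)] scale(2)] show ?case by (simp add: mult.assoc)
qed

text \<open>If the character takes the value \<open>-1\<close> at \<open>z\<close>, translation by
  \<open>z\<close> turns the sum into its negative, so it is \<open>0\<close>; otherwise every term
  is \<open>1\<close>.\<close>

lemma sum_spin_char_nonneg:
  assumes "spin_char V \<psi>"
  shows "0 \<le> (\<Sum>x\<in>spins V. \<psi> x)"
proof (cases "\<exists>z\<in>spins V. \<psi> z = -1")
  case True
  then obtain z where z: "z \<in> spins V" "\<psi> z = -1" by blast
  have "(\<Sum>x\<in>spins V. \<psi> x) = (\<Sum>x\<in>spins V. \<psi> (spin_mult V z x))"
    using sum_spin_mult[OF z(1), of \<psi>] by simp
  also have "\<dots> = (\<Sum>x\<in>spins V. - \<psi> x)"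
    using assms z by (intro sum.cong) (auto simp: spin_char_def)
  finally show ?thesis by (simp add: sum_negf)
next
  case False
  then show ?thesis using assms by (intro sum_nonneg) (force simp: spin_char_def)
qed

lemma sum_pos_def_nonneg: "pos_def V f \<Longrightarrow> 0 \<le> (\<Sum>x\<in>spins V. f x)"
  by (induction rule: pos_def.induct)
    (auto simp: sum_spin_char_nonneg sum.distrib sum_distrib_left[symmetric])

lemma pos_def_cong_sum_nonneg:
  "pos_def V f \<Longrightarrow> (\<And>x. x \<in> spins V \<Longrightarrow> g x = f x) \<Longrightarrow> 0 \<le> (\<Sum>x\<in>spins V. g x)"
  using sum_pos_def_nonneg[of V f] by simp

lemma pos_def_affine: "spin_char V \<psi> \<Longrightarrow> 0 \<le> a \<Longrightarrow> 0 \<le> b \<Longrightarrow> pos_def V (\<lambda>x. a + b * \<psi> x)"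
  by (intro pos_def.add pos_def_const pos_def.scale pos_def.char)

lemma ferro_weight_pos_def: "ferro_weight V w \<Longrightarrow> pos_def V w"
  by (induction rule: ferro_weight.induct) (auto intro!: pos_def_mult pos_def_affine pos_def_const)

lemma ferro_weight_nonneg: "ferro_weight V w \<Longrightarrow> x \<in> spins V \<Longrightarrow> 0 \<le> w x"
proof (induction rule: ferro_weight.induct)
  case (mult w \<psi> b a)
  then have "\<psi> x = 1 \<or> \<psi> x = -1" by (auto simp: spin_char_def)
  with mult show ?case by (intro mult_nonneg_nonneg) auto
qed auto

text \<open>The duplicated weight with relative configuration \<open>z\<close> fixed is again positive definite; this
  is where \<open>b \<le> a\<close> enters.\<close>

lemma ferro_weight_duplicate:
  assumes "ferro_weight V w" "z \<in> spins V"
  shows "\<exists>f. pos_def V f \<and> (\<forall>x\<in>spins V. w x * w (spin_mult V z x) = f x)"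
  using assms(1)
proof (induction rule: ferro_weight.induct)
  case one
  then show ?case using pos_def_const[of 1] by auto
next
  case (mult w \<psi> b a)
  then obtain f where f: "pos_def V f" "\<And>x. x \<in> spins V \<Longrightarrow> w x * w (spin_mult V z x) = f x" by blast
  have chi: "\<psi> (spin_mult V z x) = \<psi> z * \<psi> x" "\<psi> x * \<psi> x = 1" if "x \<in> spins V" for x
    using mult(2) that assms(2) unfolding spin_char_def by force+
  consider "\<psi> z = 1" | "\<psi> z = -1" using mult(2) assms(2) by (auto simp: spin_char_def)
  then show ?case
  proof cases
    case 1
    show ?thesis
    proof (intro exI conjI ballI)
      show "pos_def V (\<lambda>x. f x * ((a\<^sup>2 + b\<^sup>2) + (2 * a * b) * \<psi> x))"
        using mult by (intro pos_def_mult f pos_def_affine) auto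
      fix x assume x: "x \<in> spins V"
      have "(a + b * \<psi> x) * (a + b * \<psi> x) = (a\<^sup>2 + b\<^sup>2 * (\<psi> x * \<psi> x)) + (2 * a * b) * \<psi> x"
        by (simp add: algebra_simps power2_eq_square)
      then show "w x * (a + b * \<psi> x) * (w (spin_mult V z x) * (a + b * \<psi> (spin_mult V z x))) =
        f x * ((a\<^sup>2 + b\<^sup>2) + (2 * a * b) * \<psi> x)"
        using f(2)[OF x] chi[OF x] 1 by (simp add: mult.assoc mult.left_commute)
    qed
  next
    case 2
    show ?thesis
    proof (intro exI conjI ballI)
      show "pos_def V (\<lambda>x. f x * (a\<^sup>2 - b\<^sup>2))"
        using mult by (intro pos_def_mult f pos_def_const) (auto intro: power_mono)
      fix x assume x: "x \<in> spins V"
      have "(a + b * \<psi> x) * (a - b * \<psi> x) = a\<^sup>2 - b\<^sup>2 * (\<psi> x * \<psi> x)"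
        by (simp add: algebra_simps power2_eq_square)
      then show "w x * (a + b * \<psi> x) * (w (spin_mult V z x) * (a + b * \<psi> (spin_mult V z x))) =
        f x * (a\<^sup>2 - b\<^sup>2)"
        using f(2)[OF x] chi[OF x] 2 by (simp add: mult.assoc mult.left_commute)
    qed
  qed
qed

text \<open>Ginibre's duplication: the difference of the two sides is a sum over pairs
  \<open>x\<close>, \<open>y\<close>. Writing \<open>y\<close> as the translate of \<open>x\<close>
  by \<open>z\<close> turns the term into \<open>f x * g x * (1 - g z)\<close> times a duplicated
  weight; for fixed \<open>z\<close> the part summed over \<open>x\<close> is positive
  definite.\<close>

lemma griffiths_char:
  assumes w: "ferro_weight V w" and f: "spin_char V f" and g: "spin_char V g"
  shows "(\<Sum>x\<in>spins V. f x * w x) * (\<Sum>x\<in>spins V. g x * w x)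
    \<le> (\<Sum>x\<in>spins V. f x * g x * w x) * (\<Sum>x\<in>spins V. w x)"
proof -
  have "(\<Sum>x\<in>spins V. f x * g x * w x) * (\<Sum>x\<in>spins V. w x)
     - (\<Sum>x\<in>spins V. f x * w x) * (\<Sum>x\<in>spins V. g x * w x)
    = (\<Sum>x\<in>spins V. \<Sum>y\<in>spins V. (f x * g x - f x * g y) * (w x * w y))"
    unfolding sum_product sum_subtractf[symmetric]
    by (intro sum.cong refl) (simp add: algebra_simps)
  also have "\<dots> = (\<Sum>x\<in>spins V. \<Sum>z\<in>spins V.
      (f x * g x - f x * g (spin_mult V x z)) * (w x * w (spin_mult V x z)))"
    by (intro sum.cong refl sum_spin_mult[symmetric])
  also have "\<dots> = (\<Sum>z\<in>spins V. (1 - g z) * (\<Sum>x\<in>spins V. f x * g x * (w x * w (spin_mult V z x))))"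
    by (subst sum.swap, intro sum.cong refl, subst sum_distrib_left, intro sum.cong refl)
      (use g in \<open>auto simp: spin_char_def spin_mult_def algebra_simps\<close>)
  also have "\<dots> \<ge> 0"
  proof (rule sum_nonneg, rule mult_nonneg_nonneg)
    fix z assume z: "z \<in> spins V"
    show "0 \<le> 1 - g z" using g z by (fastforce simp: spin_char_def)
    obtain h where h: "pos_def V h" "\<And>x. x \<in> spins V \<Longrightarrow> w x * w (spin_mult V z x) = h x"
      using ferro_weight_duplicate[OF w z] by blast
    show "0 \<le> (\<Sum>x\<in>spins V. f x * g x * (w x * w (spin_mult V z x)))"
      by (rule pos_def_cong_sum_nonneg[OF
            pos_def_mult[OF pos_def_mult[OF pos_def.char[OF f] pos_def.char[OF g]] h(1)]])
        (simp add: h(2))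
  qed
  finally show ?thesis by simp
qed

lemma griffiths:
  assumes w: "ferro_weight V w" and f: "pos_def V f" and g: "pos_def V g"
  shows "(\<Sum>x\<in>spins V. f x * w x) * (\<Sum>x\<in>spins V. g x * w x)
    \<le> (\<Sum>x\<in>spins V. f x * g x * w x) * (\<Sum>x\<in>spins V. w x)"
  using f
proof (induction rule: pos_def.induct)
  case (char f)
  from g show ?case
  proof (induction rule: pos_def.induct)
    case (char g)
    then show ?case using griffiths_char w \<open>spin_char V f\<close> by blast
  next
    case (add g h)
    then show ?case by (simp add: distrib_left distrib_right sum.distrib)
  next
    case (scale g c)
    have "(\<Sum>x\<in>spins V. c * g x * w x) = c * (\<Sum>x\<in>spins V. g x * w x)"
      "(\<Sum>x\<in>spins V. f x * (c * g x) * w x) = c * (\<Sum>x\<in>spins V. f x * g x * w x)"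
      by (simp_all only: sum_distrib_left mult_ac)
    with mult_left_mono[OF scale(3,2)] show ?case by (simp add: mult_ac)
  qed
next
  case (add f h)
  then show ?case by (simp add: distrib_left distrib_right sum.distrib)
next
  case (scale f c)
  have "(\<Sum>x\<in>spins V. c * f x * w x) = c * (\<Sum>x\<in>spins V. f x * w x)"
    "(\<Sum>x\<in>spins V. c * f x * g x * w x) = c * (\<Sum>x\<in>spins V. f x * g x * w x)"
    by (simp_all only: sum_distrib_left mult_ac)
  with mult_left_mono[OF scale(3,2)] show ?case by (simp add: mult_ac)
qed

lemma ferro_weight_prod:
  assumes "ferro_weight V w" "\<And>i. i \<in> I \<Longrightarrow> spin_char V (\<psi> i)" "\<And>i. i \<in> I \<Longrightarrow> 0 \<le> b i"
    "\<And>i. i \<in> I \<Longrightarrow> b i \<le> a i"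
  shows "ferro_weight V (\<lambda>x. w x * (\<Prod>i\<in>I. a i + b i * \<psi> i x))"
  using assms(2-)
proof (induction I rule: infinite_finite_induct)
  case (insert i I)
  then have "ferro_weight V (\<lambda>x. w x * (\<Prod>i\<in>I. a i + b i * \<psi> i x) * (a i + b i * \<psi> i x))"
    by (intro ferro_weight.mult) auto
  then show ?case using insert by (simp add: mult_ac)
qed (use assms(1) in auto)

definition gibbs :: "'a set \<Rightarrow> (('a \<Rightarrow> int) \<Rightarrow> real) \<Rightarrow> (('a \<Rightarrow> int) \<Rightarrow> real) \<Rightarrow> real" where
  "gibbs V w f = (\<Sum>x\<in>spins V. f x * w x) / (\<Sum>x\<in>spins V. w x)"

text \<open>Both boundary comparisons are of this kind: restoring deleted edges and freezing a
  sphere at plus multiply the weight by a positive definite \<open>g\<close>. As \<open>g\<close>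
  may vanish, positivity of the new total mass is a separate premise.\<close>

lemma gibbs_mono_weight:
  assumes "ferro_weight V w" "pos_def V f" "pos_def V g"
    "0 < (\<Sum>x\<in>spins V. w x)" "0 < (\<Sum>x\<in>spins V. w x * g x)"
  shows "gibbs V w f \<le> gibbs V (\<lambda>x. w x * g x) f"
  using griffiths[OF assms(1-3)] assms(4,5) unfolding gibbs_def
  by (subst pos_divide_le_eq, simp, subst times_divide_eq_left, subst pos_le_divide_eq)
    (simp_all add: mult_ac)

lemma gibbs_cong:
  "(\<And>x. x \<in> spins V \<Longrightarrow> w x = w' x) \<Longrightarrow> (\<And>x. x \<in> spins V \<Longrightarrow> f x = f' x) \<Longrightarrow> gibbs V w f = gibbs V w' f'"
  by (simp add: gibbs_def)

text \<open>The high-temperature identity; since \<open>0 \<le> sinh J \<le> cosh J\<close> for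
  \<open>0 \<le> J\<close>, it puts Boltzmann factors into the form required by
  \<open>ferro_weight\<close>.\<close>

lemma exp_spin_char: "\<psi> = 1 \<or> \<psi> = -1 \<Longrightarrow> exp (J * \<psi>) = cosh J + sinh J * (\<psi>::real)"
  by (auto simp: cosh_plus_sinh cosh_minus_sinh)

section \<open>Sums over configurations on disjoint vertex sets\<close>

definition spin_join :: "'a set \<Rightarrow> 'a set \<Rightarrow> ('a \<Rightarrow> int) \<Rightarrow> ('a \<Rightarrow> int) \<Rightarrow> 'a \<Rightarrow> int" where
  "spin_join A B y z = (\<lambda>v\<in>A \<union> B. if v \<in> A then y v else z v)"

lemma restrict_spins: "x \<in> spins V \<Longrightarrow> A \<subseteq> V \<Longrightarrow> restrict x A \<in> spins A"
  unfolding spins_def by (auto dest!: PiE_mem)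

lemma spin_join_in: "y \<in> spins A \<Longrightarrow> z \<in> spins B \<Longrightarrow> spin_join A B y z \<in> spins (A \<union> B)"
  unfolding spins_def spin_join_def by (rule restrict_PiE_iff[THEN iffD2]) (auto dest: PiE_mem)

lemma restrict_spin_join:
  assumes "A \<inter> B = {}" "y \<in> spins A" "z \<in> spins B"
  shows "restrict (spin_join A B y z) A = y" "restrict (spin_join A B y z) B = z"
  using assms by (auto simp: spin_join_def restrict_def fun_eq_iff spins_def PiE_def extensional_def)

lemma spin_join_restrict:
  assumes "x \<in> spins (A \<union> B)"
  shows "spin_join A B (restrict x A) (restrict x B) = x"
  using assms by (auto simp: spin_join_def restrict_def fun_eq_iff spins_def PiE_def extensional_def)

lemma sum_spins_split:
  assumes "A \<inter> B = {}"
  shows "(\<Sum>x\<in>spins (A \<union> B). f x) = (\<Sum>y\<in>spins A. \<Sum>z\<in>spins B. f (spin_join A B y z))"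
proof -
  have "(\<Sum>x\<in>spins (A \<union> B). f x) = (\<Sum>(y, z)\<in>spins A \<times> spins B. f (spin_join A B y z))"
    by (rule sum.reindex_bij_witness[of _ "\<lambda>(y, z). spin_join A B y z"
          "\<lambda>x. (restrict x A, restrict x B)"])
      (use assms in \<open>auto simp: spin_join_in restrict_spins spin_join_restrict restrict_spin_join\<close>)
  then show ?thesis by (simp add: sum.cartesian_product)
qed

lemma sum_spins_product:
  fixes g h :: "('a \<Rightarrow> int) \<Rightarrow> real"
  assumes "A \<inter> B = {}" "\<And>x. x \<in> spins (A \<union> B) \<Longrightarrow> f x = g (restrict x A) * h (restrict x B)"
  shows "(\<Sum>x\<in>spins (A \<union> B). f x) = (\<Sum>y\<in>spins A. g y) * (\<Sum>z\<in>spins B. h z)"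
  unfolding sum_spins_split[OF assms(1)] sum_product
  by (intro sum.cong refl) (simp add: assms(2) spin_join_in restrict_spin_join[OF assms(1)])

section \<open>Ising measures on balls of the tree\<close>

abbreviation words :: "nat \<Rightarrow> letter list set" where
  "words r \<equiv> carrier (free_group r)"

text \<open>Generators multiply from the left, so dropping the head letter of a reduced word is the
  step towards the root: \<open>tl\<close> is the parent map of the Cayley tree. As
  \<open>tl [] = []\<close>, sums over edges leave out the root.\<close>

definition word_ball :: "nat \<Rightarrow> nat \<Rightarrow> letter list set" where
  "word_ball r R = {w \<in> words r. length w \<le> R}"

definition word_sphere :: "nat \<Rightarrow> nat \<Rightarrow> letter list set" where
  "word_sphere r R = {w \<in> words r. length w = R}"

lemma Nil_in_carrier [simp]: "[] \<in> words r"
  by (simp add: free_group_def reduced_def)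

lemma Cons_in_carrier:
  "a # w \<in> words r \<longleftrightarrow>
    fst a < r \<and> w \<in> words r \<and> (w = [] \<or> hd w \<noteq> inv_letter a)"
  by (cases w; cases a) (auto simp: free_group_def reduced_def)

lemma tl_in_carrier: "w \<in> words r \<Longrightarrow> tl w \<in> words r"
  by (cases w) (auto simp: Cons_in_carrier)

lemma finite_word_ball [simp]: "finite (word_ball r R)"
proof (rule finite_subset)
  show "word_ball r R \<subseteq> {w. set w \<subseteq> {..<r} \<times> UNIV \<and> length w \<le> R}"
    by (auto simp: word_ball_def free_group_def)
qed (intro finite_lists_length_le, simp)

lemma word_sphere_subset: "word_sphere r R \<subseteq> word_ball r R"
  by (auto simp: word_sphere_def word_ball_def)

lemma finite_word_sphere [simp]: "finite (word_sphere r R)"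
  by (rule finite_subset[OF word_sphere_subset]) simp

lemma word_ball_Suc: "word_ball r (Suc R) = word_ball r R \<union> word_sphere r (Suc R)"
  "word_ball r R \<inter> word_sphere r (Suc R) = {}"
  by (auto simp: word_sphere_def word_ball_def)

lemma word_ball_mono: "R \<le> S \<Longrightarrow> word_ball r R \<subseteq> word_ball r S"
  by (auto simp: word_ball_def)

lemma tl_in_word_ball: "w \<in> word_ball r R \<Longrightarrow> tl w \<in> word_ball r R"
  by (auto simp: word_ball_def tl_in_carrier)

lemma tl_word_sphere_Suc: "w \<in> word_sphere r (Suc R) \<Longrightarrow> tl w \<in> word_sphere r R"
  by (auto simp: word_sphere_def tl_in_carrier)

lemma card_children:
  assumes "w \<in> words r" "w \<noteq> []"
  shows "card {a. a # w \<in> words r} = 2 * r - 1"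
proof -
  have "{a. a # w \<in> words r} = {..<r} \<times> UNIV - {inv_letter (hd w)}"
    using assms by (auto simp: Cons_in_carrier)
  moreover have "inv_letter (hd w) \<in> {..<r} \<times> UNIV"
    using assms by (cases w) (auto simp: Cons_in_carrier inv_letter_def)
  ultimately show ?thesis by (simp add: card_Diff_singleton card_cartesian_product)
qed

text \<open>The root has \<open>2 * r\<close> children and every other word
  \<open>2 * r - 1\<close>; this is the source of the premise \<open>R \<ge> 1\<close> in the
  recursion over spheres.\<close>

lemma sum_word_sphere_Suc:
  assumes "R \<ge> 1"
  shows "(\<Sum>w\<in>word_sphere r (Suc R). g (tl w)) = real (2 * r - 1) * (\<Sum>w\<in>word_sphere r R. g w)"
proof -
  have "(\<Sum>w\<in>word_sphere r (Suc R). g (tl w)) =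
    (\<Sum>(w, a)\<in>(SIGMA w:word_sphere r R. {a. a # w \<in> words r}). g w)"
  proof (rule sum.reindex_bij_witness[of _ "\<lambda>(w, a). a # w" "\<lambda>w. (tl w, hd w)"])
    fix w assume "w \<in> word_sphere r (Suc R)"
    then show "(tl w, hd w) \<in> (SIGMA w:word_sphere r R. {a. a # w \<in> words r})"
      by (cases w) (auto simp: word_sphere_def Cons_in_carrier)
  qed (auto simp: word_sphere_def length_Suc_conv)
  also have "\<dots> = (\<Sum>w\<in>word_sphere r R. real (card {a. a # w \<in> words r}) * g w)"
  proof (subst sum.Sigma[symmetric])
    show "\<forall>w\<in>word_sphere r R. finite {a. a # w \<in> words r}"
      by (auto intro: finite_subset[of _ "{..<r} \<times> UNIV"] simp: Cons_in_carrier)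
  qed auto
  also have "\<dots> = (\<Sum>w\<in>word_sphere r R. real (2 * r - 1) * g w)"
    by (intro sum.cong refl arg_cong2[of _ _ _ _ "(*)"] arg_cong[of _ _ real] card_children)
      (use assms in \<open>auto simp: word_sphere_def\<close>)
  finally show ?thesis by (simp add: sum_distrib_left)
qed

text \<open>On the outer sphere \<open>h\<close> replaces \<open>B\<close> instead of being added to
  it. Thus \<open>h = B\<close> is the free boundary condition, and
  \<open>h = B + real (2 * r - 1) * J\<close> is the effect of plus spins one step further
  out.\<close>

definition tree_weight ::
  "nat \<Rightarrow> nat \<Rightarrow> real \<Rightarrow> real \<Rightarrow> real \<Rightarrow> (letter list \<Rightarrow> int) \<Rightarrow> real" where
  "tree_weight r R J B h x =
     exp (J * (\<Sum>w\<in>word_ball r R - {[]}. spin x w * spin x (tl w))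
        + B * (\<Sum>w\<in>word_ball r R - word_sphere r R. spin x w)
        + h * (\<Sum>w\<in>word_sphere r R. spin x w))"

definition tree_mean ::
  "nat \<Rightarrow> nat \<Rightarrow> real \<Rightarrow> real \<Rightarrow> real \<Rightarrow> ((letter list \<Rightarrow> int) \<Rightarrow> real) \<Rightarrow> real" where
  "tree_mean r R J B h = gibbs (word_ball r R) (tree_weight r R J B h)"

text \<open>This is \<open>artanh (tanh J * tanh s)\<close>: the effective field that a vertex with
  field \<open>s\<close> exerts on a neighbour through the coupling \<open>J\<close>.\<close>

definition cavity :: "real \<Rightarrow> real \<Rightarrow> real" where
  "cavity J s = ln (cosh (J + s) / cosh (J - s)) / 2"

text \<open>Summing out a leaf \<open>s\<close> attached to \<open>e\<close>. The sum is
  \<open>2 * cosh (J + h)\<close> or \<open>2 * cosh (J - h)\<close> according to the sign of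
  \<open>e\<close>; the geometric mean of the two is the constant, and half the logarithm of their
  ratio is the field on \<open>e\<close>.\<close>

lemma cavity_sum:
  assumes "e = 1 \<or> e = (-1::int)"
  shows "(\<Sum>s\<in>{-1, 1::int}. exp (J * (real_of_int s * real_of_int e) + h * real_of_int s))
    = 2 * sqrt (cosh (J + h) * cosh (J - h)) * exp (cavity J h * real_of_int e)"
proof -
  let ?a = "cosh (J + h)" and ?b = "cosh (J - h)"
  have pos: "?a > 0" "?b > 0" by simp_all
  have *: "exp (cavity J h) = sqrt (?a / ?b)" "exp (- cavity J h) = sqrt (?b / ?a)"
    using pos by (simp_all add: cavity_def sqrt_def root_powr_inverse powr_def ln_div field_simps)
  have "sqrt (?a * ?b) * sqrt (?a / ?b) = ?a" "sqrt (?a * ?b) * sqrt (?b / ?a) = ?b"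
    using pos by (simp_all flip: real_sqrt_mult)
  moreover have "2 * ?a = exp (J + h) + exp (- J - h)" "2 * ?b = exp (J - h) + exp (- J + h)"
    by (simp_all add: cosh_def)
  ultimately show ?thesis
    using assms * by (auto simp: mult.assoc)
qed

text \<open>Each leaf of the outermost sphere is summed out by \<open>cavity_sum\<close>, and the
  \<open>2 * r - 1\<close> fields arriving at a common parent add up. The constant precedes
  \<open>f\<close> in the quantifiers so that it cancels in \<open>gibbs\<close>.\<close>

lemma sum_tree_weight_Suc:
  assumes R: "R \<ge> 1"
  shows "\<exists>c>0. \<forall>f. (\<forall>x. f (restrict x (word_ball r R)) = f x) \<longrightarrow>
    (\<Sum>x\<in>spins (word_ball r (Suc R)). f x * tree_weight r (Suc R) J B h x) =
    c * (\<Sum>x\<in>spins (word_ball r R). f x * tree_weight r R J B (B + real (2 * r - 1) * cavity J h) x)"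
proof (intro exI conjI allI impI)
  let ?A = "word_ball r R" and ?S = "word_sphere r (Suc R)"
  let ?c = "(2 * sqrt (cosh (J + h) * cosh (J - h))) ^ card ?S"
  show "?c > 0" by simp
  fix f :: "(letter list \<Rightarrow> int) \<Rightarrow> real" assume f: "\<forall>x. f (restrict x ?A) = f x"
  let ?E = "\<lambda>y. J * (\<Sum>w\<in>?A - {[]}. spin y w * spin y (tl w))
      + B * (\<Sum>w\<in>?A. spin y w)"
  have split: "tree_weight r (Suc R) J B h (spin_join ?A ?S y z) = exp (?E y) *
      (\<Prod>w\<in>?S. exp (J * (spin z w * spin y (tl w)) + h * spin z w))"
    for y z
  proof -
    let ?x = "spin_join ?A ?S y z"
    have xA: "?x w = y w" if "w \<in> ?A" for w using that by (simp add: spin_join_def)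
    have xS: "?x w = z w" "?x (tl w) = y (tl w)" if "w \<in> ?S" for w
      using that tl_word_sphere_Suc[OF that] by (auto simp: spin_join_def word_sphere_def word_ball_def)
    have B: "word_ball r (Suc R) - {[]} = (?A - {[]}) \<union> ?S" "(?A - {[]}) \<inter> ?S = {}"
      "word_ball r (Suc R) - ?S = ?A"
      by (auto simp: word_ball_def word_sphere_def)
    have "(\<Sum>w\<in>?A - {[]}. spin ?x w * spin ?x (tl w)) =
        (\<Sum>w\<in>?A - {[]}. spin y w * spin y (tl w))"
      by (intro sum.cong refl) (simp add: xA tl_in_word_ball)
    moreover have "(\<Sum>w\<in>?S. spin ?x w * spin ?x (tl w)) =
        (\<Sum>w\<in>?S. spin z w * spin y (tl w))"
      by (intro sum.cong refl) (simp add: xS)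
    moreover have "(\<Sum>w\<in>?S. spin ?x w) = (\<Sum>w\<in>?S. spin z w)"
      "(\<Sum>w\<in>?A. spin ?x w) = (\<Sum>w\<in>?A. spin y w)"
      by (intro sum.cong refl; simp add: xS xA)+
    moreover have "(\<Prod>w\<in>?S. exp (J * (spin z w * spin y (tl w)) + h * spin z w))
      = exp (J * (\<Sum>w\<in>?S. spin z w * spin y (tl w)) + h * (\<Sum>w\<in>?S. spin z w))"
      by (simp only: exp_sum[symmetric, OF finite_word_sphere] sum.distrib sum_distrib_left)
    ultimately show ?thesis
      unfolding tree_weight_def B(3) unfolding B(1)
      by (subst sum.union_disjoint) (use B(2) in \<open>simp_all add: exp_add[symmetric] algebra_simps\<close>)
  qed
  have leaf: "(\<Sum>z\<in>spins ?S. \<Prod>w\<in>?S.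
        exp (J * (spin z w * spin y (tl w)) + h * spin z w))
      = ?c * exp (real (2 * r - 1) * cavity J h * (\<Sum>w\<in>word_sphere r R. spin y w))"
    if y: "y \<in> spins ?A" for y
  proof -
    have "(\<Sum>z\<in>spins ?S. \<Prod>w\<in>?S.
        exp (J * (spin z w * spin y (tl w)) + h * spin z w))
      = (\<Prod>w\<in>?S. \<Sum>s\<in>{-1, 1::int}.
          exp (J * (real_of_int s * spin y (tl w)) + h * real_of_int s))"
      unfolding spins_def by (subst prod_sum_PiE) auto
    also have "\<dots> = (\<Prod>w\<in>?S. 2 * sqrt (cosh (J + h) * cosh (J - h)) *
        exp (cavity J h * spin y (tl w)))"
    proof (intro prod.cong refl cavity_sum)
      fix w assume "w \<in> ?S"
      then have "tl w \<in> ?A" using tl_word_sphere_Suc word_sphere_subset by blast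
      then show "y (tl w) = 1 \<or> y (tl w) = -1" using spins_cases[OF y] by blast
    qed
    also have "\<dots> = ?c * exp (cavity J h * (\<Sum>w\<in>?S. spin y (tl w)))"
      by (simp add: prod.distrib exp_sum sum_distrib_left)
    finally show ?thesis
      using sum_word_sphere_Suc[OF R, of "\<lambda>w. spin y w" r] by (simp add: mult_ac)
  qed
  have int: "(\<Sum>w\<in>?A. spin y w) =
      (\<Sum>w\<in>?A - word_sphere r R. spin y w) + (\<Sum>w\<in>word_sphere r R. spin y w)" for y
    by (rule sum.subset_diff) (use word_sphere_subset in auto)
  have "(\<Sum>x\<in>spins (word_ball r (Suc R)). f x * tree_weight r (Suc R) J B h x) =
    (\<Sum>y\<in>spins ?A. \<Sum>z\<in>spins ?S. f y * (exp (?E y) *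
      (\<Prod>w\<in>?S. exp (J * (spin z w * spin y (tl w)) + h * spin z w))))"
    unfolding word_ball_Suc(1) sum_spins_split[OF word_ball_Suc(2)]
  proof (intro sum.cong refl)
    fix y z assume yz: "y \<in> spins ?A" "z \<in> spins ?S"
    have "f (spin_join ?A ?S y z) = f y"
      using f restrict_spin_join(1)[OF word_ball_Suc(2) yz] by metis
    then show "f (spin_join ?A ?S y z) * tree_weight r (Suc R) J B h (spin_join ?A ?S y z) =
      f y * (exp (?E y) *
      (\<Prod>w\<in>?S. exp (J * (spin z w * spin y (tl w)) + h * spin z w)))"
      by (simp only: split)
  qed
  also have "\<dots> = (\<Sum>y\<in>spins ?A. f y * (exp (?E y) *
      (?c * exp (real (2 * r - 1) * cavity J h * (\<Sum>w\<in>word_sphere r R. spin y w)))))"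
    by (intro sum.cong refl) (simp only: sum_distrib_left[symmetric] leaf)
  also have "\<dots> = (\<Sum>y\<in>spins ?A. ?c * (f y * tree_weight r R J B (B + real (2 * r - 1) * cavity J h) y))"
    unfolding tree_weight_def int
    by (intro sum.cong refl) (simp add: exp_add[symmetric] algebra_simps)
  finally show "(\<Sum>x\<in>spins (word_ball r (Suc R)). f x * tree_weight r (Suc R) J B h x) = ?c *
    (\<Sum>x\<in>spins (word_ball r R). f x * tree_weight r R J B (B + real (2 * r - 1) * cavity J h) x)"
    by (simp only: sum_distrib_left)
qed

lemma tree_mean_Suc:
  assumes "R \<ge> 1" "\<And>x. f (restrict x (word_ball r R)) = f x"
  shows "tree_mean r (Suc R) J B h f = tree_mean r R J B (B + real (2 * r - 1) * cavity J h) f"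
proof -
  obtain c where c: "c > 0" "\<forall>f. (\<forall>x. f (restrict x (word_ball r R)) = f x) \<longrightarrow>
    (\<Sum>x\<in>spins (word_ball r (Suc R)). f x * tree_weight r (Suc R) J B h x) =
    c * (\<Sum>x\<in>spins (word_ball r R). f x * tree_weight r R J B (B + real (2 * r - 1) * cavity J h) x)"
    using sum_tree_weight_Suc[OF assms(1), of r J B h] by (elim exE conjE)
  from c(2)[rule_format, of f] c(2)[rule_format, of "\<lambda>x. 1"] c(1) assms(2) show ?thesis
    by (simp add: tree_mean_def gibbs_def)
qed

text \<open>A boundary condition at depth \<open>R + n\<close> is felt in the ball of radius
  \<open>R\<close> only through the \<open>n\<close>-th iterate of the cavity recursion.\<close>

lemma tree_mean_iterate:
  assumes "R \<ge> 1" "\<And>x. f (restrict x (word_ball r R)) = f x"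
  shows "tree_mean r (R + n) J B h f =
    tree_mean r R J B (((\<lambda>h. B + real (2 * r - 1) * cavity J h) ^^ n) h) f"
proof (induction n arbitrary: h)
  case (Suc n)
  have "f (restrict x (word_ball r (R + n))) = f x" for x
  proof -
    have "restrict (restrict x (word_ball r (R + n))) (word_ball r R) = restrict x (word_ball r R)"
      using word_ball_mono[of R "R + n" r] by (auto simp: restrict_def fun_eq_iff)
    then show ?thesis using assms(2) by metis
  qed
  then show ?case
    using tree_mean_Suc[of "R + n" f r J B h] assms(1) Suc by (simp add: funpow_Suc_right del:
      funpow.simps(2))
qed simp

lemma tree_weight_pos [simp]: "tree_weight r R J B h x > 0"
  by (simp add: tree_weight_def)

lemma sum_pos_spins: "finite V \<Longrightarrow> (\<And>x. x \<in> spins V \<Longrightarrow> (0::real) < w x) \<Longrightarrow> 0 < (\<Sum>x\<in>spins V. w x)"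
  by (intro sum_pos) (auto simp: spins_nonempty)

lemma tendsto_tree_mean:
  assumes "(J \<longlongrightarrow> J0) F" "(B \<longlongrightarrow> B0) F" "(h \<longlongrightarrow> h0) F"
  shows "((\<lambda>n. tree_mean r R (J n) (B n) (h n) f) \<longlongrightarrow> tree_mean r R J0 B0 h0 f) F"
proof -
  have "(\<Sum>x\<in>spins (word_ball r R). tree_weight r R J0 B0 h0 x) > 0"
    by (intro sum_pos_spins) auto
  then show ?thesis
    unfolding tree_mean_def gibbs_def tree_weight_def
    by (intro tendsto_intros assms) (auto simp: tree_weight_def)
qed

section \<open>Comparison of a tree-like neighbourhood with the tree\<close>

text \<open>These are the Walsh functions, i.e. characters of the spin group: Griffiths' inequality
  applies to each of them, and by \<open>local_function_expansion\<close> they span the local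
  functions.\<close>

definition spin_prod :: "'a set \<Rightarrow> ('a \<Rightarrow> int) \<Rightarrow> real" where
  "spin_prod A x = (\<Prod>a\<in>A. spin x a)"

lemma spin_prod_restrict: "A \<subseteq> U \<Longrightarrow> spin_prod A (restrict x U) = spin_prod A x"
  unfolding spin_prod_def by (rule prod.cong) auto

definition spin_flip :: "'a set \<Rightarrow> ('a \<Rightarrow> int) \<Rightarrow> 'a \<Rightarrow> int" where
  "spin_flip V x = (\<lambda>v\<in>V. - x v)"

lemma spin_flip_in: "x \<in> spins V \<Longrightarrow> spin_flip V x \<in> spins V"
  unfolding spins_def spin_flip_def by (rule restrict_PiE_iff[THEN iffD2]) (auto dest!: PiE_mem)

lemma spin_flip_flip: "x \<in> spins V \<Longrightarrow> spin_flip V (spin_flip V x) = x"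
  by (auto simp: spin_flip_def spins_def PiE_def extensional_def fun_eq_iff)

lemma spin_prod_flip:
  assumes "\<phi> ` A \<subseteq> V"
  shows "spin_prod A (\<lambda>a. spin_flip V x (\<phi> a)) = (-1) ^ card A * spin_prod A (\<lambda>a. x (\<phi> a))"
proof -
  have "spin_prod A (\<lambda>a. spin_flip V x (\<phi> a)) = (\<Prod>a\<in>A. (-1) * spin x (\<phi> a))"
    unfolding spin_prod_def by (rule prod.cong) (use assms in \<open>auto simp: spin_flip_def\<close>)
  then show ?thesis by (simp only: prod.distrib prod_constant spin_prod_def)
qed

lemma spin_char_spin_prod:
  assumes "\<phi> ` A \<subseteq> V"
  shows "spin_char V (\<lambda>x. spin_prod A (\<lambda>w. x (\<phi> w)))"
  unfolding spin_prod_def by (rule spin_char_prod) (use assms in \<open>auto intro: spin_char_spin\<close>)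

lemma spin_real_cases: "x \<in> spins V \<Longrightarrow> v \<in> V \<Longrightarrow> spin x v = 1 \<or> spin x v = -1"
  using spins_cases[of x V v] by auto

lemma sum_spins_reindex:
  assumes "inj_on \<phi> D"
  shows "(\<Sum>y\<in>spins (\<phi> ` D). G (\<lambda>w\<in>D. y (\<phi> w))) = (\<Sum>z\<in>spins D. G z)"
proof (rule sum.reindex_bij_witness[of _ "\<lambda>z. \<lambda>u\<in>\<phi> ` D. z (the_inv_into D \<phi> u)" "\<lambda>y. \<lambda>w\<in>D. y (\<phi> w)"])
  fix y assume y: "y \<in> spins (\<phi> ` D)"
  show "(\<lambda>u\<in>\<phi> ` D. (\<lambda>w\<in>D. y (\<phi> w)) (the_inv_into D \<phi> u)) = y"
    using y assms by (auto simp: fun_eq_iff the_inv_into_f_f spins_def PiE_def extensional_def)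
  show "(\<lambda>w\<in>D. y (\<phi> w)) \<in> spins D" using y by (auto simp: spins_def dest!: PiE_mem)
next
  fix z assume z: "z \<in> spins D"
  show "(\<lambda>w\<in>D. (\<lambda>u\<in>\<phi> ` D. z (the_inv_into D \<phi> u)) (\<phi> w)) = z"
    using z assms by (auto simp: fun_eq_iff the_inv_into_f_f spins_def PiE_def extensional_def)
  show "(\<lambda>u\<in>\<phi> ` D. z (the_inv_into D \<phi> u)) \<in> spins (\<phi> ` D)"
    using z assms by (auto simp: spins_def the_inv_into_f_f dest!: PiE_mem)
qed simp

text \<open>The spatial Markov property in the form needed for both boundary conditions: once the
  embedded ball is decoupled from the rest, an observable of the ball factors out with its tree
  expectation, whatever function \<open>g\<close> of the outer spins accompanies it. In the second
  moment \<open>g\<close> is the observable of another ball.\<close>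

lemma sum_tree_factor:
  fixes W :: "('v \<Rightarrow> int) \<Rightarrow> real"
  assumes inj: "inj_on \<phi> (word_ball r R)" and sub: "\<phi> ` word_ball r R \<subseteq> V"
    and W: "\<And>x. x \<in> spins V \<Longrightarrow> W x = tree_weight r R J B h (\<lambda>w\<in>word_ball r R. x (\<phi> w)) *
      Wout (restrict x (V - \<phi> ` word_ball r R))"
    and F: "\<And>x. F (restrict x (word_ball r R)) = F x"
    and g: "\<And>x. g (restrict x (V - \<phi> ` word_ball r R)) = g x"
  shows "(\<Sum>x\<in>spins V. F (\<lambda>w. x (\<phi> w)) * g x * W x) =
    tree_mean r R J B h F * (\<Sum>x\<in>spins V. g x * W x)"
proof -
  let ?D = "word_ball r R"
  let ?A = "\<phi> ` ?D"
  have V: "V = ?A \<union> (V - ?A)" "?A \<inter> (V - ?A) = {}" using sub by auto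
  have res: "(\<lambda>w\<in>?D. restrict x ?A (\<phi> w)) = (\<lambda>w\<in>?D. x (\<phi> w))" for x :: "'v \<Rightarrow> int"
    by (auto simp: restrict_def fun_eq_iff)
  have main: "(\<Sum>x\<in>spins V. F (\<lambda>w. x (\<phi> w)) * g x * W x) =
      (\<Sum>z\<in>spins ?D. F z * tree_weight r R J B h z) * (\<Sum>x\<in>spins (V - ?A). g x * Wout x)"
    if F: "\<And>x. F (restrict x ?D) = F x" for F :: "(letter list \<Rightarrow> int) \<Rightarrow> real"
  proof -
    have "(\<Sum>x\<in>spins (?A \<union> (V - ?A)). F (\<lambda>w. x (\<phi> w)) * g x * W x) =
      (\<Sum>y\<in>spins ?A. F (\<lambda>w\<in>?D. y (\<phi> w)) * tree_weight r R J B h (\<lambda>w\<in>?D. y (\<phi> w))) *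
      (\<Sum>x\<in>spins (V - ?A). g x * Wout x)"
    proof (rule sum_spins_product[OF V(2)])
      fix x assume "x \<in> spins (?A \<union> (V - ?A))"
      then have x: "x \<in> spins V" using V(1) by simp
      have "F (\<lambda>w\<in>?D. x (\<phi> w)) = F (\<lambda>w. x (\<phi> w))" by (rule F)
      then show "F (\<lambda>w. x (\<phi> w)) * g x * W x =
        F (\<lambda>w\<in>?D. restrict x ?A (\<phi> w)) * tree_weight r R J B h (\<lambda>w\<in>?D. restrict x ?A (\<phi> w)) *
        (g (restrict x (V - ?A)) * Wout (restrict x (V - ?A)))"
        unfolding res W[OF x] g by simp
    qed
    then show ?thesis
      unfolding V(1)[symmetric]
      using sum_spins_reindex[OF inj, of "\<lambda>z. F z * tree_weight r R J B h z"] by simp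
  qed
  have Z: "(\<Sum>z\<in>spins ?D. tree_weight r R J B h z) > 0" by (intro sum_pos_spins) auto
  have "(\<Sum>x\<in>spins V. g x * W x) = (\<Sum>x\<in>spins V. 1 * g x * W x)" by simp
  also have "\<dots> = (\<Sum>z\<in>spins ?D. 1 * tree_weight r R J B h z) * (\<Sum>x\<in>spins (V - ?A). g x * Wout x)"
    by (rule main) simp
  finally show ?thesis
    unfolding main[where F = F, OF F] using Z by (simp add: tree_mean_def gibbs_def)
qed

text \<open>Each \<open>\<sigma> g\<close> is a permutation, but \<open>\<sigma>\<close> is not
  assumed to be a homomorphism, not even at the identity; the relations used near a vertex are
  collected in \<open>treelike\<close>.\<close>

locale perm_model =
  fixes r :: nat and V :: "'v set" and \<sigma> :: "letter list \<Rightarrow> 'v \<Rightarrow> 'v"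
  assumes finite_V: "finite V"
    and perm: "g \<in> words r \<Longrightarrow> \<sigma> g permutes V"
begin

definition edges :: "(nat \<times> 'v) set" where
  "edges = {..<r} \<times> V"

text \<open>The edge starts at \<open>\<sigma> [] v\<close> rather than at \<open>v\<close>, so that
  the energy is exactly \<open>card V\<close> times a sum of averaged local products
  (\<open>energy_eq_avg\<close>), even where \<open>\<sigma> []\<close> moves points.\<close>

definition edge_term :: "nat \<times> 'v \<Rightarrow> ('v \<Rightarrow> int) \<Rightarrow> real" where
  "edge_term e x = spin x (\<sigma> [] (snd e)) * spin x (\<sigma> [(fst e, True)] (snd e))"

definition energy :: "('v \<Rightarrow> int) \<Rightarrow> real" where
  "energy x = (\<Sum>e\<in>edges. edge_term e x)"

definition magn :: "('v \<Rightarrow> int) \<Rightarrow> real" where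
  "magn x = (\<Sum>v\<in>V. spin x v)"

definition ising_weight :: "real \<Rightarrow> real \<Rightarrow> ('v \<Rightarrow> int) \<Rightarrow> real" where
  "ising_weight J B x = exp (J * energy x + B * magn x)"

text \<open>The ball is embedded together with its edges. The condition on
  \<open>\<sigma> []\<close> matches the starting points in \<open>edge_term\<close>. The last two
  conditions treat the edge to the parent by its orientation: from parent to child for a head letter
  \<open>s_i\<close>, from child to parent for its inverse.\<close>

definition treelike :: "nat \<Rightarrow> 'v \<Rightarrow> bool" where
  "treelike R v \<longleftrightarrow> v \<in> V \<and> inj_on (\<lambda>w. \<sigma> w v) (word_ball r R) \<and>
     (\<forall>w\<in>word_ball r R. \<sigma> [] (\<sigma> w v) = \<sigma> w v) \<and>
     (\<forall>i w. (i, True) # w \<in> word_ball r R \<longrightarrow> \<sigma> [(i, True)] (\<sigma> w v) = \<sigma> ((i, True) # w) v) \<and>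
     (\<forall>i w. (i, False) # w \<in> word_ball r R \<longrightarrow> \<sigma> [(i, True)] (\<sigma> ((i, False) # w) v) = \<sigma> w v)"

text \<open>The index of the edge joining \<open>w\<close> to its parent: an index stores the
  generator and the end at which that generator is applied.\<close>

definition word_edge :: "'v \<Rightarrow> letter list \<Rightarrow> nat \<times> 'v" where
  "word_edge v w = (fst (hd w), if snd (hd w) then \<sigma> (tl w) v else \<sigma> w v)"

text \<open>The edge set is a parameter because the comparison with a free boundary deletes edges;
  the product form is the one \<open>ferro_weight\<close> asks for.\<close>

definition edge_weight :: "real \<Rightarrow> real \<Rightarrow> (nat \<times> 'v) set \<Rightarrow> ('v \<Rightarrow> int) \<Rightarrow> real" where
  "edge_weight J B E x = (\<Prod>v\<in>V. cosh B + sinh B * spin x v) *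
     (\<Prod>e\<in>E. cosh J + sinh J * edge_term e x)"

lemma in_V: "g \<in> words r \<Longrightarrow> v \<in> V \<Longrightarrow> \<sigma> g v \<in> V"
  using perm by (simp add: permutes_in_image)

lemma gen_in_carrier: "i < r \<Longrightarrow> [(i, b)] \<in> words r"
  by (simp add: Cons_in_carrier)

lemma spin_char_edge_term: "e \<in> edges \<Longrightarrow> spin_char V (edge_term e)"
  unfolding edge_term_def
  by (intro spin_char_mult spin_char_spin in_V) (auto simp: edges_def gen_in_carrier)

lemma ferro_edge_weight:
  assumes "E \<subseteq> edges" "0 \<le> J" "0 \<le> B"
  shows "ferro_weight V (edge_weight J B E)"
proof -
  have sc: "sinh J \<le> cosh J" for J :: real by (simp add: sinh_def cosh_def)
  have "ferro_weight V (\<lambda>x. 1 * (\<Prod>v\<in>V. cosh B + sinh B * spin x v))"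
    by (rule ferro_weight_prod) (use assms in \<open>auto intro: ferro_weight.one spin_char_spin simp: sc\<close>)
  then have "ferro_weight V (\<lambda>x. (\<Prod>v\<in>V. cosh B + sinh B * spin x v) *
     (\<Prod>e\<in>E. cosh J + sinh J * edge_term e x))"
    by (intro ferro_weight_prod) (use assms in \<open>auto intro!: spin_char_edge_term simp: sc\<close>)
  then show ?thesis unfolding edge_weight_def .
qed

lemma edge_term_cases: "x \<in> spins V \<Longrightarrow> e \<in> edges \<Longrightarrow> edge_term e x = 1 \<or> edge_term e x = -1"
  using spin_char_edge_term unfolding spin_char_def by blast

lemma edge_weight_exp:
  assumes "x \<in> spins V" "E \<subseteq> edges"
  shows "edge_weight J B E x = exp (J * (\<Sum>e\<in>E. edge_term e x) + B * magn x)"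
proof -
  have "finite E" using assms(2) finite_V by (auto simp: edges_def intro: finite_subset)
  moreover have "(\<Prod>v\<in>V. cosh B + sinh B * spin x v) = (\<Prod>v\<in>V. exp (B * spin x v))"
    by (intro prod.cong refl exp_spin_char[symmetric] spin_real_cases[OF assms(1)])
  moreover have "(\<Prod>e\<in>E. cosh J + sinh J * edge_term e x) = (\<Prod>e\<in>E. exp (J * edge_term e x))"
    using edge_term_cases assms by (intro prod.cong refl exp_spin_char[symmetric]) auto
  ultimately show ?thesis using finite_V
    by (simp add: edge_weight_def exp_sum[symmetric] exp_add magn_def sum_distrib_left)
qed

lemma edge_weight_edges: "x \<in> spins V \<Longrightarrow> edge_weight J B edges x = ising_weight J B x"
  by (simp add: edge_weight_exp ising_weight_def energy_def)

end

text \<open>The extra layer beyond radius \<open>R\<close> serves twice: with it, every edge at the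
  embedded ball of radius \<open>R\<close> is a tree edge, and its sphere carries the plus boundary
  condition.\<close>

locale treelike_vertex = perm_model +
  fixes v :: 'a and R :: nat
  assumes treelike: "treelike (Suc R) v"
begin

abbreviation \<phi> :: "letter list \<Rightarrow> 'a" where "\<phi> w \<equiv> \<sigma> w v"

lemma inj: "inj_on \<phi> (word_ball r (Suc R))"
  using treelike by (simp add: treelike_def)

lemma inj_R: "inj_on \<phi> (word_ball r R)"
  by (rule inj_on_subset[OF inj]) (simp add: word_ball_mono)

lemma phi_in: "w \<in> words r \<Longrightarrow> \<phi> w \<in> V"
  using in_V treelike by (simp add: treelike_def)

lemma phi_ball: "\<phi> ` word_ball r R' \<subseteq> V"
  using phi_in by (auto simp: word_ball_def)

lemma nonroot_cases:
  assumes "w \<in> word_ball r (Suc R) - {[]}"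
  obtains i u where "w = (i, True) # u" "\<sigma> [(i, True)] (\<phi> u) = \<phi> w" "word_edge v w = (i, \<phi> u)"
      "i < r" "u \<in> word_ball r (Suc R)"
    | i u where "w = (i, False) # u" "\<sigma> [(i, True)] (\<phi> w) = \<phi> u" "word_edge v w = (i, \<phi> w)"
      "i < r" "u \<in> word_ball r (Suc R)"
proof -
  obtain i b u where w: "w = (i, b) # u" using assms by (cases w) auto
  have "i < r" "u \<in> word_ball r (Suc R)" using assms w by (auto simp: word_ball_def Cons_in_carrier)
  then show thesis
    using that assms w treelike by (cases b) (auto simp: treelike_def word_edge_def)
qed

lemma e_fix: "w \<in> word_ball r (Suc R) \<Longrightarrow> \<sigma> [] (\<phi> w) = \<phi> w"
  using treelike by (simp add: treelike_def)

lemma edge_term_word_edge: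
  assumes "w \<in> word_ball r (Suc R) - {[]}"
  shows "edge_term (word_edge v w) x = spin x (\<phi> w) * spin x (\<phi> (tl w))"
  using assms by (cases rule: nonroot_cases) (use assms in \<open>simp_all add: edge_term_def e_fix\<close>)

lemma word_edge_in:
  assumes w: "w \<in> word_ball r (Suc R) - {[]}"
  shows "word_edge v w \<in> edges"
  using w
proof (cases rule: nonroot_cases)
  case (1 i u)
  then show ?thesis using phi_in[of u] by (simp add: edges_def word_ball_def)
next
  case (2 i u)
  then show ?thesis using phi_in[of w] w by (simp add: edges_def word_ball_def)
qed

text \<open>Equal indices mean the same generator and the same starting end. For opposite head
  letters this would make one of the words begin with \<open>s_i\<close> followed by its inverse,
  which is not reduced.\<close>

lemma inj_word_edge: "inj_on (word_edge v) (word_ball r (Suc R) - {[]})"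
proof (rule inj_onI)
  fix w w' assume w: "w \<in> word_ball r (Suc R) - {[]}" and w': "w' \<in> word_ball r (Suc R) - {[]}"
    and eq: "word_edge v w = word_edge v w'"
  have no: False if "(i, True) # (i, False) # u \<in> word_ball r (Suc R)" for i u
    using that by (auto simp: word_ball_def Cons_in_carrier inv_letter_def)
  show "w = w'"
    using w
  proof (cases rule: nonroot_cases)
    case a: (1 i u)
    show ?thesis using w'
    proof (cases rule: nonroot_cases)
      case b: (1 j u')
      then show ?thesis using a eq inj by (auto dest: inj_onD)
    next
      case b: (2 j u')
      then have "u = w'" using a eq inj w' by (auto dest: inj_onD)
      then show ?thesis using a b w eq no by auto
    qed
  next
    case a: (2 i u)
    show ?thesis using w'
    proof (cases rule: nonroot_cases)
      case b: (1 j u')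
      then have "w = u'" using a eq inj w by (auto dest: inj_onD)
      then show ?thesis using a b w' eq no by auto
    next
      case b: (2 j u')
      then show ?thesis using a eq inj w w' by (auto dest: inj_onD)
    qed
  qed
qed

text \<open>Since the generators act by permutations, every vertex is the start of one edge and the
  end of one edge for each generator. At a vertex of the ball the tree edges of depth up to
  \<open>R + 1\<close> already use all of them.\<close>

lemma edge_outside:
  assumes e: "e \<in> edges - word_edge v ` (word_ball r (Suc R) - {[]})"
  shows "\<sigma> [] (snd e) \<in> V - \<phi> ` word_ball r R" "\<sigma> [(fst e, True)] (snd e) \<in> V - \<phi> ` word_ball r R"
proof -
  obtain i u where iu: "e = (i, u)" "i < r" "u \<in> V" using e by (auto simp: edges_def)
  have V: "\<sigma> [] u \<in> V" "\<sigma> [(i, True)] u \<in> V"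
    using iu by (auto intro!: in_V gen_in_carrier)
  have ball: "w \<in> word_ball r R \<Longrightarrow> w \<in> word_ball r (Suc R)" for w by (auto simp: word_ball_def)
  have app: "a # w \<in> word_ball r (Suc R) \<longleftrightarrow> fst a < r \<and> (w = [] \<or> hd w \<noteq> inv_letter a)"
    if "w \<in> word_ball r R" for a w
    using that by (auto simp: word_ball_def Cons_in_carrier)
  have nw: "word_edge v w \<noteq> (i, u)" if "w \<in> word_ball r (Suc R)" "w \<noteq> []" for w
    using e iu that by (metis Diff_iff image_eqI singletonD)
  have "\<sigma> [] u \<noteq> \<phi> w" if w: "w \<in> word_ball r R" for w
  proof
    assume "\<sigma> [] u = \<phi> w"
    then have "\<sigma> [] u = \<sigma> [] (\<phi> w)" using e_fix[OF ball[OF w]] by simp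
    then have u: "u = \<phi> w" using permutes_inj[OF perm[OF Nil_in_carrier]] by (simp add: inj_eq)
    show False
    \<comment> \<open>The \<open>s_i\<close>-edge starting at \<open>w\<close> leads to the child
      \<open>s_i w\<close>, unless \<open>w\<close> begins with the inverse of \<open>s_i\<close>;
      then it leads to the parent.\<close>
    proof (cases "w = [] \<or> hd w \<noteq> inv_letter (i, True)")
      case True
      then show False using nw[of "(i, True) # w"] app[OF w] iu u by (simp add: word_edge_def)
    next
      case False
      then show False using nw[of w] ball[OF w] u by (simp add: word_edge_def inv_letter_def)
    qed
  qed
  then show "\<sigma> [] (snd e) \<in> V - \<phi> ` word_ball r R" using V iu by auto
  have inj_i: "\<sigma> [(i, True)] u = \<sigma> [(i, True)] u' \<Longrightarrow> u = u'" for u'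
    using permutes_inj[OF perm[OF gen_in_carrier[OF iu(2)]]] by (simp add: inj_eq)
  have "\<sigma> [(i, True)] u \<noteq> \<phi> w" if w: "w \<in> word_ball r R" for w
  proof
    assume eq: "\<sigma> [(i, True)] u = \<phi> w"
    show False
    proof (cases "w \<noteq> [] \<and> hd w = (i, True)")
      case True
      then obtain u' where w': "w = (i, True) # u'" by (cases w) auto
      then have "\<sigma> [(i, True)] (\<phi> u') = \<phi> w" using treelike ball[OF w] by (auto simp: treelike_def)
      then have "u = \<phi> u'" using eq inj_i by simp
      then show False using nw[of w] ball[OF w] w' by (simp add: word_edge_def)
    next
      case False
      then have w': "(i, False) # w \<in> word_ball r (Suc R)"
        using app[OF w] iu by (auto simp: inv_letter_def)
      then have "\<sigma> [(i, True)] (\<phi> ((i, False) # w)) = \<phi> w" using treelike by (auto simp: treelike_def)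
      then have "u = \<phi> ((i, False) # w)" using eq inj_i by simp
      then show False using nw[OF w'] by (simp add: word_edge_def)
    qed
  qed
  then show "\<sigma> [(fst e, True)] (snd e) \<in> V - \<phi> ` word_ball r R" using V iu by auto
qed

lemma sum_word_edge:
  assumes "D \<subseteq> word_ball r (Suc R) - {[]}"
  shows "(\<Sum>e\<in>word_edge v ` D. edge_term e x) =
    (\<Sum>w\<in>D. spin x (\<phi> w) * spin x (\<phi> (tl w)))"
  by (subst sum.reindex[OF inj_on_subset[OF inj_word_edge assms]], unfold o_def,
      rule sum.cong[OF refl], rule edge_term_word_edge) (use assms in auto)

lemma magn_split:
  "magn x = (\<Sum>w\<in>word_ball r R. spin x (\<phi> w)) + (\<Sum>u\<in>V - \<phi> ` word_ball r R. spin x u)"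
  unfolding magn_def
  by (subst sum.subset_diff[OF phi_ball[of R] finite_V]) (simp add: sum.reindex[OF inj_R])

lemma tree_weight_phi:
  "tree_weight r R J B h (\<lambda>w\<in>word_ball r R. x (\<phi> w)) =
    exp (J * (\<Sum>w\<in>word_ball r R - {[]}. spin x (\<phi> w) * spin x (\<phi> (tl w)))
      + B * (\<Sum>w\<in>word_ball r R. spin x (\<phi> w))
      + (h - B) * (\<Sum>w\<in>word_sphere r R. spin x (\<phi> w)))"
proof -
  let ?y = "\<lambda>w\<in>word_ball r R. x (\<phi> w)"
  have "(\<Sum>w\<in>word_ball r R - {[]}. spin ?y w * spin ?y (tl w)) =
    (\<Sum>w\<in>word_ball r R - {[]}. spin x (\<phi> w) * spin x (\<phi> (tl w)))"
    by (intro sum.cong refl) (simp add: tl_in_word_ball)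
  moreover have sph: "(\<Sum>w\<in>word_sphere r R. spin ?y w) = (\<Sum>w\<in>word_sphere r R. spin x (\<phi> w))"
    by (intro sum.cong refl) (simp add: word_sphere_def word_ball_def)
  moreover have "(\<Sum>w\<in>word_ball r R - word_sphere r R. spin ?y w) =
      (\<Sum>w\<in>word_ball r R. spin x (\<phi> w)) - (\<Sum>w\<in>word_sphere r R. spin x (\<phi> w))"
    unfolding sph[symmetric] by (subst sum_diff) (auto simp: word_sphere_subset)
  ultimately show ?thesis by (simp only: tree_weight_def) (simp add: algebra_simps)
qed

text \<open>On configurations this is, up to a power of two, the indicator that the sphere of radius
  \<open>R + 1\<close> is all plus; the shape \<open>1 + 1 * _\<close> is the case
  \<open>a = b = 1\<close> of \<open>ferro_weight\<close>.\<close>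

definition plus_factor :: "('a \<Rightarrow> int) \<Rightarrow> real" where
  "plus_factor x = (\<Prod>w\<in>word_sphere r (Suc R). 1 + 1 * spin x (\<phi> w))"

lemma ferro_plus_factor: "ferro_weight V w \<Longrightarrow> ferro_weight V (\<lambda>x. w x * plus_factor x)"
  unfolding plus_factor_def
  by (rule ferro_weight_prod) (auto intro!: spin_char_spin phi_in simp: word_sphere_def)

lemma plus_factor_restrict:
  assumes "\<phi> ` word_sphere r (Suc R) \<subseteq> U"
  shows "plus_factor (restrict x U) = plus_factor x"
  unfolding plus_factor_def using assms by (intro prod.cong refl) auto

lemma sphere_outside: "\<phi> ` word_sphere r (Suc R) \<subseteq> V - \<phi> ` word_ball r R"
  using inj phi_in by (fastforce simp: word_sphere_def word_ball_def dest: inj_onD)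

lemma sum_plus_factor:
  assumes R: "R \<ge> 1"
    and F: "\<And>x. F (restrict x (word_ball r R)) = F x"
    and g: "\<And>x. g (restrict x (V - \<phi> ` word_ball r R)) = g x"
    and Q: "\<And>x. Q (restrict x (V - \<phi> ` word_ball r R)) = Q x"
  shows "(\<Sum>x\<in>spins V. F (\<lambda>w. x (\<phi> w)) * g x * (ising_weight J B x * plus_factor x * Q x)) =
    tree_mean r R J B (B + real (2 * r - 1) * J) F *
    (\<Sum>x\<in>spins V. g x * (ising_weight J B x * plus_factor x * Q x))"
proof (rule sum_tree_factor[where F = F and g = g, OF inj_R phi_ball _ F g])
  let ?h = "B + real (2 * r - 1) * J"
  let ?U = "V - \<phi> ` word_ball r R" and ?D = "word_ball r (Suc R) - {[]}"
  let ?O = "edges - word_edge v ` ?D"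
  let ?Wout = "\<lambda>x. exp (J * (\<Sum>e\<in>?O. edge_term e x) + B * (\<Sum>u\<in>?U. spin x u)) *
    plus_factor x * Q x"
  fix x assume x: "x \<in> spins V"
  have D: "?D = (word_ball r R - {[]}) \<union> word_sphere r (Suc R)"
    by (auto simp: word_ball_def word_sphere_def)
  have "word_edge v ` ?D \<subseteq> edges" using word_edge_in by blast
  moreover have "finite edges" using finite_V by (simp add: edges_def)
  ultimately have "energy x = (\<Sum>e\<in>?O. edge_term e x) + (\<Sum>e\<in>word_edge v ` ?D. edge_term e x)"
    unfolding energy_def by (intro sum.subset_diff)
  also have "(\<Sum>e\<in>word_edge v ` ?D. edge_term e x) =
      (\<Sum>w\<in>?D. spin x (\<phi> w) * spin x (\<phi> (tl w)))"
    by (rule sum_word_edge) simp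
  also have "(\<Sum>w\<in>?D. spin x (\<phi> w) * spin x (\<phi> (tl w))) =
      (\<Sum>w\<in>word_ball r R - {[]}. spin x (\<phi> w) * spin x (\<phi> (tl w))) +
      (\<Sum>w\<in>word_sphere r (Suc R). spin x (\<phi> w) * spin x (\<phi> (tl w)))"
    unfolding D by (rule sum.union_disjoint) (use word_ball_Suc(2) in auto)
  finally have en: "energy x = (\<Sum>e\<in>?O. edge_term e x) +
      ((\<Sum>w\<in>word_ball r R - {[]}. spin x (\<phi> w) * spin x (\<phi> (tl w))) +
      (\<Sum>w\<in>word_sphere r (Suc R). spin x (\<phi> w) * spin x (\<phi> (tl w))))" .
  have O: "(\<Sum>e\<in>?O. edge_term e (restrict x ?U)) = (\<Sum>e\<in>?O. edge_term e x)"
    using edge_outside by (intro sum.cong refl) (simp add: edge_term_def)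
  have U: "(\<Sum>u\<in>?U. real_of_int (restrict x ?U u)) = (\<Sum>u\<in>?U. spin x u)"
    by (intro sum.cong) auto
  have P: "plus_factor (restrict x ?U) = plus_factor x"
    by (rule plus_factor_restrict[OF sphere_outside])
  show "ising_weight J B x * plus_factor x * Q x =
      tree_weight r R J B ?h (\<lambda>w\<in>word_ball r R. x (\<phi> w)) * ?Wout (restrict x ?U)"
  proof (cases "plus_factor x = 0")
    case False
    have "spin x (\<phi> w) = 1" if w: "w \<in> word_sphere r (Suc R)" for w
    proof -
      have "1 + spin x (\<phi> w) \<noteq> 0" using False w by (simp add: plus_factor_def)
      moreover have "\<phi> w \<in> V" using w by (intro phi_in) (simp add: word_sphere_def)
      ultimately show ?thesis using spins_cases[OF x] by force
    qed
    then have "(\<Sum>w\<in>word_sphere r (Suc R). spin x (\<phi> w) * spin x (\<phi> (tl w))) =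
        (\<Sum>w\<in>word_sphere r (Suc R). spin x (\<phi> (tl w)))"
      by (intro sum.cong) auto
    also have "\<dots> = real (2 * r - 1) * (\<Sum>w\<in>word_sphere r R. spin x (\<phi> w))"
      by (rule sum_word_sphere_Suc[OF R])
    finally show ?thesis
      unfolding O U P Q tree_weight_phi ising_weight_def magn_split en
      by (simp add: exp_add[symmetric] algebra_simps)
  qed (simp add: P)
qed

text \<open>Deleting all edges except those of the embedded ball leaves the tree with free boundary,
  hence \<open>h = B\<close>. Restoring them multiplies the weight by a positive definite factor,
  which cannot lower a correlation.\<close>

lemma tree_lower:
  assumes A: "A \<subseteq> word_ball r R" and J: "0 \<le> J" and B: "0 \<le> B"
  shows "tree_mean r R J B B (spin_prod A) \<le> gibbs V (ising_weight J B) (\<lambda>x. spin_prod A (\<lambda>w. x (\<phi> w)))"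
proof -
  let ?f = "\<lambda>x. spin_prod A (\<lambda>w. x (\<phi> w))"
  let ?D = "word_ball r R - {[]}"
  let ?E = "word_edge v ` ?D"
  let ?U = "V - \<phi> ` word_ball r R"
  have DS: "?D \<subseteq> word_ball r (Suc R) - {[]}" by (auto simp: word_ball_def)
  then have E: "?E \<subseteq> edges" using word_edge_in by blast
  let ?W = "edge_weight J B ?E"
  let ?G = "\<lambda>x. \<Prod>e\<in>edges - ?E. cosh J + sinh J * edge_term e x"
  have Wpos: "x \<in> spins V \<Longrightarrow> ?W x > 0" for x by (simp add: edge_weight_exp E)
  have fin: "finite edges" using finite_V by (simp add: edges_def)
  have full: "?W x * ?G x = ising_weight J B x" if "x \<in> spins V" for x
    unfolding edge_weight_edges[OF that, symmetric] edge_weight_def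
    by (simp add: prod.subset_diff[OF E fin] mult_ac)
  have sub: "\<phi> ` A \<subseteq> V" using phi_ball A by blast
  have "(\<Sum>x\<in>spins V. spin_prod A (\<lambda>w. x (\<phi> w)) * 1 * ?W x) =
      tree_mean r R J B B (spin_prod A) * (\<Sum>x\<in>spins V. 1 * ?W x)"
  proof (rule sum_tree_factor[OF inj_R phi_ball])
    fix x assume x: "x \<in> spins V"
    have U: "(\<Sum>u\<in>?U. real_of_int (restrict x ?U u)) = (\<Sum>u\<in>?U. spin x u)"
      by (intro sum.cong) auto
    show "?W x = tree_weight r R J B B (\<lambda>w\<in>word_ball r R. x (\<phi> w)) *
        (\<lambda>x. exp (B * (\<Sum>u\<in>?U. spin x u))) (restrict x ?U)"
      unfolding edge_weight_exp[OF x E] tree_weight_phi U magn_split sum_word_edge[OF DS]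
      by (simp add: exp_add[symmetric] algebra_simps)
  next
    show "spin_prod A (restrict x (word_ball r R)) = spin_prod A x" for x
      by (rule spin_prod_restrict[OF A])
  qed simp
  moreover have Z: "(\<Sum>x\<in>spins V. ?W x) > 0" by (intro sum_pos_spins finite_V Wpos)
  ultimately have "tree_mean r R J B B (spin_prod A) = gibbs V ?W ?f"
    by (simp add: gibbs_def)
  also have "\<dots> \<le> gibbs V (\<lambda>x. ?W x * ?G x) ?f"
  proof (rule gibbs_mono_weight[OF _ _ _ Z])
    show "ferro_weight V ?W" by (rule ferro_edge_weight[OF E J B])
    show "pos_def V ?f" by (intro pos_def.char spin_char_spin_prod sub)
    have "ferro_weight V (\<lambda>x. 1 * ?G x)"
      by (rule ferro_weight_prod)
        (use J in \<open>auto intro: ferro_weight.one spin_char_edge_term simp: sinh_def cosh_def\<close>)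
    then show "pos_def V ?G" using ferro_weight_pos_def by fastforce
    show "0 < (\<Sum>x\<in>spins V. ?W x * ?G x)"
      by (intro sum_pos_spins finite_V) (simp add: full ising_weight_def)
  qed
  also have "\<dots> = gibbs V (ising_weight J B) ?f" by (rule gibbs_cong) (simp_all add: full)
  finally show ?thesis .
qed

end

context perm_model
begin

text \<open>Freezing both surrounding spheres at plus cannot lower the correlation, and it makes the
  two balls independent. The bound is therefore a square, as a variance estimate requires.\<close>

lemma tree_upper_pair:
  assumes v: "treelike (Suc R) v" and v': "treelike (Suc R) v'"
    and disj: "(\<lambda>w. \<sigma> w v) ` word_ball r (Suc R) \<inter> (\<lambda>w. \<sigma> w v') ` word_ball r (Suc R) = {}"
    and R: "R \<ge> 1" and A: "A \<subseteq> word_ball r R" and J: "0 \<le> J" and B: "0 \<le> B"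
  shows "gibbs V (ising_weight J B)
      (\<lambda>x. spin_prod A (\<lambda>w. x (\<sigma> w v)) * spin_prod A (\<lambda>w. x (\<sigma> w v')))
    \<le> (tree_mean r R J B (B + real (2 * r - 1) * J) (spin_prod A))\<^sup>2"
proof -
  interpret a: treelike_vertex r V \<sigma> v R by unfold_locales (rule v)
  interpret b: treelike_vertex r V \<sigma> v' R by unfold_locales (rule v')
  let ?tm = "tree_mean r R J B (B + real (2 * r - 1) * J) (spin_prod A)"
  let ?f = "\<lambda>x. spin_prod A (\<lambda>w. x (\<sigma> w v))" and ?f' = "\<lambda>x. spin_prod A (\<lambda>w. x (\<sigma> w v'))"
  let ?W = "\<lambda>x. ising_weight J B x * a.plus_factor x * b.plus_factor x"
  let ?U = "V - (\<lambda>w. \<sigma> w v) ` word_ball r R" and ?U' = "V - (\<lambda>w. \<sigma> w v') ` word_ball r R"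
  have ball: "word_ball r R \<subseteq> word_ball r (Suc R)" "word_sphere r (Suc R) \<subseteq> word_ball r (Suc R)"
    by (auto simp: word_ball_def word_sphere_def)
  have sub: "(\<lambda>w. \<sigma> w v) ` A \<subseteq> V" "(\<lambda>w. \<sigma> w v') ` A \<subseteq> V" using a.phi_ball b.phi_ball A by blast+
  note FA = spin_prod_restrict[OF A]
  have f'_out: "?f' (restrict x ?U) = ?f' x" for x
    unfolding spin_prod_def
  proof (rule prod.cong)
    fix w assume w: "w \<in> A"
    then have "\<sigma> w v' \<in> ?U" using disj ball A sub(2) by blast
    then show "real_of_int (restrict x ?U (\<sigma> w v')) = spin x (\<sigma> w v')" by simp
  qed simp
  have Qa: "a.plus_factor (restrict x ?U') = a.plus_factor x" for x
    by (rule a.plus_factor_restrict) (use disj ball a.phi_ball[of "Suc R"] in blast)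
  have Qb: "b.plus_factor (restrict x ?U) = b.plus_factor x" for x
    by (rule b.plus_factor_restrict) (use disj ball b.phi_ball[of "Suc R"] in blast)
  have 1: "(\<Sum>x\<in>spins V. ?f x * ?f' x * ?W x) = ?tm * (\<Sum>x\<in>spins V. ?f' x * ?W x)"
    by (rule a.sum_plus_factor[where F = "spin_prod A" and g = ?f' and Q = b.plus_factor, OF R FA
      f'_out Qb])
  have "(\<Sum>x\<in>spins V. ?f' x * 1 * (ising_weight J B x * b.plus_factor x * a.plus_factor x)) =
      ?tm * (\<Sum>x\<in>spins V. 1 * (ising_weight J B x * b.plus_factor x * a.plus_factor x))"
    by (rule b.sum_plus_factor[where F = "spin_prod A" and g = "\<lambda>_. 1" and Q = a.plus_factor, OF R
      FA _ Qa]) simp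
  then have 2: "(\<Sum>x\<in>spins V. ?f' x * ?W x) = ?tm * (\<Sum>x\<in>spins V. ?W x)"
    by (simp add: mult_ac)
  have ferro: "ferro_weight V (edge_weight J B edges)" by (rule ferro_edge_weight[OF _ J B]) simp
  \<comment> \<open>The plus factors vanish on many configurations; the all-plus one keeps the total
    mass positive.\<close>
  have "0 < ?W (\<lambda>u\<in>V. 1)"
    using a.phi_in b.phi_in
    by (auto simp: a.plus_factor_def b.plus_factor_def ising_weight_def word_sphere_def
        intro!: mult_pos_pos prod_pos)
  moreover have "0 \<le> ?W x" if x: "x \<in> spins V" for x
    using ferro_weight_nonneg[OF a.ferro_plus_factor[OF b.ferro_plus_factor[OF ferro]] x]
    by (simp add: edge_weight_edges[OF x] mult_ac)
  ultimately have Z: "0 < (\<Sum>x\<in>spins V. ?W x)"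
    by (intro sum_pos2[of _ "\<lambda>u\<in>V. 1"] finite_spins finite_V) (auto simp: spins_def)
  have "gibbs V (ising_weight J B) (\<lambda>x. ?f x * ?f' x) = gibbs V (edge_weight J B edges) (\<lambda>x. ?f x *
    ?f' x)"
    by (rule gibbs_cong) (simp_all add: edge_weight_edges)
  also have "\<dots> \<le> gibbs V (\<lambda>x. edge_weight J B edges x * (a.plus_factor x * b.plus_factor x)) (\<lambda>x. ?f
    x * ?f' x)"
  proof (rule gibbs_mono_weight[OF ferro])
    show "pos_def V (\<lambda>x. ?f x * ?f' x)"
      by (intro pos_def.char spin_char_mult spin_char_spin_prod sub)
    have "ferro_weight V (\<lambda>x. 1 * a.plus_factor x * b.plus_factor x)"
      by (intro a.ferro_plus_factor b.ferro_plus_factor ferro_weight.one)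
    then show "pos_def V (\<lambda>x. a.plus_factor x * b.plus_factor x)" using ferro_weight_pos_def by
      fastforce
    show "0 < (\<Sum>x\<in>spins V. edge_weight J B edges x)"
      by (intro sum_pos_spins finite_V) (simp add: edge_weight_edges ising_weight_def)
    show "0 < (\<Sum>x\<in>spins V. edge_weight J B edges x * (a.plus_factor x * b.plus_factor x))"
      using Z by (simp add: edge_weight_edges mult_ac)
  qed
  also have "\<dots> = gibbs V ?W (\<lambda>x. ?f x * ?f' x)"
    by (rule gibbs_cong) (simp_all add: edge_weight_edges mult_ac)
  also have "\<dots> = ?tm\<^sup>2"
    using Z 1 2 by (simp add: gibbs_def power2_eq_square)
  finally show ?thesis .
qed

end

section \<open>The cavity recursion\<close>

lemma tanh_sum_formula:
  fixes J s :: real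
  shows "(tanh (J + s) + tanh (J - s)) / 2 = sinh (2 * J) / (cosh (2 * J) + cosh (2 * s))"
    and "(tanh (J + s) - tanh (J - s)) / 2 = sinh (2 * s) / (cosh (2 * J) + cosh (2 * s))"
proof -
  have c: "cosh (2 * J) + cosh (2 * s) = 2 * (cosh (J + s) * cosh (J - s))"
    using cosh_add[of "J + s" "J - s"] cosh_diff[of "J + s" "J - s"] by simp
  have a: "sinh (2 * J) = sinh (J + s) * cosh (J - s) + cosh (J + s) * sinh (J - s)"
    using sinh_add[of "J + s" "J - s"] by simp
  have b: "sinh (2 * s) = sinh (J + s) * cosh (J - s) - cosh (J + s) * sinh (J - s)"
    using sinh_diff[of "J + s" "J - s"] by simp
  have nz: "cosh (J + s) \<noteq> 0" "cosh (J - s) \<noteq> 0" by simp_all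
  show "(tanh (J + s) + tanh (J - s)) / 2 = sinh (2 * J) / (cosh (2 * J) + cosh (2 * s))"
    unfolding c a tanh_def using nz by (simp add: field_simps)
  show "(tanh (J + s) - tanh (J - s)) / 2 = sinh (2 * s) / (cosh (2 * J) + cosh (2 * s))"
    unfolding c b tanh_def using nz by (simp add: field_simps)
qed

lemma cavity_alt: "cavity J s = (ln (cosh (J + s)) - ln (cosh (J - s))) / 2"
  by (simp add: cavity_def ln_div)

lemma has_real_derivative_ln_cosh: "((\<lambda>x. ln (cosh x)) has_real_derivative tanh x) (at (x::real))"
proof -
  have "((\<lambda>x. ln (cosh x)) has_real_derivative inverse (cosh x) * sinh x) (at x)"
    by (rule DERIV_chain2[OF DERIV_ln]) (auto intro!: derivative_eq_intros)
  then show ?thesis by (simp add: tanh_def field_simps)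
qed

lemma has_real_derivative_cavity:
  "(cavity J has_real_derivative sinh (2 * J) / (cosh (2 * J) + cosh (2 * s))) (at s)"
proof -
  have "((\<lambda>s. (ln (cosh (J + s)) - ln (cosh (J - s))) / 2) has_real_derivative
      (tanh (J + s) * 1 - tanh (J - s) * (- 1)) / 2) (at s)"
    by (intro DERIV_cdivide DERIV_diff DERIV_chain2[OF has_real_derivative_ln_cosh])
      (auto intro!: derivative_eq_intros)
  moreover have "cavity J = (\<lambda>s. (ln (cosh (J + s)) - ln (cosh (J - s))) / 2)"
    by (rule ext) (rule cavity_alt)
  ultimately show ?thesis using tanh_sum_formula(1)[of J s] by simp
qed

lemma has_real_derivative_cavity_J:
  "((\<lambda>J. cavity J s) has_real_derivative sinh (2 * s) / (cosh (2 * J) + cosh (2 * s))) (at J within X)"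
proof -
  have "((\<lambda>J. (ln (cosh (J + s)) - ln (cosh (J - s))) / 2) has_real_derivative
      (tanh (J + s) * 1 - tanh (J - s) * 1) / 2) (at J)"
    by (intro DERIV_cdivide DERIV_diff DERIV_chain2[OF has_real_derivative_ln_cosh])
      (auto intro!: derivative_eq_intros)
  then show ?thesis
    unfolding cavity_alt[symmetric] using tanh_sum_formula(2)[of J s]
    by (simp add: has_field_derivative_at_within)
qed

lemma cosh_sum_pos: "0 < cosh (x::real) + cosh y"
  by (simp add: add_pos_pos)

lemma cavity_0 [simp]: "cavity J 0 = 0" "cavity 0 s = 0"
  by (simp_all add: cavity_def)

lemma cavity_minus: "cavity J (- s) = - cavity J s"
  by (simp add: cavity_alt field_simps)

lemma isCont_cavity: "isCont (cavity J) s"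
  by (rule DERIV_isCont[OF has_real_derivative_cavity])

lemma cavity_mono:
  assumes "0 \<le> J" "a \<le> b"
  shows "cavity J a \<le> cavity J b"
proof (rule DERIV_nonneg_imp_nondecreasing[OF assms(2)])
  fix x
  show "\<exists>y. (cavity J has_real_derivative y) (at x) \<and> 0 \<le> y"
    by (rule exI, rule conjI, rule has_real_derivative_cavity) (use assms(1) cosh_sum_pos[of "2 * J"
      "2 * x"] in \<open>simp add: divide_nonneg_pos\<close>)
qed

lemma cavity_strict_mono_J:
  assumes "0 < s" "a < b"
  shows "cavity a s < cavity b s"
proof (rule DERIV_pos_imp_increasing[OF assms(2)])
  fix x
  show "\<exists>y. ((\<lambda>J. cavity J s) has_real_derivative y) (at x) \<and> 0 < y"
    by (rule exI, rule conjI, rule has_real_derivative_cavity_J) (use assms(1) cosh_sum_pos[of "2 *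
      x" "2 * s"] in \<open>simp add: divide_pos_pos\<close>)
qed

text \<open>\<open>J\<close> is the limit of \<open>cavity J s\<close> for infinite
  \<open>s\<close>, the field of a neighbour frozen at plus. So the plus boundary dominates every
  cavity field, and the recursion started there decreases.\<close>

lemma cavity_le_J:
  assumes "0 \<le> J"
  shows "cavity J s \<le> J"
proof -
  have "cosh (J + s) \<le> exp (2 * J) * cosh (J - s)"
  proof -
    have "exp (- J - s) \<le> exp (3 * J - s)" using assms by simp
    then have "exp (J + s) + exp (- (J + s)) \<le> exp (2 * J) * (exp (J - s) + exp (- (J - s)))"
      by (simp add: distrib_left exp_add[symmetric])
    then show ?thesis by (simp add: cosh_def)
  qed
  then have "cosh (J + s) / cosh (J - s) \<le> exp (2 * J)" by (simp add: field_simps)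
  then have "ln (cosh (J + s) / cosh (J - s)) \<le> ln (exp (2 * J))" by (subst ln_le_cancel_iff) auto
  then show ?thesis by (simp add: cavity_def)
qed

lemma cavity_deriv_antimono:
  fixes J a b :: real
  assumes "0 \<le> J" "0 \<le> a" "a \<le> b"
  shows "sinh (2 * J) / (cosh (2 * J) + cosh (2 * b)) \<le> sinh (2 * J) / (cosh (2 * J) + cosh (2 * a))"
  using assms cosh_sum_pos[of "2 * J"]
  by (intro divide_left_mono) (auto intro!: mult_pos_pos simp: cosh_real_nonneg_le_iff)

text \<open>\<open>tanh J\<close> is the slope at \<open>0\<close>, and the slope decreases on the
  half-line.\<close>

lemma cavity_le_tanh:
  assumes "0 \<le> J" "0 \<le> s"
  shows "cavity J s \<le> tanh J * s"
proof -
  have "\<exists>y. ((\<lambda>x. tanh J * x - cavity J x) has_real_derivative y) (at x) \<and> 0 \<le> y" if x: "0 \<le> x" for x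
  proof (intro exI conjI)
    show "((\<lambda>x. tanh J * x - cavity J x) has_real_derivative
        tanh J - sinh (2 * J) / (cosh (2 * J) + cosh (2 * x))) (at x)"
      by (auto intro!: derivative_eq_intros has_real_derivative_cavity)
    show "0 \<le> tanh J - sinh (2 * J) / (cosh (2 * J) + cosh (2 * x))"
      using cavity_deriv_antimono[OF assms(1) order.refl x] tanh_sum_formula(1)[of J 0] by simp
  qed
  from DERIV_nonneg_imp_nondecreasing[OF assms(2) this] show ?thesis by simp
qed

lemma convex_on_cavity_gap:
  assumes "0 \<le> J" "0 \<le> k"
  shows "convex_on {0..} (\<lambda>s. s - k * cavity J s)"
proof (rule convex_on_realI)
  fix x assume "x \<in> {0::real..}"
  show "((\<lambda>s. s - k * cavity J s) has_real_derivative
      1 - k * (sinh (2 * J) / (cosh (2 * J) + cosh (2 * x)))) (at x)"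
    by (auto intro!: derivative_eq_intros has_real_derivative_cavity)
next
  fix x y assume "x \<in> {0::real..}" "y \<in> {0..}" "x \<le> y"
  then show "1 - k * (sinh (2 * J) / (cosh (2 * J) + cosh (2 * x)))
      \<le> 1 - k * (sinh (2 * J) / (cosh (2 * J) + cosh (2 * y)))"
    using mult_left_mono[OF cavity_deriv_antimono[of J x y], of k] assms by auto
qed simp

text \<open>\<open>t\<close> is the cavity field of the plus state at coupling \<open>J\<close>; with \<open>t\<close> fixed and the coupling
  lowered, the external field is raised to \<open>cavity_field\<close> so that \<open>t\<close> stays the fixed point of the
  recursion, which then is globally attracting on the nonnegative half-line.\<close>

definition plus_field :: "nat \<Rightarrow> real \<Rightarrow> real \<Rightarrow> bool" where
  "plus_field r J t \<longleftrightarrow> 1 \<le> r \<and> 0 < J \<and>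
     (0 < t \<and> real (2 * r - 1) * cavity J t = t \<or> t = 0 \<and> real (2 * r - 1) * tanh J \<le> 1)"

definition cavity_field :: "nat \<Rightarrow> real \<Rightarrow> real \<Rightarrow> real" where
  "cavity_field r t J = t - real (2 * r - 1) * cavity J t"

text \<open>The function \<open>s - real (2 * r - 1) * cavity J' s\<close> is convex on the
  half-line and vanishes at \<open>0\<close>. For \<open>t > 0\<close> it also vanishes at
  \<open>t\<close> when the coupling is \<open>J\<close>, so it is positive there for
  \<open>J' < J\<close>, and convexity separates its value at \<open>t\<close> from those on either
  side. For \<open>t = 0\<close> the subcritical slope bound does this. Hence \<open>t\<close> is
  the only nonnegative fixed point.\<close>

lemma cavity_gap:
  assumes "plus_field r J t" "0 \<le> J'" "J' < J"
  shows "0 \<le> s \<Longrightarrow> s < t \<Longrightarrow> s - real (2 * r - 1) * cavity J' s < t - real (2 * r - 1) * cavity J' t"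
    and "t < s \<Longrightarrow> t - real (2 * r - 1) * cavity J' t < s - real (2 * r - 1) * cavity J' s"
proof -
  let ?k = "real (2 * r - 1)"
  let ?g = "\<lambda>s. s - ?k * cavity J' s"
  have k: "?k > 0" using assms(1) by (simp add: plus_field_def)
  have conv: "convex_on {0..} ?g" by (rule convex_on_cavity_gap) (use assms in auto)
  \<comment> \<open>Convexity along the chord from \<open>0\<close>, where \<open>?g\<close>
    vanishes.\<close>
  have scale: "?g (u * y) \<le> u * ?g y" if "0 \<le> u" "u \<le> 1" "0 \<le> y" for u y
    using convex_onD[OF conv, of u 0 y] that by simp
  have gt: "?g t > 0" if "t > 0"
    using that assms(1) mult_strict_left_mono[OF cavity_strict_mono_J[OF that assms(3)] k]
    by (auto simp: plus_field_def)
  show "?g s < ?g t" if s: "0 \<le> s" "s < t"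
  proof -
    have "?g (s / t * t) \<le> s / t * ?g t" using s by (intro scale) auto
    moreover have "s / t * ?g t < ?g t" using gt s by (simp add: divide_less_eq)
    ultimately show ?thesis using s by simp
  qed
  show "?g t < ?g s" if s: "t < s"
  proof (cases "t > 0")
    case True
    have "?g (t / s * s) \<le> t / s * ?g s" using s True by (intro scale) auto
    then have *: "?g t \<le> t / s * ?g s" using s True by simp
    \<comment> \<open>Positivity of \<open>?g t\<close> carries over to \<open>?g s\<close>, so that
      the factor \<open>t / s < 1\<close> makes the chord bound strict.\<close>
    have "0 < t / s * ?g s" using gt[OF True] * by (rule less_le_trans)
    moreover have "0 < t / s" using s True by simp
    ultimately have "0 < ?g s" using zero_less_mult_pos by blast
    then have "t / s * ?g s < ?g s" using s True by (simp add: divide_less_eq)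
    with * show ?thesis by linarith
  next
    case False
    then have t: "t = 0" "?k * tanh J \<le> 1" using assms(1) by (auto simp: plus_field_def)
    have "?k * cavity J' s \<le> ?k * (tanh J' * s)"
      using cavity_le_tanh[of J' s] assms s t k by (intro mult_left_mono) auto
    also have "\<dots> < ?k * (tanh J * s)" using s t k assms by simp
    also have "\<dots> \<le> 1 * s"
      using mult_right_mono[OF t(2), of s] s t by (simp add: mult.assoc)
    finally show ?thesis using t by simp
  qed
qed

lemma cavity_field_nonneg:
  assumes "plus_field r J t" "0 \<le> J'" "J' < J"
  shows "0 \<le> cavity_field r t J'"
proof (cases "t = 0")
  case False
  then have "0 < t" using assms by (auto simp: plus_field_def)
  from cavity_gap(1)[OF assms order.refl this] show ?thesis by (simp add: cavity_field_def)
qed (simp add: cavity_field_def)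

lemma plus_field_nonneg: "plus_field r J t \<Longrightarrow> 0 \<le> t"
  by (auto simp: plus_field_def)

section \<open>Convergence of the cavity iterates\<close>

lemma mono_iterate_tendsto:
  fixes F :: "real \<Rightarrow> real"
  assumes mono: "mono F" and cont: "\<And>s. isCont F s" and fixp: "F t = t"
    and le: "s0 \<le> F s0" "s0 \<le> t" and uniq: "\<And>s. s0 \<le> s \<Longrightarrow> s < t \<Longrightarrow> F s \<noteq> s"
  shows "(\<lambda>n. (F ^^ n) s0) \<longlonglongrightarrow> t"
proof -
  have up: "incseq (\<lambda>n. (F ^^ n) s0)"
  proof (rule incseq_SucI)
    fix n show "(F ^^ n) s0 \<le> (F ^^ Suc n) s0"
    proof (induction n)
      case (Suc n)
      then show ?case using monoD[OF mono Suc] by simp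
    qed (use le in simp)
  qed
  have bd: "(F ^^ n) s0 \<le> t" for n
  proof (induction n)
    case (Suc n)
    then show ?case using monoD[OF mono Suc] fixp by simp
  qed (use le in simp)
  obtain L where L: "(\<lambda>n. (F ^^ n) s0) \<longlonglongrightarrow> L" "\<forall>n. (F ^^ n) s0 \<le> L"
    using incseq_convergent[OF up] bd by blast
  have "(\<lambda>n. F ((F ^^ n) s0)) \<longlonglongrightarrow> F L" by (rule isCont_tendsto_compose[OF cont L(1)])
  moreover have "(\<lambda>n. F ((F ^^ n) s0)) \<longlonglongrightarrow> L" using LIMSEQ_Suc[OF L(1)] by simp
  ultimately have "F L = L" by (rule LIMSEQ_unique)
  moreover have "s0 \<le> L" using L(2)[rule_format, of 0] by simp
  moreover have "L \<le> t" by (rule LIMSEQ_le_const2[OF L(1)]) (use bd in blast)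
  ultimately have "L = t" using uniq[of L] by (meson leI order_antisym)
  then show ?thesis using L by simp
qed

text \<open>The recursion rises from the free start \<open>B\<close> and falls from the plus start;
  each limit is a fixed point, and \<open>cavity_gap\<close> leaves only \<open>t\<close>. The lower
  start lies in the half-line covered there because \<open>B\<close> is nonnegative.\<close>

lemma cavity_iterate_tendsto:
  assumes pf: "plus_field r J t" and J': "0 \<le> J'" "J' < J"
  defines "B \<equiv> cavity_field r t J'"
  shows "(\<lambda>n. ((\<lambda>h. B + real (2 * r - 1) * cavity J' h) ^^ n) B) \<longlonglongrightarrow> t" (is ?lower)
    and "(\<lambda>n. ((\<lambda>h. B + real (2 * r - 1) * cavity J' h) ^^ n) (B + real (2 * r - 1) * J')) \<longlonglongrightarrow> t"
      (is ?upper)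
proof -
  let ?k = "real (2 * r - 1)"
  let ?F = "\<lambda>h. B + ?k * cavity J' h"
  have mono: "mono ?F" by (intro monoI add_left_mono mult_left_mono cavity_mono) (use J' in auto)
  have cont: "isCont ?F s" for s by (intro continuous_intros isCont_cavity)
  have fixp: "?F t = t" by (simp add: B_def cavity_field_def)
  have B0: "0 \<le> B" unfolding B_def by (rule cavity_field_nonneg[OF pf J'])
  have t0: "0 \<le> t" by (rule plus_field_nonneg[OF pf])
  have cpos: "0 \<le> s \<Longrightarrow> 0 \<le> cavity J' s" for s using cavity_mono[OF J'(1), of 0 s] by simp
  show ?lower
  proof (rule mono_iterate_tendsto[OF mono cont fixp])
    show "B \<le> ?F B" using cpos[OF B0] by simp
    show "B \<le> t" unfolding B_def cavity_field_def using cpos[OF t0] by simp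
    show "?F s \<noteq> s" if "B \<le> s" "s < t" for s
      using cavity_gap(1)[OF pf J', of s] that B0 unfolding B_def cavity_field_def by simp
  qed
  \<comment> \<open>Conjugation by the sign reverses the order and reduces the decreasing case to
    the increasing one.\<close>
  let ?G = "\<lambda>s. - ?F (- s)"
  have conj: "(?G ^^ n) (- s) = - (?F ^^ n) s" for n s by (induction n) simp_all
  have "(\<lambda>n. (?G ^^ n) (- (B + ?k * J'))) \<longlonglongrightarrow> - t"
  proof (rule mono_iterate_tendsto)
    show "mono ?G" using mono by (auto simp: mono_def)
    show "isCont ?G s" for s
      by (intro continuous_intros isCont_o2[of _ "\<lambda>s. - s"] isCont_cavity)
    show "?G (- t) = - t" using fixp by simp
    show "- (B + ?k * J') \<le> ?G (- (B + ?k * J'))"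
      using cavity_le_J[OF J'(1)] by (simp add: mult_left_mono)
    show "- (B + ?k * J') \<le> - t"
      unfolding B_def cavity_field_def using cavity_le_J[OF J'(1), of t] by (simp add: mult_left_mono)
    show "?G s \<noteq> s" if "- (B + ?k * J') \<le> s" "s < - t" for s
      using cavity_gap(2)[OF pf J', of "- s"] that unfolding B_def cavity_field_def by simp
  qed
  from tendsto_minus[OF this] show ?upper unfolding conj by simp
qed

text \<open>Griffiths' first inequality. The sign matters in \<open>avg_deviation\<close>, where a
  lower bound for the mean is multiplied by \<open>- 2 * c\<close>.\<close>

lemma tree_mean_nonneg:
  assumes "0 \<le> J" "0 \<le> B" "0 \<le> h" "A \<subseteq> word_ball r R"
  shows "0 \<le> tree_mean r R J B h (spin_prod A)"
proof -
  let ?V = "word_ball r R" and ?S = "word_sphere r R"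
  let ?a = "\<lambda>J c. cosh J + sinh J * (c::real)"
  let ?w = "\<lambda>x. 1 * (\<Prod>w\<in>?V - {[]}. ?a J (spin x w * spin x (tl w))) *
    (\<Prod>w\<in>?V - ?S. ?a B (spin x w)) * (\<Prod>w\<in>?S. ?a h (spin x w))"
  have sc: "sinh J \<le> cosh J" for J :: real by (simp add: sinh_def cosh_def)
  have S: "w \<in> ?S \<Longrightarrow> w \<in> ?V" for w using word_sphere_subset by blast
  have ferro: "ferro_weight ?V ?w"
    by (intro ferro_weight_prod ferro_weight.one)
      (use assms in \<open>auto intro!: spin_char_mult spin_char_spin intro: tl_in_word_ball S simp: sc\<close>)
  have eq: "tree_weight r R J B h x = ?w x" if x: "x \<in> spins ?V" for x
  proof -
    have e: "w \<in> ?V \<Longrightarrow> spin x w = 1 \<or> spin x w = -1" for w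
      by (rule spin_real_cases[OF x])
    have "(\<Prod>w\<in>?V - {[]}. ?a J (spin x w * spin x (tl w))) =
        (\<Prod>w\<in>?V - {[]}. exp (J * (spin x w * spin x (tl w))))"
    proof (intro prod.cong refl exp_spin_char[symmetric])
      fix w assume "w \<in> ?V - {[]}"
      then show "spin x w * spin x (tl w) = 1 \<or>
          spin x w * spin x (tl w) = -1"
        using e[of w] e[of "tl w"] tl_in_word_ball by auto
    qed
    moreover have "(\<Prod>w\<in>?V - ?S. ?a B (spin x w)) = (\<Prod>w\<in>?V - ?S. exp (B * spin x w))"
      "(\<Prod>w\<in>?S. ?a h (spin x w)) = (\<Prod>w\<in>?S. exp (h * spin x w))"
      by (intro prod.cong refl exp_spin_char[symmetric] e; use S in blast)+
    ultimately show ?thesis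
      by (simp add: tree_weight_def exp_add exp_sum sum_distrib_left)
  qed
  have chr: "spin_char ?V (spin_prod A)"
    using spin_char_spin_prod[of "\<lambda>w. w" A ?V] assms(4) by simp
  have "0 \<le> (\<Sum>x\<in>spins ?V. spin_prod A x * tree_weight r R J B h x)"
    by (rule pos_def_cong_sum_nonneg[OF pos_def_mult[OF pos_def.char[OF chr] ferro_weight_pos_def[OF
      ferro]]])
      (simp add: eq)
  moreover have "0 \<le> (\<Sum>x\<in>spins ?V. tree_weight r R J B h x)"
    by (intro sum_nonneg) (simp add: less_imp_le)
  ultimately show ?thesis by (simp add: tree_mean_def gibbs_def)
qed

lemma tree_mean_tendsto:
  assumes pf: "plus_field r J t" and J': "0 \<le> J'" "J' < J" and R: "R \<ge> 1" and A: "A \<subseteq> word_ball r R"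
  defines "B \<equiv> cavity_field r t J'"
  shows "(\<lambda>n. tree_mean r (R + n) J' B B (spin_prod A)) \<longlonglongrightarrow> tree_mean r R J' B t (spin_prod A)"
    and "(\<lambda>n. tree_mean r (R + n) J' B (B + real (2 * r - 1) * J') (spin_prod A))
      \<longlonglongrightarrow> tree_mean r R J' B t (spin_prod A)"
proof -
  note FA = spin_prod_restrict[OF A]
  show "(\<lambda>n. tree_mean r (R + n) J' B B (spin_prod A)) \<longlonglongrightarrow> tree_mean r R J' B t (spin_prod A)"
    unfolding tree_mean_iterate[where f = "spin_prod A", OF R FA]
    by (intro tendsto_tree_mean tendsto_const cavity_iterate_tendsto(1)[OF pf J', folded B_def])
  show "(\<lambda>n. tree_mean r (R + n) J' B (B + real (2 * r - 1) * J') (spin_prod A))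
      \<longlonglongrightarrow> tree_mean r R J' B t (spin_prod A)"
    unfolding tree_mean_iterate[where f = "spin_prod A", OF R FA]
    by (intro tendsto_tree_mean tendsto_const cavity_iterate_tendsto(2)[OF pf J', folded B_def])
qed

section \<open>Moments of the empirical correlations\<close>

lemma gibbs_add: "gibbs V w (\<lambda>x. f x + g x) = gibbs V w f + gibbs V w g"
  by (simp add: gibbs_def distrib_right sum.distrib add_divide_distrib)

lemma gibbs_cmult: "gibbs V w (\<lambda>x. c * f x) = c * gibbs V w f"
  by (simp add: gibbs_def sum_distrib_left mult.assoc)

lemma gibbs_sum: "gibbs V w (\<lambda>x. \<Sum>i\<in>I. f i x) = (\<Sum>i\<in>I. gibbs V w (f i))"
  unfolding gibbs_def by (simp add: sum_distrib_right sum.swap[of _ I] sum_divide_distrib)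

lemma gibbs_mono:
  assumes "\<And>x. x \<in> spins V \<Longrightarrow> 0 \<le> w x" "\<And>x. x \<in> spins V \<Longrightarrow> f x \<le> g x"
  shows "gibbs V w f \<le> gibbs V w g"
  unfolding gibbs_def using assms by (intro divide_right_mono sum_mono mult_right_mono sum_nonneg) auto

lemma gibbs_const:
  assumes "finite V" "\<And>x. x \<in> spins V \<Longrightarrow> 0 < w x"
  shows "gibbs V w (\<lambda>x. c) = c"
  using sum_pos_spins[of V w, OF assms] by (simp add: gibbs_def sum_distrib_left[symmetric])

lemma gibbs_abs_le:
  assumes "finite V" "\<And>x. x \<in> spins V \<Longrightarrow> 0 < w x" "\<And>x. x \<in> spins V \<Longrightarrow> \<bar>f x\<bar> \<le> b"
  shows "\<bar>gibbs V w f\<bar> \<le> b"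
proof -
  have "gibbs V w f \<le> gibbs V w (\<lambda>x. b)" "gibbs V w (\<lambda>x. - b) \<le> gibbs V w f"
    using assms(2,3) by (intro gibbs_mono; fastforce simp: abs_le_iff less_imp_le)+
  then show ?thesis by (simp add: gibbs_const[of V w, OF assms(1,2)])
qed

lemma gibbs_square_dev:
  assumes "finite V" "\<And>x. x \<in> spins V \<Longrightarrow> 0 < w x"
  shows "gibbs V w (\<lambda>x. (f x - c)\<^sup>2) = gibbs V w (\<lambda>x. (f x)\<^sup>2) - 2 * c * gibbs V w f + c\<^sup>2"
proof -
  have "gibbs V w (\<lambda>x. (f x - c)\<^sup>2) = gibbs V w (\<lambda>x. ((f x)\<^sup>2 + (- 2 * c) * f x) + c\<^sup>2)"
    by (rule gibbs_cong) (auto simp: power2_eq_square algebra_simps)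
  also have "\<dots> = gibbs V w (\<lambda>x. (f x)\<^sup>2) + (- 2 * c) * gibbs V w f + c\<^sup>2"
    by (simp only: gibbs_add gibbs_cmult gibbs_const[of V w, OF assms])
  finally show ?thesis by simp
qed

text \<open>Jensen's inequality; it turns the variance bound into convergence of the mean, for which
  \<open>avg_first_moment\<close> gives only one side.\<close>

lemma gibbs_mean_dev:
  assumes "finite V" "\<And>x. x \<in> spins V \<Longrightarrow> 0 < w x"
  shows "(gibbs V w f - c)\<^sup>2 \<le> gibbs V w (\<lambda>x. (f x - c)\<^sup>2)"
proof -
  let ?m = "gibbs V w f"
  have "gibbs V w (\<lambda>x. 0) \<le> gibbs V w (\<lambda>x. (f x - ?m)\<^sup>2)"
    using assms(2) by (intro gibbs_mono) (auto simp: less_imp_le)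
  then have "?m\<^sup>2 \<le> gibbs V w (\<lambda>x. (f x)\<^sup>2)"
    using gibbs_square_dev[of V w f ?m, OF assms]
    by (simp add: gibbs_const[of V w, OF assms] power2_eq_square)
  moreover have "gibbs V w (\<lambda>x. (f x - c)\<^sup>2) = gibbs V w (\<lambda>x. (f x)\<^sup>2) - 2 * c * ?m + c\<^sup>2"
    using assms by (rule gibbs_square_dev)
  ultimately show ?thesis using power2_diff[of ?m c] by (simp add: mult_ac)
qed

lemma abs_spin_prod_le: "(\<And>a. a \<in> A \<Longrightarrow> x a = -1 \<or> x a = 1) \<Longrightarrow> \<bar>spin_prod A x\<bar> \<le> 1"
  unfolding spin_prod_def abs_prod by (rule prod_le_1) (force simp: abs_if)

lemma length_foldr_push: "length (foldr push_letter u v) \<le> length u + length v"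
proof (induction u)
  case (Cons a u)
  have "length (push_letter a w) \<le> Suc (length w)" for w by (cases w) auto
  from this[of "foldr push_letter u v"] Cons show ?case by simp
qed simp

lemma word_mult: "u \<otimes>\<^bsub>free_group r\<^esub> v = foldr push_letter u v"
  by (simp add: free_group_def)

context perm_model
begin

lemma ising_weight_pos [simp]: "0 < ising_weight J B x"
  by (simp add: ising_weight_def)

text \<open>If \<open>a\<close> and \<open>b\<close> send \<open>v\<close> to the same vertex, then
  the product of the inverse of \<open>b\<close> with \<open>a\<close>, of length at most
  \<open>2 * R\<close>, fixes \<open>v\<close>, and freeness makes it trivial. Hence
  \<open>F\<close> has about twice the radius of the ball.\<close>

lemma sofic_treelike:
  assumes "v \<in> V" and F: "F = word_ball r (2 * R + 1)"
    and free: "\<forall>g\<in>F - {\<one>\<^bsub>free_group r\<^esub>}. \<sigma> g v \<noteq> v"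
    and act: "\<forall>g\<in>F. \<forall>h\<in>F. \<sigma> (g \<otimes>\<^bsub>free_group r\<^esub> h) v = \<sigma> g (\<sigma> h v)"
  shows "treelike R v"
proof -
  interpret G: group "free_group r" by (rule group_free_group)
  have RF: "w \<in> F" if "w \<in> word_ball r R" for w using that by (simp add: F word_ball_def)
  have carr: "w \<in> words r" if "w \<in> F" for w using that by (simp add: F word_ball_def)
  have e: "[] \<in> F" by (simp add: F word_ball_def)
  have "inj_on (\<lambda>w. \<sigma> w v) (word_ball r R)"
  proof (rule inj_onI)
    fix a b assume a: "a \<in> word_ball r R" and b: "b \<in> word_ball r R" and eq: "\<sigma> a v = \<sigma> b v"
    let ?y = "map inv_letter (rev b)"
    let ?g = "?y \<otimes>\<^bsub>free_group r\<^esub> a"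
    have ca: "a \<in> words r" "b \<in> words r" using a b by (auto simp: word_ball_def)
    have cy: "?y \<in> words r"
      using ca(2) by (auto simp: free_group_def reduced_inverse inv_letter_def)
    have yb: "?y \<otimes>\<^bsub>free_group r\<^esub> b = \<one>\<^bsub>free_group r\<^esub>"
      using ca(2) by (simp add: free_group_def push_inverse)
    have by1: "b \<otimes>\<^bsub>free_group r\<^esub> ?y = \<one>\<^bsub>free_group r\<^esub>" using G.inv_comm[OF yb] cy ca by simp
    have cg: "?g \<in> words r" using cy ca by simp
    have "length ?g \<le> 2 * R"
      using length_foldr_push[of ?y a] a b by (simp add: word_mult word_ball_def)
    then have gF: "?g \<in> F" using cg by (simp add: F word_ball_def)
    have bg: "b \<otimes>\<^bsub>free_group r\<^esub> ?g = a"
      using by1 cy ca by (simp add: G.m_assoc[symmetric])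
    have "\<sigma> a v = \<sigma> b (\<sigma> ?g v)" using act RF[OF b] gF bg by metis
    then have "\<sigma> b (\<sigma> ?g v) = \<sigma> b v" using eq by simp
    then have "\<sigma> ?g v = v" using permutes_inj[OF perm[OF ca(2)]] by (simp add: inj_eq)
    then have "?g = \<one>\<^bsub>free_group r\<^esub>" using free gF by blast
    then show "a = b" using bg ca by simp
  qed
  moreover have "\<forall>w\<in>word_ball r R. \<sigma> [] (\<sigma> w v) = \<sigma> w v"
    using act RF e by (metis word_mult foldr.simps(1) id_apply)
  moreover have "\<sigma> [(i, True)] (\<sigma> w v) = \<sigma> ((i, True) # w) v" if w: "(i, True) # w \<in> word_ball r R"
    for i w
  proof -
    have "w \<in> F" "[(i, True)] \<in> F" using w by (auto simp: F word_ball_def Cons_in_carrier)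
    moreover have "[(i, True)] \<otimes>\<^bsub>free_group r\<^esub> w = (i, True) # w"
      using w by (cases w) (auto simp: word_mult word_ball_def Cons_in_carrier)
    ultimately show ?thesis using act by metis
  qed
  moreover have "\<sigma> [(i, True)] (\<sigma> ((i, False) # w) v) = \<sigma> w v" if w: "(i, False) # w \<in> word_ball r
    R" for i w
  proof -
    have "(i, False) # w \<in> F" "[(i, True)] \<in> F" using w by (auto simp: F word_ball_def Cons_in_carrier)
    moreover have "[(i, True)] \<otimes>\<^bsub>free_group r\<^esub> ((i, False) # w) = w"
      by (simp add: word_mult inv_letter_def)
    ultimately show ?thesis using act by metis
  qed
  ultimately show ?thesis using \<open>v \<in> V\<close> by (simp add: treelike_def)
qed

lemma sofic_map_treelike:
  assumes "sofic_map r (word_ball r (2 * R + 1)) \<delta> V \<sigma>"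
  shows "real (card {v \<in> V. \<not> treelike R v}) \<le> 2 * \<delta> * real (card V)"
proof (cases "V = {}")
  case False
  let ?F = "word_ball r (2 * R + 1)"
  define P where "P = {v \<in> V. \<forall>g\<in>?F - {\<one>\<^bsub>free_group r\<^esub>}. \<sigma> g v \<noteq> v}"
  define Q where "Q = {v \<in> V. \<forall>g\<in>?F. \<forall>h\<in>?F. \<sigma> (g \<otimes>\<^bsub>free_group r\<^esub> h) v = \<sigma> g (\<sigma> h v)}"
  have n: "real (card V) > 0" using False finite_V by (simp add: card_gt_0_iff)
  have PQ: "P \<subseteq> V" "Q \<subseteq> V" by (auto simp: P_def Q_def)
  have "real (card P) / real (card V) > 1 - \<delta>" "real (card Q) / real (card V) > 1 - \<delta>"
    using assms by (simp_all add: sofic_map_def P_def Q_def)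
  then have "real (card P) > (1 - \<delta>) * real (card V)" "real (card Q) > (1 - \<delta>) * real (card V)"
    using n by (simp_all add: field_simps)
  moreover have "real (card (V - P)) = real (card V) - real (card P)"
    "real (card (V - Q)) = real (card V) - real (card Q)"
    using PQ finite_V by (simp_all add: card_Diff_subset finite_subset of_nat_diff card_mono)
  moreover have "{v \<in> V. \<not> treelike R v} \<subseteq> (V - P) \<union> (V - Q)"
    using sofic_treelike[where R = R, OF _ refl] by (auto simp: P_def Q_def)
  then have "card {v \<in> V. \<not> treelike R v} \<le> card ((V - P) \<union> (V - Q))"
    using finite_V by (intro card_mono) auto
  then have "card {v \<in> V. \<not> treelike R v} \<le> card (V - P) + card (V - Q)"
    using card_Un_le[of "V - P" "V - Q"] by linarith
  then have "real (card {v \<in> V. \<not> treelike R v}) \<le> real (card (V - P)) + real (card (V - Q))"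
    by (simp flip: of_nat_add)
  ultimately show ?thesis by (simp add: algebra_simps)
qed simp

definition local_spin :: "letter list set \<Rightarrow> 'v \<Rightarrow> ('v \<Rightarrow> int) \<Rightarrow> real" where
  "local_spin A v x = spin_prod A (\<lambda>w. x (\<sigma> w v))"

definition avg :: "letter list set \<Rightarrow> ('v \<Rightarrow> int) \<Rightarrow> real" where
  "avg A x = (\<Sum>v\<in>V. local_spin A v x) / real (card V)"

lemma abs_local_spin_le:
  assumes "A \<subseteq> words r" "x \<in> spins V" "v \<in> V"
  shows "\<bar>local_spin A v x\<bar> \<le> 1"
  unfolding local_spin_def
proof (rule abs_spin_prod_le)
  fix a assume "a \<in> A"
  then have "\<sigma> a v \<in> V" using assms in_V[of a v] by auto
  then show "x (\<sigma> a v) = -1 \<or> x (\<sigma> a v) = 1" by (rule spins_cases[OF assms(2)])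
qed

lemma card_times_avg: "real (card V) * avg A x = (\<Sum>v\<in>V. local_spin A v x)"
  using finite_V by (cases "card V = 0") (auto simp: avg_def)

lemma magn_eq_avg: "magn x = real (card V) * avg {[]} x"
  unfolding card_times_avg magn_def
  using sum.permute[OF perm[OF Nil_in_carrier], of "\<lambda>v. spin x v"]
  by (simp add: o_def local_spin_def spin_prod_def)

lemma energy_eq_avg: "energy x = real (card V) * (\<Sum>i<r. avg {[], [(i, True)]} x)"
proof -
  have "energy x = (\<Sum>(i, v)\<in>{..<r} \<times> V. local_spin {[], [(i, True)]} v x)"
    unfolding energy_def edges_def edge_term_def
    by (intro sum.cong) (auto simp: local_spin_def spin_prod_def)
  then show ?thesis by (simp add: sum.cartesian_product[symmetric] sum_distrib_left card_times_avg)
qed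

text \<open>A meeting point determines \<open>v'\<close> from two words of the ball. The bound is
  uniform in \<open>V\<close>, so most pairs of vertices have disjoint neighbourhoods when
  \<open>V\<close> is large.\<close>

lemma card_meeting_balls:
  assumes "v \<in> V"
  shows "card {v' \<in> V. (\<lambda>w. \<sigma> w v) ` word_ball r R \<inter> (\<lambda>w. \<sigma> w v') ` word_ball r R \<noteq> {}}
    \<le> card (word_ball r R) ^ 2"
proof -
  let ?K = "word_ball r R"
  have "{v' \<in> V. (\<lambda>w. \<sigma> w v) ` ?K \<inter> (\<lambda>w. \<sigma> w v') ` ?K \<noteq> {}} \<subseteq>
      (\<lambda>(a, b). inv_into UNIV (\<sigma> b) (\<sigma> a v)) ` (?K \<times> ?K)"
  proof
    fix v' assume "v' \<in> {v' \<in> V. (\<lambda>w. \<sigma> w v) ` ?K \<inter> (\<lambda>w. \<sigma> w v') ` ?K \<noteq> {}}"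
    then obtain a b where ab: "a \<in> ?K" "b \<in> ?K" "\<sigma> a v = \<sigma> b v'" by auto
    then have "inv_into UNIV (\<sigma> b) (\<sigma> a v) = v'"
      using permutes_inverses(2)[OF perm, of b] by (simp add: word_ball_def)
    then show "v' \<in> (\<lambda>(a, b). inv_into UNIV (\<sigma> b) (\<sigma> a v)) ` (?K \<times> ?K)" using ab by force
  qed
  then have "card {v' \<in> V. (\<lambda>w. \<sigma> w v) ` ?K \<inter> (\<lambda>w. \<sigma> w v') ` ?K \<noteq> {}} \<le>
      card ((\<lambda>(a, b). inv_into UNIV (\<sigma> b) (\<sigma> a v)) ` (?K \<times> ?K))"
    by (intro card_mono) auto
  also have "\<dots> \<le> card (?K \<times> ?K)" by (rule card_image_le) simp
  finally show ?thesis by (simp add: card_cartesian_product power2_eq_square)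
qed

lemma avg_first_moment:
  assumes A: "A \<subseteq> word_ball r R" and J: "0 \<le> J" "0 \<le> B"
  shows "real (card V) * tree_mean r R J B B (spin_prod A) - 2 * real (card {v \<in> V. \<not> treelike (Suc
    R) v})
    \<le> real (card V) * gibbs V (ising_weight J B) (avg A)"
proof -
  let ?L = "tree_mean r R J B B (spin_prod A)" and ?W = "ising_weight J B"
  let ?b = "{v \<in> V. \<not> treelike (Suc R) v}"
  have carr: "A \<subseteq> words r" using A by (auto simp: word_ball_def)
  have L: "?L \<le> 1"
  proof -
    have "\<bar>?L\<bar> \<le> 1" unfolding tree_mean_def
      by (rule gibbs_abs_le) (use A spins_cases[of _ "word_ball r R"] in \<open>auto intro!:
        abs_spin_prod_le\<close>)
    then show ?thesis by simp
  qed
  \<comment> \<open>A vertex without a tree-like neighbourhood costs at most \<open>2\<close>, the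
    largest distance between two numbers in \<open>[-1, 1]\<close>.\<close>
  have ge: "?L - (if treelike (Suc R) v then 0 else 2) \<le> gibbs V ?W (local_spin A v)" if v: "v \<in> V"
    for v
  proof (cases "treelike (Suc R) v")
    case True
    interpret treelike_vertex r V \<sigma> v R by unfold_locales (rule True)
    show ?thesis using tree_lower[OF A J] True by (simp add: local_spin_def[abs_def])
  next
    case False
    have "\<bar>gibbs V ?W (local_spin A v)\<bar> \<le> 1"
      by (rule gibbs_abs_le) (use abs_local_spin_le[OF carr] v finite_V in auto)
    then show ?thesis using L False by auto
  qed
  have "real (card V) * ?L - 2 * real (card ?b) = (\<Sum>v\<in>V. ?L - (if treelike (Suc R) v then 0 else 2))"
    using finite_V by (simp add: sum_subtractf sum.If_cases Int_def)
  also have "\<dots> \<le> (\<Sum>v\<in>V. gibbs V ?W (local_spin A v))" by (rule sum_mono) (rule ge)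
  also have "\<dots> = real (card V) * gibbs V ?W (avg A)"
  proof -
    have "gibbs V ?W (avg A) = gibbs V ?W (\<lambda>x. (1 / real (card V)) * (\<Sum>v\<in>V. local_spin A v x))"
      by (simp add: avg_def[abs_def])
    also have "\<dots> = (1 / real (card V)) * (\<Sum>v\<in>V. gibbs V ?W (local_spin A v))"
      by (simp only: gibbs_cmult gibbs_sum)
    finally show ?thesis using finite_V by (cases "V = {}") auto
  qed
  finally show ?thesis .
qed

text \<open>Each pair of vertices is either covered by \<open>tree_upper_pair\<close> or charged the
  trivial bound \<open>1\<close> to a defect: a bad first vertex, a bad second vertex, or meeting
  balls. Along a sofic approximation the defects are a vanishing fraction of all pairs.\<close>

lemma avg_second_moment:
  assumes R: "R \<ge> 1" and A: "A \<subseteq> word_ball r R" and J: "0 \<le> J" "0 \<le> B"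
  shows "(real (card V))\<^sup>2 * gibbs V (ising_weight J B) (\<lambda>x. (avg A x)\<^sup>2) \<le>
    (real (card V))\<^sup>2 * (tree_mean r R J B (B + real (2 * r - 1) * J) (spin_prod A))\<^sup>2 +
    2 * real (card V) * real (card {v \<in> V. \<not> treelike (Suc R) v}) +
    real (card V) * real (card (word_ball r (Suc R)) ^ 2)"
proof -
  let ?U = "(tree_mean r R J B (B + real (2 * r - 1) * J) (spin_prod A))\<^sup>2" and ?W = "ising_weight J B"
  let ?b = "{v \<in> V. \<not> treelike (Suc R) v}" and ?n = "real (card V)"
  let ?i = "\<lambda>v. if treelike (Suc R) v then 0 else 1 :: real"
  let ?meet = "\<lambda>v v'. (\<lambda>w. \<sigma> w v) ` word_ball r (Suc R) \<inter> (\<lambda>w. \<sigma> w v') ` word_ball r (Suc R) \<noteq> {}"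
  let ?m = "\<lambda>v v'. if ?meet v v' then 1 else 0 :: real"
  have carr: "A \<subseteq> words r" using A by (auto simp: word_ball_def)
  have le: "gibbs V ?W (\<lambda>x. local_spin A v x * local_spin A v' x) \<le> ?U + ?i v + ?i v' + ?m v v'"
    if v: "v \<in> V" "v' \<in> V" for v v'
  proof (cases "treelike (Suc R) v \<and> treelike (Suc R) v' \<and> \<not> ?meet v v'")
    case True
    then show ?thesis
      using tree_upper_pair[of R v v' A J B] R A J by (simp add: local_spin_def)
  next
    case False
    have "\<bar>local_spin A v x * local_spin A v' x\<bar> \<le> 1" if "x \<in> spins V" for x
      using abs_local_spin_le[OF carr that] v by (simp add: abs_mult mult_le_one)
    then have "\<bar>gibbs V ?W (\<lambda>x. local_spin A v x * local_spin A v' x)\<bar> \<le> 1"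
      by (intro gibbs_abs_le finite_V) auto
    then have "gibbs V ?W (\<lambda>x. local_spin A v x * local_spin A v' x) \<le> 1" by linarith
    also have "1 \<le> ?U + ?i v + ?i v' + ?m v v'" using False by (auto simp: add_nonneg_nonneg)
    finally show ?thesis .
  qed
  have i: "(\<Sum>v\<in>V. ?i v) = real (card ?b)"
    using finite_V by (simp add: sum.If_cases Int_def)
  have m: "(\<Sum>v'\<in>V. ?m v v') \<le> real (card (word_ball r (Suc R)) ^ 2)" if "v \<in> V" for v
  proof -
    have "(\<Sum>v'\<in>V. ?m v v') = real (card {v' \<in> V. ?meet v v'})"
      using finite_V by (simp add: sum.If_cases Int_def)
    also have "\<dots> \<le> real (card (word_ball r (Suc R)) ^ 2)"
      using card_meeting_balls[OF that] by (rule of_nat_mono)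
    finally show ?thesis .
  qed
  have "?n\<^sup>2 * gibbs V ?W (\<lambda>x. (avg A x)\<^sup>2) = gibbs V ?W (\<lambda>x. ?n\<^sup>2 * (avg A x)\<^sup>2)"
    by (simp only: gibbs_cmult)
  also have "\<dots> = gibbs V ?W (\<lambda>x. \<Sum>v\<in>V. \<Sum>v'\<in>V. local_spin A v x * local_spin A v' x)"
  proof (rule gibbs_cong[OF refl])
    fix x
    from card_times_avg[of A x] show "?n\<^sup>2 * (avg A x)\<^sup>2 = (\<Sum>v\<in>V. \<Sum>v'\<in>V. local_spin A v x *
      local_spin A v' x)"
      by (simp add: power_mult_distrib[symmetric] power2_eq_square[of "_ * _"] power2_eq_square[of
        "sum _ _"]
          sum_product)
  qed
  also have "\<dots> = (\<Sum>v\<in>V. \<Sum>v'\<in>V. gibbs V ?W (\<lambda>x. local_spin A v x * local_spin A v' x))"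
    by (simp only: gibbs_sum)
  also have "\<dots> \<le> (\<Sum>v\<in>V. \<Sum>v'\<in>V. ?U + ?i v + ?i v' + ?m v v')"
    by (intro sum_mono le)
  also have "\<dots> = (\<Sum>v\<in>V. ?n * ?U + ?n * ?i v + real (card ?b) + (\<Sum>v'\<in>V. ?m v v'))"
    by (simp only: sum.distrib i sum_constant)
  also have "\<dots> \<le> (\<Sum>v\<in>V. ?n * ?U + ?n * ?i v + real (card ?b) + real (card (word_ball r (Suc R)) ^ 2))"
    by (intro sum_mono add_left_mono m)
  also have "\<dots> = ?n * (?n * ?U) + ?n * real (card ?b) + ?n * real (card ?b) +
      ?n * real (card (word_ball r (Suc R)) ^ 2)"
    by (simp only: sum.distrib sum_distrib_left[symmetric] i sum_constant)
  finally show ?thesis by (simp add: power2_eq_square algebra_simps)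
qed

text \<open>After expansion of the square the second moment counts positively and, as
  \<open>0 \<le> c\<close>, the first one negatively. So an upper bound from plus boundaries for the
  former and a lower bound from free boundaries for the latter suffice.\<close>

lemma avg_deviation:
  assumes R: "R \<ge> 1" and A: "A \<subseteq> word_ball r R" and J: "0 \<le> J" "0 \<le> B" and c: "0 \<le> c" and V: "V \<noteq> {}"
  shows "gibbs V (ising_weight J B) (\<lambda>x. (avg A x - c)\<^sup>2) \<le>
    (tree_mean r R J B (B + real (2 * r - 1) * J) (spin_prod A))\<^sup>2
    - 2 * c * tree_mean r R J B B (spin_prod A) + c\<^sup>2 +
    ((2 + 4 * c) * (real (card {v \<in> V. \<not> treelike (Suc R) v}) / real (card V))
    + real (card (word_ball r (Suc R)) ^ 2) / real (card V))"
proof -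
  let ?n = "real (card V)" and ?b = "real (card {v \<in> V. \<not> treelike (Suc R) v})"
  let ?K = "real (card (word_ball r (Suc R)) ^ 2)"
  let ?U = "tree_mean r R J B (B + real (2 * r - 1) * J) (spin_prod A)"
  let ?L = "tree_mean r R J B B (spin_prod A)"
  let ?g = "gibbs V (ising_weight J B)"
  have n: "?n > 0" using V finite_V by (simp add: card_gt_0_iff)
  have 1: "?L - 2 * ?b / ?n \<le> ?g (avg A)"
    using avg_first_moment[OF A J] n by (simp add: field_simps)
  have "?n\<^sup>2 * ?g (\<lambda>x. (avg A x)\<^sup>2) \<le> ?n\<^sup>2 * (?U\<^sup>2 + 2 * ?b / ?n + ?K / ?n)"
    using avg_second_moment[OF R A J] n by (simp add: power2_eq_square algebra_simps)
  then have 2: "?g (\<lambda>x. (avg A x)\<^sup>2) \<le> ?U\<^sup>2 + 2 * ?b / ?n + ?K / ?n"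
    using n by simp
  have "2 * c * (?L - 2 * ?b / ?n) \<le> 2 * c * ?g (avg A)" using 1 c by (intro mult_left_mono) auto
  then have "?g (\<lambda>x. (avg A x - c)\<^sup>2) \<le>
      ?U\<^sup>2 + 2 * ?b / ?n + ?K / ?n - 2 * c * (?L - 2 * ?b / ?n) + c\<^sup>2"
    using 2 unfolding gibbs_square_dev[of V "ising_weight J B", OF finite_V ising_weight_pos] by
      linarith
  then show ?thesis by (simp add: algebra_simps add_divide_distrib)
qed

section \<open>The partition function as a function of the coupling\<close>

definition partition_fn :: "real \<Rightarrow> real \<Rightarrow> real" where
  "partition_fn J B = (\<Sum>x\<in>spins V. ising_weight J B x)"

lemma partition_fn_pos: "0 < partition_fn J B"
  unfolding partition_fn_def by (intro sum_pos_spins finite_V) simp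

lemma has_real_derivative_ln_partition:
  assumes "(B has_real_derivative B') (at J within S)"
  shows "((\<lambda>J. ln (partition_fn J (B J))) has_real_derivative
    gibbs V (ising_weight J (B J)) (\<lambda>x. energy x + B' * magn x)) (at J within S)"
proof -
  have "((\<lambda>J. \<Sum>x\<in>spins V. exp (J * energy x + B J * magn x)) has_real_derivative
      (\<Sum>x\<in>spins V. (energy x + B' * magn x) * ising_weight J (B J) x)) (at J within S)"
    unfolding ising_weight_def
    by (intro DERIV_sum) (auto intro!: derivative_eq_intros assms simp: algebra_simps)
  then have "((\<lambda>J. partition_fn J (B J)) has_real_derivative
      (\<Sum>x\<in>spins V. (energy x + B' * magn x) * ising_weight J (B J) x)) (at J within S)"
    by (simp add: partition_fn_def ising_weight_def)
  from DERIV_chain2[OF DERIV_ln[OF partition_fn_pos] this]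
  show ?thesis by (simp add: gibbs_def partition_fn_def divide_inverse mult.commute)
qed

lemma partition_fn_0: "partition_fn 0 B = (2 * cosh B) ^ card V"
proof -
  have "partition_fn 0 B = (\<Sum>x\<in>spins V. \<Prod>v\<in>V. exp (B * spin x v))"
    using finite_V by (simp add: partition_fn_def ising_weight_def magn_def sum_distrib_left exp_sum)
  also have "\<dots> = (\<Prod>v\<in>V. \<Sum>s\<in>{-1, 1::int}. exp (B * real_of_int s))"
    unfolding spins_def using finite_V by (subst prod_sum_PiE) auto
  also have "(\<Sum>s\<in>{-1, 1::int}. exp (B * real_of_int s)) = 2 * cosh B" by (simp add: cosh_def)
  finally show ?thesis by simp
qed

lemma abs_avg_le: "A \<subseteq> words r \<Longrightarrow> x \<in> spins V \<Longrightarrow> \<bar>avg A x\<bar> \<le> 1"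
proof -
  assume A: "A \<subseteq> words r" "x \<in> spins V"
  have "\<bar>\<Sum>v\<in>V. local_spin A v x\<bar> \<le> (\<Sum>v\<in>V. 1)"
    by (rule order_trans[OF sum_abs sum_mono]) (rule abs_local_spin_le[OF A])
  then show ?thesis by (cases "card V = 0") (simp_all add: avg_def divide_le_eq_1 card_gt_0_iff)
qed

end

section \<open>The free energy\<close>

text \<open>\<open>Suc\<close> makes the radius positive, as the recursion over spheres
  demands.\<close>

definition word_radius :: "letter list set \<Rightarrow> nat" where
  "word_radius A = Suc (Max (insert 0 (length ` A)))"

lemma word_radius_ge_1: "1 \<le> word_radius A"
  by (simp add: word_radius_def)

lemma subset_word_ball_radius:
  assumes "finite A" "A \<subseteq> words r"
  shows "A \<subseteq> word_ball r (word_radius A)"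
  using assms Max_ge[of "insert 0 (length ` A)"] by (fastforce simp: word_ball_def word_radius_def
    le_Suc_eq)

text \<open>Correlations of the tree-indexed chain with coupling \<open>J\<close> and cavity field \<open>t\<close>.\<close>

definition tree_corr :: "nat \<Rightarrow> real \<Rightarrow> real \<Rightarrow> letter list set \<Rightarrow> real" where
  "tree_corr r t J A = tree_mean r (word_radius A) J (cavity_field r t J) t (spin_prod A)"

lemma sofic_perm_model: "sofic_approximation r V \<sigma> \<Longrightarrow> perm_model r (V n) (\<sigma> n)"
  by unfold_locales (auto simp: sofic_approximation_def)

lemma sofic_card: "sofic_approximation r V \<sigma> \<Longrightarrow> filterlim (\<lambda>n. real (card (V n))) at_top sequentially"
  by (rule filterlim_compose[OF filterlim_real_sequentially]) (simp add: sofic_approximation_def)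

lemma sofic_card_pos: "sofic_approximation r V \<sigma> \<Longrightarrow> \<forall>\<^sub>F n in sequentially. 0 < card (V n)"
  unfolding sofic_approximation_def filterlim_at_top by (metis (mono_tags, lifting) eventually_mono
    Suc_le_eq)

lemma sofic_treelike_density:
  assumes "sofic_approximation r V \<sigma>"
  shows "(\<lambda>n. real (card {v \<in> V n. \<not> perm_model.treelike r (V n) (\<sigma> n) R v}) / real (card (V n)))
    \<longlonglongrightarrow> 0"
proof (rule tendstoI)
  fix e :: real assume e: "e > 0"
  let ?F = "word_ball r (2 * R + 1)"
  have "finite ?F \<and> ?F \<subseteq> words r \<and> e / 4 > 0"
    using e by (auto simp: word_ball_def intro: finite_word_ball[unfolded word_ball_def])
  then have "\<forall>\<^sub>F n in sequentially. sofic_map r ?F (e / 4) (V n) (\<sigma> n)"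
    using assms unfolding sofic_approximation_def by blast
  then show "\<forall>\<^sub>F n in sequentially. dist (real (card {v \<in> V n. \<not> perm_model.treelike r (V n) (\<sigma> n) R v})
      / real (card (V n))) 0 < e"
    using sofic_card_pos[OF assms]
  proof eventually_elim
    case (elim n)
    then have "real (card {v \<in> V n. \<not> perm_model.treelike r (V n) (\<sigma> n) R v}) \<le> 2 * (e / 4) * real
      (card (V n))"
      by (intro perm_model.sofic_map_treelike sofic_perm_model[OF assms])
    then have "real (card {v \<in> V n. \<not> perm_model.treelike r (V n) (\<sigma> n) R v}) / real (card (V n)) \<le>
      e / 2"
      using elim by (simp add: pos_divide_le_eq)
    then show ?case using e unfolding dist_real_def by (simp only: diff_0_right abs_of_nonneg
      divide_nonneg_nonneg of_nat_0_le_iff)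
  qed
qed

text \<open>The depth \<open>m\<close> is fixed before \<open>n\<close>: it brings the two tree
  bounds together, whatever the graph. The remaining error involves only balls of that fixed depth,
  so it vanishes along the sofic approximation.\<close>

lemma deviation_tendsto:
  assumes sof: "sofic_approximation r V \<sigma>" and pf: "plus_field r J t" and J': "0 \<le> J'" "J' < J"
    and A: "finite A" "A \<subseteq> words r"
  defines "B \<equiv> cavity_field r t J'" and "c \<equiv> tree_corr r t J' A"
  shows "(\<lambda>n. gibbs (V n) (perm_model.ising_weight r (V n) (\<sigma> n) J' B)
    (\<lambda>x. (perm_model.avg (V n) (\<sigma> n) A x - c)\<^sup>2)) \<longlonglongrightarrow> 0"
proof (rule tendstoI)
  fix e :: real assume e: "e > 0"
  let ?R = "word_radius A"
  let ?U = "\<lambda>m. tree_mean r (?R + m) J' B (B + real (2 * r - 1) * J') (spin_prod A)"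
  let ?L = "\<lambda>m. tree_mean r (?R + m) J' B B (spin_prod A)"
  have AR: "A \<subseteq> word_ball r ?R" by (rule subset_word_ball_radius[OF A])
  have B: "0 \<le> B" unfolding B_def by (rule cavity_field_nonneg[OF pf J'])
  have c: "0 \<le> c" unfolding c_def tree_corr_def B_def[symmetric]
    by (rule tree_mean_nonneg[OF J'(1) B plus_field_nonneg[OF pf] AR])
  have "?L \<longlonglongrightarrow> c" "?U \<longlonglongrightarrow> c"
    unfolding c_def tree_corr_def B_def using tree_mean_tendsto[OF pf J' word_radius_ge_1 AR] by blast+
  then have "(\<lambda>m. (?U m)\<^sup>2 - 2 * c * ?L m + c\<^sup>2) \<longlonglongrightarrow> c\<^sup>2 - 2 * c * c + c\<^sup>2"
    by (intro tendsto_intros)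
  then have "(\<lambda>m. (?U m)\<^sup>2 - 2 * c * ?L m + c\<^sup>2) \<longlonglongrightarrow> 0" by (simp add: power2_eq_square)
  then have "\<forall>\<^sub>F m in sequentially. (?U m)\<^sup>2 - 2 * c * ?L m + c\<^sup>2 < e / 2"
    by (rule order_tendstoD) (use e in simp)
  then obtain m where m: "(?U m)\<^sup>2 - 2 * c * ?L m + c\<^sup>2 < e / 2"
    by (auto simp: eventually_sequentially)
  let ?S = "Suc (?R + m)"
  let ?err = "\<lambda>n. (2 + 4 * c) * (real (card {v \<in> V n. \<not> perm_model.treelike r (V n) (\<sigma> n) ?S v}) /
    real (card (V n)))
    + real (card (word_ball r ?S) ^ 2) / real (card (V n))"
  have "?err \<longlonglongrightarrow> (2 + 4 * c) * 0 + 0"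
    by (intro tendsto_intros sofic_treelike_density[OF sof] tendsto_divide_0[OF tendsto_const]
        filterlim_at_top_imp_at_infinity sofic_card[OF sof])
  then have "\<forall>\<^sub>F n in sequentially. ?err n < e / 2"
    by (rule order_tendstoD) (use e in simp)
  then show "\<forall>\<^sub>F n in sequentially. dist (gibbs (V n) (perm_model.ising_weight r (V n) (\<sigma> n) J' B)
    (\<lambda>x. (perm_model.avg (V n) (\<sigma> n) A x - c)\<^sup>2)) 0 < e"
    using sofic_card_pos[OF sof]
  proof eventually_elim
    case (elim n)
    interpret perm_model r "V n" "\<sigma> n" by (rule sofic_perm_model[OF sof])
    let ?g = "gibbs (V n) (ising_weight J' B) (\<lambda>x. (avg A x - c)\<^sup>2)"
    have "?g \<le> (?U m)\<^sup>2 - 2 * c * ?L m + c\<^sup>2 + ?err n"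
      by (rule avg_deviation) (use elim AR J' B c word_radius_ge_1[of A] word_ball_mono[of ?R "?R +
        m" r] in auto)
    then have "?g < e" using m elim(1) by linarith
    moreover have "0 \<le> ?g"
      unfolding gibbs_def by (intro divide_nonneg_nonneg sum_nonneg mult_nonneg_nonneg) (auto intro:
        less_imp_le)
    ultimately show ?case by simp
  qed
qed

lemma avg_mean_tendsto:
  assumes sof: "sofic_approximation r V \<sigma>" and pf: "plus_field r J t" and J': "0 \<le> J'" "J' < J"
    and A: "finite A" "A \<subseteq> words r"
  shows "(\<lambda>n. gibbs (V n) (perm_model.ising_weight r (V n) (\<sigma> n) J' (cavity_field r t J'))
    (perm_model.avg (V n) (\<sigma> n) A)) \<longlonglongrightarrow> tree_corr r t J' A"
proof -
  let ?w = "\<lambda>n. perm_model.ising_weight r (V n) (\<sigma> n) J' (cavity_field r t J')"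
  let ?a = "\<lambda>n. perm_model.avg (V n) (\<sigma> n) A"
  let ?c = "tree_corr r t J' A"
  have "(\<lambda>n. (gibbs (V n) (?w n) (?a n) - ?c)\<^sup>2) \<longlonglongrightarrow> 0"
  proof (rule tendsto_sandwich[OF _ _ tendsto_const deviation_tendsto[OF assms]])
    show "\<forall>\<^sub>F n in sequentially. (gibbs (V n) (?w n) (?a n) - ?c)\<^sup>2 \<le> gibbs (V n) (?w n) (\<lambda>x. (?a n
      x - ?c)\<^sup>2)"
    proof (rule always_eventually, rule allI, rule gibbs_mean_dev)
      fix n
      interpret perm_model r "V n" "\<sigma> n" by (rule sofic_perm_model[OF sof])
      show "finite (V n)" by (rule finite_V)
      show "0 < ?w n x" for x by simp
    qed
  qed simp
  then have "(\<lambda>n. sqrt ((gibbs (V n) (?w n) (?a n) - ?c)\<^sup>2)) \<longlonglongrightarrow> sqrt 0"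
    by (rule tendsto_real_sqrt)
  then show ?thesis by (simp add: tendsto_rabs_zero_iff LIM_zero_iff)
qed

section \<open>Integration along the path of couplings\<close>

definition cavity_field_deriv :: "nat \<Rightarrow> real \<Rightarrow> real \<Rightarrow> real" where
  "cavity_field_deriv r t s = - real (2 * r - 1) * (sinh (2 * t) / (cosh (2 * s) + cosh (2 * t)))"

lemma has_real_derivative_cavity_field:
  "(cavity_field r t has_real_derivative cavity_field_deriv r t s) (at s within S)"
proof -
  have "((\<lambda>s. t - real (2 * r - 1) * cavity s t) has_real_derivative
      0 - real (2 * r - 1) * (sinh (2 * t) / (cosh (2 * s) + cosh (2 * t)))) (at s within S)"
    by (intro DERIV_diff DERIV_const DERIV_cmult has_real_derivative_cavity_J)
  then show ?thesis by (simp add: cavity_field_def[abs_def] cavity_field_deriv_def)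
qed

lemma abs_cavity_field_deriv_le: "\<bar>cavity_field_deriv r t s\<bar> \<le> real (2 * r - 1)"
proof -
  have "\<bar>sinh (2 * t)\<bar> \<le> cosh (2 * t)" by (simp add: sinh_def cosh_def abs_le_iff)
  also have "\<dots> \<le> cosh (2 * s) + cosh (2 * t)" by simp
  finally have "\<bar>sinh (2 * t) / (cosh (2 * s) + cosh (2 * t))\<bar> \<le> 1"
    using cosh_sum_pos[of "2 * s" "2 * t"] by (simp add: abs_divide)
  then show ?thesis
    unfolding cavity_field_deriv_def abs_mult by (intro order_trans[OF mult_left_le]) auto
qed

definition free_energy_deriv :: "nat \<Rightarrow> real \<Rightarrow> real \<Rightarrow> real" where
  "free_energy_deriv r t s = (\<Sum>i<r. tree_corr r t s {[], [(i, True)]})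
     + cavity_field_deriv r t s * tree_corr r t s {[]}"

text \<open>At coupling \<open>0\<close> the field of the path is \<open>t\<close> and the spins are
  independent, which gives \<open>ln (2 * cosh t)\<close>. The integrand is the mean edge
  interaction per vertex plus the rate of change of the field times the mean magnetisation.\<close>

definition free_energy :: "nat \<Rightarrow> real \<Rightarrow> real \<Rightarrow> real" where
  "free_energy r t J = ln (2 * cosh t) + integral {0..J} (free_energy_deriv r t)"

lemma edge_words: "i < r \<Longrightarrow> {[], [(i, True)]} \<subseteq> words r" "{[]} \<subseteq> words r"
  by (auto simp: Cons_in_carrier)

text \<open>The derivative of the log partition function per vertex converges at every coupling
  below \<open>J\<close> and is bounded because correlations are at most \<open>1\<close>, so
  dominated convergence applies to its integral. The limit involves tree correlations only, hence
  not the graphs.\<close>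

lemma ln_partition_tendsto:
  assumes sof: "sofic_approximation r V \<sigma>" and pf: "plus_field r J t" and J': "0 \<le> J'" "J' < J"
  shows "(\<lambda>n. ln (perm_model.partition_fn r (V n) (\<sigma> n) J' (cavity_field r t J')) / real (card (V n)))
    \<longlonglongrightarrow> free_energy r t J'"
proof -
  let ?B = "cavity_field r t" and ?B' = "cavity_field_deriv r t"
  let ?p = "\<lambda>n s. ln (perm_model.partition_fn r (V n) (\<sigma> n) s (?B s)) / real (card (V n))"
  let ?g = "\<lambda>n s. gibbs (V n) (perm_model.ising_weight r (V n) (\<sigma> n) s (?B s))"
  let ?a = "\<lambda>n A. perm_model.avg (V n) (\<sigma> n) A"
  let ?p' = "\<lambda>n s. ?g n s (\<lambda>x. perm_model.energy r (V n) (\<sigma> n) x + ?B' s * perm_model.magn (V n) x)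
    / real (card (V n))"
  let ?q = "\<lambda>n s. (\<Sum>i<r. ?g n s (?a n {[], [(i, True)]})) + ?B' s * ?g n s (?a n {[]})"
  have deriv: "(?p n has_real_derivative ?p' n s) (at s within S)" for n s S
  proof -
    interpret perm_model r "V n" "\<sigma> n" by (rule sofic_perm_model[OF sof])
    show ?thesis
      by (intro DERIV_cdivide has_real_derivative_ln_partition has_real_derivative_cavity_field)
  qed
  have p'_q: "?p' n s = ?q n s" if "card (V n) > 0" for n s
  proof -
    interpret perm_model r "V n" "\<sigma> n" by (rule sofic_perm_model[OF sof])
    have "?g n s (\<lambda>x. energy x + ?B' s * magn x) =
      ?g n s (\<lambda>x. real (card (V n)) * ((\<Sum>i<r. avg {[], [(i, True)]} x) + ?B' s * avg {[]} x))"
      by (rule gibbs_cong) (simp_all add: energy_eq_avg magn_eq_avg algebra_simps)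
    also have "\<dots> = real (card (V n)) * ?q n s"
      by (simp only: gibbs_cmult gibbs_add gibbs_sum)
    finally show ?thesis using that by simp
  qed
  have bound: "norm (?p' n s) \<le> real r + real (2 * r - 1)" for n s
  proof (cases "card (V n) > 0")
    case True
    interpret perm_model r "V n" "\<sigma> n" by (rule sofic_perm_model[OF sof])
    have le: "\<bar>?g n s (avg A)\<bar> \<le> 1" if "A \<subseteq> words r" for A
      by (rule gibbs_abs_le) (use finite_V abs_avg_le[OF that] in auto)
    have "\<bar>?q n s\<bar> \<le> (\<Sum>i<r. \<bar>?g n s (avg {[], [(i, True)]})\<bar>) + \<bar>?B' s\<bar> * \<bar>?g n s (avg {[]})\<bar>"
      unfolding abs_mult[symmetric] by (rule order_trans[OF abs_triangle_ineq add_right_mono[OF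
        sum_abs]])
    also have "\<dots> \<le> (\<Sum>i<r. 1) + real (2 * r - 1) * 1"
      by (intro add_mono sum_mono mult_mono le edge_words abs_cavity_field_deriv_le) auto
    finally show ?thesis using p'_q[OF True] by simp
  next
    case False
    then show ?thesis by simp
  qed
  have conv: "(\<lambda>n. ?p' n s) \<longlonglongrightarrow> free_energy_deriv r t s" if s: "s \<in> {0..J'}" for s
  proof (rule Lim_transform_eventually)
    have s': "0 \<le> s" "s < J" using s J' by auto
    show "(\<lambda>n. ?q n s) \<longlonglongrightarrow> free_energy_deriv r t s"
      unfolding free_energy_deriv_def
      by (intro tendsto_intros avg_mean_tendsto[OF sof pf s'] edge_words) auto
    show "\<forall>\<^sub>F n in sequentially. ?q n s = ?p' n s"
      using sofic_card_pos[OF sof] by eventually_elim (simp add: p'_q)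
  qed
  have ftc: "(?p' n has_integral (?p n J' - ?p n 0)) {0..J'}" for n
    by (rule fundamental_theorem_of_calculus[OF J'(1)])
      (use deriv in \<open>auto simp: has_real_derivative_iff_has_vector_derivative\<close>)
  have "(\<lambda>n. integral {0..J'} (?p' n)) \<longlonglongrightarrow> integral {0..J'} (free_energy_deriv r t)"
    by (rule dominated_convergence(2)[where h = "\<lambda>_. real r + real (2 * r - 1)"])
      (use ftc bound conv in \<open>auto simp: has_integral_integrable\<close>)
  then have lim: "(\<lambda>n. ln (2 * cosh t) + (?p n J' - ?p n 0)) \<longlonglongrightarrow> free_energy r t J'"
    unfolding free_energy_def integral_unique[OF ftc] by (intro tendsto_intros)
  show ?thesis
  proof (rule Lim_transform_eventually[OF lim])
    show "\<forall>\<^sub>F n in sequentially. ln (2 * cosh t) + (?p n J' - ?p n 0) = ?p n J'"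
      using sofic_card_pos[OF sof]
    proof eventually_elim
      case (elim n)
      interpret perm_model r "V n" "\<sigma> n" by (rule sofic_perm_model[OF sof])
      have "ln (partition_fn 0 (?B 0)) = real (card (V n)) * ln (2 * cosh t)"
        using ln_realpow[of "2 * cosh t" "card (V n)"]
        by (simp only: partition_fn_0 cavity_field_def cavity_0 mult_zero_right diff_zero)
      then show ?case using elim by simp
    qed
  qed
qed

text \<open>Continuity at \<open>J\<close> itself links the Gibbs measures, which are controlled for
  \<open>s < J\<close> only, to the chain, which lives at \<open>J\<close>.\<close>

lemma tree_corr_tendsto: "((\<lambda>s. tree_corr r t s A) \<longlongrightarrow> tree_corr r t J A) (at J within S)"
proof -
  have "continuous (at J within S) (cavity_field r t)"
    by (rule DERIV_continuous[OF has_real_derivative_cavity_field])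
  then show ?thesis
    unfolding tree_corr_def
    by (intro tendsto_tree_mean tendsto_const tendsto_ident_at) (simp add: continuous_within)
qed

section \<open>Counting good models\<close>

context perm_model
begin

definition near_models :: "letter list set set \<Rightarrow> real \<Rightarrow> (letter list set \<Rightarrow> real) \<Rightarrow> ('v \<Rightarrow> int) set" where
  "near_models \<A> \<epsilon> c = {x \<in> spins V. \<forall>A\<in>\<A>. \<bar>avg A x - c A\<bar> < \<epsilon>}"

lemma finite_near_models: "finite (near_models \<A> \<epsilon> c)"
  unfolding near_models_def using finite_V by simp

text \<open>A global flip multiplies the average over \<open>A\<close> by
  \<open>(-1) ^ card A\<close>. The minus state thus has exactly as many models as the plus state,
  and the analysis of the plus state serves for both.\<close>

lemma card_flip_near_models:
  "card (near_models \<A> \<epsilon> (\<lambda>A. (-1) ^ card A * c A)) = card (near_models \<A> \<epsilon> c)"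
  if \<A>: "\<And>A. A \<in> \<A> \<Longrightarrow> A \<subseteq> words r"
proof -
  let ?f = "spin_flip V"
  have avg: "avg A (?f x) = (-1) ^ card A * avg A x" if "A \<in> \<A>" for A x
  proof -
    have "local_spin A v (?f x) = (-1) ^ card A * local_spin A v x" if "v \<in> V" for v
      unfolding local_spin_def by (rule spin_prod_flip) (use \<A>[OF \<open>A \<in> \<A>\<close>] in_V that in auto)
    then show ?thesis by (simp add: avg_def sum_distrib_left)
  qed
  have sgn: "\<bar>(-1) ^ k * a - (-1) ^ k * b\<bar> = \<bar>a - b\<bar>" for k and a b :: real
    by (simp add: right_diff_distrib[symmetric] abs_mult power_abs)
  have sq: "(-1) ^ k * ((-1) ^ k * a) = a" for k and a :: real
    by (simp add: mult.assoc[symmetric] power_mult_distrib[symmetric])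
  have "bij_betw ?f (near_models \<A> \<epsilon> c) (near_models \<A> \<epsilon> (\<lambda>A. (-1) ^ card A * c A))"
  proof (rule bij_betwI[where g = ?f])
    show "?f \<in> near_models \<A> \<epsilon> c \<rightarrow> near_models \<A> \<epsilon> (\<lambda>A. (-1) ^ card A * c A)"
      unfolding near_models_def using spin_flip_in avg sgn by auto
    show "?f \<in> near_models \<A> \<epsilon> (\<lambda>A. (-1) ^ card A * c A) \<rightarrow> near_models \<A> \<epsilon> c"
    proof
      fix x assume x: "x \<in> near_models \<A> \<epsilon> (\<lambda>A. (-1) ^ card A * c A)"
      have "\<bar>avg A (?f x) - c A\<bar> < \<epsilon>" if A: "A \<in> \<A>" for A
      proof -
        have "\<bar>avg A (?f x) - c A\<bar> = \<bar>(-1) ^ card A * avg A x - (-1) ^ card A * ((-1) ^ card A * c A)\<bar>"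
          unfolding avg[OF A] sq ..
        also have "\<dots> = \<bar>avg A x - (-1) ^ card A * c A\<bar>" by (rule sgn)
        also have "\<dots> < \<epsilon>" using x A by (simp add: near_models_def)
        finally show ?thesis .
      qed
      then show "?f x \<in> near_models \<A> \<epsilon> c" using x spin_flip_in by (auto simp: near_models_def)
    qed
  qed (use spin_flip_flip in \<open>auto simp: near_models_def\<close>)
  then show ?thesis by (simp add: bij_betw_same_card)
qed

end

text \<open>The correlations that determine energy and magnetisation: fixing them approximately
  fixes the Boltzmann weight of a configuration at every coupling of the path.\<close>

definition edge_family :: "nat \<Rightarrow> letter list set set" where
  "edge_family r = insert {[]} ((\<lambda>i. {[], [(i, True)]}) ` {..<r})"

definition mean_log_weight :: "nat \<Rightarrow> real \<Rightarrow> (letter list set \<Rightarrow> real) \<Rightarrow> real \<Rightarrow> real" where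
  "mean_log_weight r t c s = s * (\<Sum>i<r. c {[], [(i, True)]}) + cavity_field r t s * c {[]}"

lemma (in perm_model) abs_log_weight:
  assumes x: "x \<in> near_models \<A> \<epsilon> c" and \<A>: "edge_family r \<subseteq> \<A>" and s: "0 \<le> s" "0 \<le> cavity_field r t s"
  shows "\<bar>ln (ising_weight s (cavity_field r t s) x) - real (card V) * mean_log_weight r t c s\<bar>
    \<le> real (card V) * (\<epsilon> * (s * real r + cavity_field r t s))"
proof -
  let ?B = "cavity_field r t s" and ?n = "real (card V)"
  let ?e = "\<lambda>i. {[], [(i, True)]} :: letter list set"
  have d: "\<bar>avg A x - c A\<bar> \<le> \<epsilon>" if "A \<in> edge_family r" for A
    using x \<A> that by (auto simp: near_models_def less_imp_le)
  have "ln (ising_weight s ?B x) - ?n * mean_log_weight r t c s =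
      ?n * (s * (\<Sum>i<r. avg (?e i) x - c (?e i)) + ?B * (avg {[]} x - c {[]}))"
    by (simp add: ising_weight_def energy_eq_avg magn_eq_avg mean_log_weight_def sum_subtractf
      algebra_simps)
  also have "\<bar>\<dots>\<bar> \<le> ?n * (s * (\<Sum>i<r. \<bar>avg (?e i) x - c (?e i)\<bar>) + ?B * \<bar>avg {[]} x - c {[]}\<bar>)"
    unfolding abs_mult abs_of_nat
    by (intro mult_left_mono order_trans[OF abs_triangle_ineq] add_mono)
      (use s in \<open>auto simp: abs_mult intro!: mult_left_mono sum_abs\<close>)
  also have "\<dots> \<le> ?n * (s * (\<Sum>i<r. \<epsilon>) + ?B * \<epsilon>)"
    by (intro mult_left_mono add_mono sum_mono d) (use s in \<open>auto simp: edge_family_def\<close>)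
  also have "\<dots> = ?n * (\<epsilon> * (s * real r + ?B))" by (simp add: algebra_simps)
  finally show ?thesis .
qed

text \<open>A Gibbs entropy per vertex, free energy minus mean log weight, with two parameters kept
  apart: the weights are those at \<open>s\<close>, the correlations those of the state at
  \<open>J\<close> whose models are counted.\<close>

definition entropy_bound :: "nat \<Rightarrow> real \<Rightarrow> real \<Rightarrow> real \<Rightarrow> real" where
  "entropy_bound r t J s = free_energy r t s - mean_log_weight r t (tree_corr r t J) s"

text \<open>Every near model has weight at least about \<open>exp (n * mean_log_weight)\<close> for
  \<open>n\<close> vertices, and all the weights together are at most the partition
  function.\<close>

lemma near_models_upper:
  assumes sof: "sofic_approximation r V \<sigma>" and pf: "plus_field r J t" and s: "0 \<le> s" "s < J"
    and \<eta>: "0 < \<eta>"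
  shows "\<exists>\<epsilon>>0. \<forall>\<^sub>F n in sequentially.
    real (card (perm_model.near_models (V n) (\<sigma> n) (edge_family r) \<epsilon> (tree_corr r t J)))
    \<le> exp (real (card (V n)) * (entropy_bound r t J s + \<eta>))"
proof -
  let ?B = "cavity_field r t s" and ?c = "tree_corr r t J"
  have B: "0 \<le> ?B" by (rule cavity_field_nonneg[OF pf s])
  \<comment> \<open>Chosen so that the error in \<open>abs_log_weight\<close> is at most
    \<open>\<eta> / 2\<close> per vertex; the summand \<open>1\<close> keeps the denominator
    positive.\<close>
  define \<epsilon> where "\<epsilon> = \<eta> / (2 * (s * real r + ?B + 1))"
  have pos: "s * real r + ?B + 1 > 0" using s B by (simp add: add_nonneg_pos)
  have \<epsilon>: "0 < \<epsilon>" using \<eta> pos by (simp add: \<epsilon>_def)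
  have \<epsilon>2: "\<epsilon> * (s * real r + ?B) \<le> \<eta> / 2"
  proof -
    have "\<epsilon> * (s * real r + ?B) \<le> \<epsilon> * (s * real r + ?B + 1)" using \<epsilon> by simp
    also have "\<dots> = \<eta> / 2" using pos by (simp add: \<epsilon>_def field_simps)
    finally show ?thesis .
  qed
  have "\<forall>\<^sub>F n in sequentially. ln (perm_model.partition_fn r (V n) (\<sigma> n) s ?B) / real (card (V n))
      < free_energy r t s + \<eta> / 2"
    by (rule order_tendstoD[OF ln_partition_tendsto[OF sof pf s]]) (use \<eta> in simp)
  then have "\<forall>\<^sub>F n in sequentially.
    real (card (perm_model.near_models (V n) (\<sigma> n) (edge_family r) \<epsilon> ?c))
    \<le> exp (real (card (V n)) * (entropy_bound r t J s + \<eta>))"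
    using sofic_card_pos[OF sof]
  proof eventually_elim
    case (elim n)
    interpret perm_model r "V n" "\<sigma> n" by (rule sofic_perm_model[OF sof])
    let ?n = "real (card (V n))" and ?N = "near_models (edge_family r) \<epsilon> ?c"
    let ?m = "mean_log_weight r t ?c s"
    have w: "exp (?n * (?m - \<eta> / 2)) \<le> ising_weight s ?B x" if x: "x \<in> ?N" for x
    proof -
      have "?n * ?m - ?n * (\<eta> / 2) \<le> ln (ising_weight s ?B x)"
        using abs_log_weight[OF x order.refl s(1) B] mult_left_mono[OF \<epsilon>2, of ?n] by auto
      then have "exp (?n * (?m - \<eta> / 2)) \<le> exp (ln (ising_weight s ?B x))"
        by (subst exp_le_cancel_iff) (simp add: algebra_simps)
      then show ?thesis by simp
    qed
    have "real (card ?N) * exp (?n * (?m - \<eta> / 2)) = (\<Sum>x\<in>?N. exp (?n * (?m - \<eta> / 2)))" by simp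
    also have "\<dots> \<le> (\<Sum>x\<in>?N. ising_weight s ?B x)" by (rule sum_mono) (rule w)
    also have "\<dots> \<le> partition_fn s ?B"
      unfolding partition_fn_def using finite_V
      by (intro sum_mono2) (auto simp: near_models_def less_imp_le)
    also have "\<dots> = exp (ln (partition_fn s ?B))" by (simp add: partition_fn_pos)
    also have "\<dots> \<le> exp (?n * (free_energy r t s + \<eta> / 2))"
      using elim by (simp add: divide_less_eq mult.commute)
    finally have "real (card ?N) \<le> exp (?n * (free_energy r t s + \<eta> / 2)) / exp (?n * (?m - \<eta> / 2))"
      by (simp add: pos_le_divide_eq)
    also have "\<dots> = exp (?n * (entropy_bound r t J s + \<eta>))"
      by (simp add: exp_diff[symmetric] entropy_bound_def algebra_simps)
    finally show ?case .
  qed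
  with \<epsilon> show ?thesis by blast
qed

text \<open>For \<open>s\<close> close to \<open>J\<close> the Gibbs measure at \<open>s\<close>
  eventually gives mass at least \<open>1 / 2\<close> to the near models of the state at
  \<open>J\<close>, and each of them has weight at most about
  \<open>exp (n * mean_log_weight)\<close>; so there must be many.\<close>

lemma near_models_lower:
  assumes sof: "sofic_approximation r V \<sigma>" and pf: "plus_field r J t"
    and \<A>: "finite \<A>" "\<And>A. A \<in> \<A> \<Longrightarrow> finite A \<and> A \<subseteq> words r"
    and \<epsilon>: "0 < \<epsilon>" and \<eta>: "0 < \<eta>"
  shows "\<exists>s. 0 \<le> s \<and> s < J \<and> (\<forall>\<^sub>F n in sequentially.
    exp (real (card (V n)) * (entropy_bound r t J s - \<eta>)) \<le>
    real (card (perm_model.near_models (V n) (\<sigma> n) \<A> \<epsilon> (tree_corr r t J))))"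
proof -
  let ?c = "tree_corr r t J"
  \<comment> \<open>Enlarged so that the models counted have controlled weights as well; this only
    shrinks the set of models.\<close>
  define \<A>' where "\<A>' = \<A> \<union> edge_family r"
  have J: "0 < J" and t: "0 \<le> t" using pf plus_field_nonneg by (auto simp: plus_field_def)
  have \<A>': "finite \<A>'" "\<And>A. A \<in> \<A>' \<Longrightarrow> finite A \<and> A \<subseteq> words r"
    using \<A> edge_words by (auto simp: \<A>'_def edge_family_def)
  \<comment> \<open>Bounds \<open>s * real r + cavity_field r t s\<close> for all \<open>s\<close>
    between \<open>0\<close> and \<open>J\<close> at once, because \<open>\<delta>\<close> has to be
    fixed before \<open>s\<close>.\<close>
  define M where "M = J * real r + t + 1"
  have M: "0 < M" using J t by (simp add: M_def add_nonneg_pos)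
  \<comment> \<open>Half of \<open>\<delta>\<close> is spent on moving the correlations from
    \<open>J\<close> to \<open>s\<close>, half on the fluctuations at \<open>s\<close>.\<close>
  define \<delta> where "\<delta> = min \<epsilon> (\<eta> / (2 * M))"
  have \<delta>: "0 < \<delta>" "\<delta> \<le> \<epsilon>" "\<delta> * M \<le> \<eta> / 2"
  proof -
    show "0 < \<delta>" "\<delta> \<le> \<epsilon>" using \<epsilon> \<eta> M by (auto simp: \<delta>_def)
    have "\<delta> * M \<le> \<eta> / (2 * M) * M" using M by (intro mult_right_mono) (auto simp: \<delta>_def)
    then show "\<delta> * M \<le> \<eta> / 2" using M by simp
  qed
  have "\<forall>\<^sub>F s in at_left J. \<forall>A\<in>\<A>'. \<bar>tree_corr r t s A - ?c A\<bar> < \<delta> / 2"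
    using \<A>'(1)
  proof (subst eventually_ball_finite_distrib, simp, intro ballI)
    fix A
    show "\<forall>\<^sub>F s in at_left J. \<bar>tree_corr r t s A - ?c A\<bar> < \<delta> / 2"
      using tendstoD[OF tree_corr_tendsto, of "\<delta> / 2"] \<delta>(1) by (simp add: dist_real_def)
  qed
  moreover have "\<forall>\<^sub>F s in at_left J. s \<in> {0<..<J}"
    by (rule eventually_at_left_real[OF J])
  ultimately have ev: "\<forall>\<^sub>F s in at_left J. s \<in> {0<..<J} \<and> (\<forall>A\<in>\<A>'. \<bar>tree_corr r t s A - ?c A\<bar> < \<delta> / 2)"
    by eventually_elim auto
  then obtain s where "s \<in> {0<..<J}" and near: "\<And>A. A \<in> \<A>' \<Longrightarrow> \<bar>tree_corr r t s A - ?c A\<bar> < \<delta> / 2"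
    using eventually_happens'[OF trivial_limit_at_left_real ev] by blast
  then have s: "0 \<le> s" "s < J" by auto
  let ?B = "cavity_field r t s"
  have B: "0 \<le> ?B" by (rule cavity_field_nonneg[OF pf s])
  have Bt: "?B \<le> t" using cavity_mono[OF s(1) t] by (simp add: cavity_field_def)
  have sM: "s * real r + ?B \<le> M"
    using Bt s mult_right_mono[of s J "real r"] by (simp add: M_def)
  let ?dev = "\<lambda>n A. gibbs (V n) (perm_model.ising_weight r (V n) (\<sigma> n) s ?B)
    (\<lambda>x. (perm_model.avg (V n) (\<sigma> n) A x - tree_corr r t s A)\<^sup>2)"
  have "(\<lambda>n. (\<Sum>A\<in>\<A>'. ?dev n A / (\<delta> / 2)\<^sup>2)) \<longlonglongrightarrow> (\<Sum>A\<in>\<A>'. 0 / (\<delta> / 2)\<^sup>2)"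
    by (intro tendsto_intros deviation_tendsto[OF sof pf s]) (use \<A>' \<delta>(1) in auto)
  then have "\<forall>\<^sub>F n in sequentially. (\<Sum>A\<in>\<A>'. ?dev n A / (\<delta> / 2)\<^sup>2) < 1 / 2"
    by (rule order_tendstoD) simp
  moreover have "\<forall>\<^sub>F n in sequentially. ln (perm_model.partition_fn r (V n) (\<sigma> n) s ?B) / real (card
    (V n))
      > free_energy r t s - \<eta> / 4"
    by (rule order_tendstoD[OF ln_partition_tendsto[OF sof pf s]]) (use \<eta> in simp)
  moreover have "\<forall>\<^sub>F n in sequentially. real (card (V n)) > 4 * ln 2 / \<eta>"
    using sofic_card[OF sof] by (simp add: filterlim_at_top_dense)
  ultimately have "\<forall>\<^sub>F n in sequentially.
    exp (real (card (V n)) * (entropy_bound r t J s - \<eta>)) \<le>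
    real (card (perm_model.near_models (V n) (\<sigma> n) \<A> \<epsilon> ?c))"
    using sofic_card_pos[OF sof]
  proof eventually_elim
    case (elim n)
    interpret perm_model r "V n" "\<sigma> n" by (rule sofic_perm_model[OF sof])
    let ?n = "real (card (V n))" and ?N = "near_models \<A>' \<delta> ?c" and ?W = "ising_weight s ?B"
    let ?m = "mean_log_weight r t ?c s"
    have w: "?W x \<le> exp (?n * (?m + \<eta> / 2))" if x: "x \<in> ?N" for x
    proof -
      have "\<delta> * (s * real r + ?B) \<le> \<delta> * M" using sM \<delta>(1) by (intro mult_left_mono) auto
      then have "\<delta> * (s * real r + ?B) \<le> \<eta> / 2" using \<delta>(3) by linarith
      from mult_left_mono[OF this, of ?n] have "ln (?W x) \<le> ?n * ?m + ?n * (\<eta> / 2)"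
        using abs_log_weight[OF x _ s(1) B] by (auto simp: \<A>'_def)
      then have "exp (ln (?W x)) \<le> exp (?n * (?m + \<eta> / 2))"
        by (subst exp_le_cancel_iff) (simp add: algebra_simps)
      then show ?thesis by simp
    qed
    \<comment> \<open>Pointwise form of Chebyshev's inequality with a union bound over
      \<open>\<A>'\<close>.\<close>
    have cheb: "1 - (\<Sum>A\<in>\<A>'. (avg A x - tree_corr r t s A)\<^sup>2 / (\<delta> / 2)\<^sup>2) \<le> indicator ?N x"
      if x: "x \<in> spins (V n)" for x
    proof (cases "x \<in> ?N")
      case True
      then show ?thesis by (simp add: sum_nonneg)
    next
      case False
      then obtain A where A: "A \<in> \<A>'" "\<delta> \<le> \<bar>avg A x - ?c A\<bar>" using x by (auto simp: near_models_def
        not_less)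
      then have "\<delta> / 2 \<le> \<bar>avg A x - tree_corr r t s A\<bar>" using near[OF A(1)] by linarith
      then have "(\<delta> / 2)\<^sup>2 \<le> (avg A x - tree_corr r t s A)\<^sup>2"
        using \<delta>(1) by (metis abs_le_square_iff abs_of_pos half_gt_zero)
      then have "1 \<le> (avg A x - tree_corr r t s A)\<^sup>2 / (\<delta> / 2)\<^sup>2" using \<delta>(1) by (simp add: divide_simps)
      also have "\<dots> \<le> (\<Sum>A\<in>\<A>'. (avg A x - tree_corr r t s A)\<^sup>2 / (\<delta> / 2)\<^sup>2)"
        by (rule member_le_sum[OF A(1)]) (auto simp: \<A>'(1))
      finally show ?thesis using False by simp
    qed
    have "1 / 2 \<le> 1 + (-1) * (\<Sum>A\<in>\<A>'. 1 / (\<delta> / 2)\<^sup>2 * ?dev n A)" using elim(1) by simp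
    also have "\<dots> = gibbs (V n) ?W (\<lambda>x. 1) +
        (-1) * gibbs (V n) ?W (\<lambda>x. \<Sum>A\<in>\<A>'. 1 / (\<delta> / 2)\<^sup>2 * (avg A x - tree_corr r t s A)\<^sup>2)"
      using gibbs_const[of "V n" ?W 1, OF finite_V ising_weight_pos] by (simp only: gibbs_cmult
        gibbs_sum)
    also have "\<dots> = gibbs (V n) ?W (\<lambda>x. 1 + (-1) * (\<Sum>A\<in>\<A>'. 1 / (\<delta> / 2)\<^sup>2 * (avg A x - tree_corr r t s
      A)\<^sup>2))"
      by (simp only: gibbs_cmult gibbs_add)
    also have "\<dots> \<le> gibbs (V n) ?W (indicator ?N)"
      by (rule gibbs_mono) (use cheb in \<open>auto simp: less_imp_le\<close>)
    also have "\<dots> = (\<Sum>x\<in>?N. ?W x) / partition_fn s ?B"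
    proof -
      have "(\<Sum>x\<in>spins (V n). indicator ?N x * ?W x) = (\<Sum>x\<in>?N. ?W x)"
        using finite_V by (intro sum.mono_neutral_cong_right) (auto simp: near_models_def)
      then show ?thesis by (simp add: gibbs_def partition_fn_def)
    qed
    finally have half: "partition_fn s ?B / 2 \<le> (\<Sum>x\<in>?N. ?W x)"
      using partition_fn_pos[of s ?B] by (simp add: field_simps)
    \<comment> \<open>\<open>ln 2\<close> is the price of keeping only half of the mass; for large
      \<open>n\<close> it and the error of the free energy cost at most \<open>\<eta> / 4\<close>
      per vertex each.\<close>
    have "ln 2 \<le> ?n * (\<eta> / 4)" using elim(3) \<eta> by (simp add: field_simps)
    moreover have "?n * (free_energy r t s - \<eta> / 4) \<le> ln (partition_fn s ?B)"
      using elim by (simp add: less_divide_eq mult.commute)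
    ultimately have "?n * (free_energy r t s - \<eta> / 2) \<le> ln (partition_fn s ?B / 2)"
      using partition_fn_pos[of s ?B] by (simp add: ln_div algebra_simps)
    then have "exp (?n * (free_energy r t s - \<eta> / 2)) \<le> exp (ln (partition_fn s ?B / 2))"
      by simp
    also have "\<dots> = partition_fn s ?B / 2" using partition_fn_pos[of s ?B] by simp
    also note half
    also have "(\<Sum>x\<in>?N. ?W x) \<le> (\<Sum>x\<in>?N. exp (?n * (?m + \<eta> / 2)))" by (rule sum_mono) (rule w)
    also have "\<dots> = real (card ?N) * exp (?n * (?m + \<eta> / 2))" by simp
    finally have "exp (?n * (free_energy r t s - \<eta> / 2)) / exp (?n * (?m + \<eta> / 2)) \<le> real (card ?N)"
      by (simp add: pos_divide_le_eq)
    moreover have "exp (?n * (free_energy r t s - \<eta> / 2)) / exp (?n * (?m + \<eta> / 2)) =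
        exp (?n * (entropy_bound r t J s - \<eta>))"
      by (simp add: exp_diff[symmetric] entropy_bound_def algebra_simps)
    moreover have "?N \<subseteq> near_models \<A> \<epsilon> ?c"
      using \<delta>(2) by (auto simp: near_models_def \<A>'_def intro: less_le_trans)
    then have "card ?N \<le> card (near_models \<A> \<epsilon> ?c)"
      by (intro card_mono finite_near_models)
    ultimately show ?case by linarith
  qed
  with s show ?thesis by blast
qed

section \<open>Weak* neighbourhoods and correlations\<close>

abbreviation fin_words :: "nat \<Rightarrow> letter list set set" where
  "fin_words r \<equiv> {A. finite A \<and> A \<subseteq> words r}"

section \<open>Borel structure and continuous functions on configurations\<close>

lemma topspace_config_top: "topspace (config_top r) = spins (words r)"
  by (simp add: config_top_def spins_def)

lemma space_config_borel: "space (config_borel r) = spins (words r)"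
  by (simp add: config_borel_def topspace_config_top space_measure_of_conv)

lemma sets_config_borel:
  "sets (config_borel r) = sigma_sets (spins (words r)) {U. openin (config_top r) U}"
  unfolding config_borel_def topspace_config_top[symmetric]
  by (rule sets_measure_of) (auto dest: openin_subset)

lemma borel_probs_sets: "\<nu> \<in> borel_probs r \<Longrightarrow> sets \<nu> = sets (config_borel r)"
  by (simp add: borel_probs_def)

lemma borel_probs_space: "\<nu> \<in> borel_probs r \<Longrightarrow> space \<nu> = spins (words r)"
  using sets_eq_imp_space_eq[OF borel_probs_sets] space_config_borel by metis

lemma borel_measurable_continuous_config:
  assumes "continuous_map (config_top r) euclideanreal f"
  shows "f \<in> borel_measurable (config_borel r)"
proof (rule borel_measurableI)
  fix S :: "real set" assume "open S"
  then have "openin (config_top r) {x \<in> topspace (config_top r). f x \<in> S}"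
    by (intro openin_continuous_map_preimage[OF assms]) simp
  then have "{x \<in> spins (words r). f x \<in> S} \<in> sets (config_borel r)"
    unfolding sets_config_borel topspace_config_top by (intro sigma_sets.Basic) simp
  moreover have "f -` S \<inter> space (config_borel r) = {x \<in> spins (words r). f x \<in> S}"
    by (auto simp: space_config_borel)
  ultimately show "f -` S \<inter> space (config_borel r) \<in> sets (config_borel r)" by simp
qed

lemma borel_probs_measurable:
  "\<nu> \<in> borel_probs r \<Longrightarrow> continuous_map (config_top r) euclideanreal f \<Longrightarrow> f \<in> borel_measurable \<nu>"
  using borel_measurable_continuous_config measurable_cong_sets[OF borel_probs_sets refl] by blast

lemma continuous_spin:
  assumes "g \<in> words r"
  shows "continuous_map (config_top r) euclideanreal (\<lambda>x. spin x g)"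
proof -
  have "continuous_map (config_top r) (discrete_topology {-1, 1}) (\<lambda>x. x g)"
    unfolding config_top_def using assms by (rule continuous_map_product_projection)
  from continuous_map_compose[OF this, of euclideanreal real_of_int] show ?thesis by (simp add: o_def)
qed

lemma continuous_spin_prod:
  assumes "A \<in> fin_words r"
  shows "continuous_map (config_top r) euclideanreal (spin_prod A)"
  unfolding spin_prod_def using assms by (intro continuous_map_prod continuous_spin) auto

lemma integrable_spin_prod:
  assumes "\<nu> \<in> borel_probs r" "A \<in> fin_words r"
  shows "integrable \<nu> (spin_prod A)"
proof -
  interpret prob_space \<nu> using assms(1) by (simp add: borel_probs_def)
  have "AE x in \<nu>. norm (spin_prod A x) \<le> 1"
  proof (rule AE_I2)
    fix x assume "x \<in> space \<nu>"
    then have "x \<in> spins (words r)" using borel_probs_space[OF assms(1)] by simp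
    then show "norm (spin_prod A x) \<le> 1"
      unfolding real_norm_def by (intro abs_spin_prod_le) (use assms(2) in \<open>auto dest: spins_cases\<close>)
  qed
  then show ?thesis
    by (rule integrable_const_bound) (rule borel_probs_measurable[OF assms(1)
      continuous_spin_prod[OF assms(2)]])
qed

text \<open>By compactness finitely many basic open sets, on each of which \<open>f\<close> varies
  by less than \<open>e\<close>, cover the space; together they constrain only finitely many
  coordinates.\<close>

lemma continuous_config_local:
  assumes f: "continuous_map (config_top r) euclideanreal f" and e: "0 < e"
  obtains K where "K \<in> fin_words r"
    "\<And>x y. x \<in> spins (words r) \<Longrightarrow> y \<in> spins (words r) \<Longrightarrow>
      (\<forall>k\<in>K. x k = y k) \<Longrightarrow> \<bar>f x - f y\<bar> < e"
proof -
  let ?C = "words r" and ?D = "\<lambda>_::letter list. discrete_topology {-1, 1::int}"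
  \<comment> \<open>Half of \<open>e\<close>, because two points of one basic set are compared
    through its centre.\<close>
  have ex: "\<exists>U. finite {i \<in> ?C. U i \<noteq> {-1, 1}} \<and> (\<forall>i\<in>?C. U i \<subseteq> {-1, 1}) \<and> x \<in> PiE ?C U \<and>
      PiE ?C U \<subseteq> {y \<in> spins ?C. f y \<in> ball (f x) (e / 2)}" if x: "x \<in> spins ?C" for x
  proof -
    have "openin (config_top r) {y \<in> topspace (config_top r). f y \<in> ball (f x) (e / 2)}"
      by (intro openin_continuous_map_preimage[OF f]) simp
    from this[unfolded config_top_def openin_product_topology_alt, rule_format, of x]
    show ?thesis using x e by (simp add: spins_def)
  qed
  define U where "U x = (SOME U. finite {i \<in> ?C. U i \<noteq> {-1, 1}} \<and> (\<forall>i\<in>?C. U i \<subseteq> {-1, 1}) \<and> x \<in> PiE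
    ?C U \<and>
      PiE ?C U \<subseteq> {y \<in> spins ?C. f y \<in> ball (f x) (e / 2)})" for x
  have U: "finite {i \<in> ?C. U x i \<noteq> {-1, 1}}" "\<forall>i\<in>?C. U x i \<subseteq> {-1, 1}" "x \<in> PiE ?C (U x)"
      "PiE ?C (U x) \<subseteq> {y \<in> spins ?C. f y \<in> ball (f x) (e / 2)}" if "x \<in> spins ?C" for x
    using someI_ex[OF ex[OF that]] unfolding U_def by blast+
  have op: "openin (config_top r) (PiE ?C (U x))" if "x \<in> spins ?C" for x
    unfolding config_top_def openin_PiE_gen using U(1,2)[OF that] by simp
  let ?\<U> = "(\<lambda>x. PiE ?C (U x)) ` spins ?C"
  have cpt: "compact_space (config_top r)"
    unfolding config_top_def by (simp add: compact_space_product_topology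
      compact_space_discrete_topology)
  have opU: "\<forall>W\<in>?\<U>. openin (config_top r) W" using op by blast
  have cover: "\<Union>?\<U> = topspace (config_top r)"
  proof
    show "\<Union>?\<U> \<subseteq> topspace (config_top r)"
      unfolding topspace_config_top using U(4) by (intro UN_least) blast
    show "topspace (config_top r) \<subseteq> \<Union>?\<U>"
      unfolding topspace_config_top using U(3) by (intro subsetI UN_I)
  qed
  from cpt[unfolded compact_space, rule_format, OF conjI, OF opU cover] obtain \<F> where \<F>: "finite \<F>"
    "\<F> \<subseteq> ?\<U>" "\<Union>\<F> = spins ?C"
    unfolding topspace_config_top by (elim exE conjE)
  obtain X where X: "X \<subseteq> spins ?C" "finite X" "\<F> = (\<lambda>x. PiE ?C (U x)) ` X"
    using finite_subset_image[OF \<F>(1,2)] by blast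
  define K where "K = (\<Union>x\<in>X. {i \<in> ?C. U x i \<noteq> {-1, 1}})"
  show thesis
  proof (rule that)
    show "K \<in> fin_words r" using X U(1) by (auto simp: K_def)
    fix y z assume y: "y \<in> spins ?C" and z: "z \<in> spins ?C" and agree: "\<forall>k\<in>K. y k = z k"
    obtain x where x: "x \<in> X" "y \<in> PiE ?C (U x)" using \<F>(3) X(3) y by blast
    then have xs: "x \<in> spins ?C" using X(1) by blast
    have "z \<in> PiE ?C (U x)"
    proof (rule PiE_I)
      fix i assume i: "i \<in> ?C"
      show "z i \<in> U x i"
      proof (cases "i \<in> K")
        case True
        then show ?thesis using agree x(2) i by (metis PiE_mem)
      next
        case False
        then have "U x i = {-1, 1}" using i x(1) by (auto simp: K_def)
        then show ?thesis using spins_cases[OF z i] by simp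
      qed
    next
      fix i assume "i \<notin> ?C"
      then show "z i = undefined" using z by (auto simp: spins_def)
    qed
    then have "f y \<in> ball (f x) (e / 2)" "f z \<in> ball (f x) (e / 2)" using U(4)[OF xs] x(2) by auto
    then show "\<bar>f y - f z\<bar> < e" by (simp add: dist_real_def abs_real_def split: if_splits)
  qed
qed

text \<open>Fourier expansion on {-1,1}^K: the indicator of a pattern \<open>\<xi>\<close> is the
  product over \<open>K\<close> of \<open>(spin \<xi> k * spin x k + 1) / 2\<close>, and multiplying
  out gives the products over subsets.\<close>

lemma local_function_expansion:
  fixes g :: "(letter list \<Rightarrow> int) \<Rightarrow> real"
  assumes "finite K"
  obtains a where "\<And>x. (\<forall>k\<in>K. x k = -1 \<or> x k = 1) \<Longrightarrow>
    g (restrict x K) = (\<Sum>A\<in>Pow K. a A * spin_prod A x)"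
proof
  let ?p = "(1 / 2 :: real) ^ card K"
  fix x :: "letter list \<Rightarrow> int" assume x: "\<forall>k\<in>K. x k = -1 \<or> x k = 1"
  have ind: "(\<Sum>A\<in>Pow K. ?p * spin_prod A \<xi> * spin_prod A x) = (if \<xi> = restrict x K then 1 else 0)"
    if \<xi>: "\<xi> \<in> spins K" for \<xi>
  proof -
    have "(\<Sum>A\<in>Pow K. ?p * spin_prod A \<xi> * spin_prod A x) =
        ?p * (\<Prod>k\<in>K. spin \<xi> k * spin x k + 1)"
      unfolding prod_add[OF assms] spin_prod_def sum_distrib_left
      by (intro sum.cong refl) (simp add: prod.distrib)
    also have "\<dots> = (\<Prod>k\<in>K. (spin \<xi> k * spin x k + 1) / 2)"
      by (simp add: prod_dividef power_one_over)
    also have "\<dots> = (\<Prod>k\<in>K. if \<xi> k = x k then 1 else 0)"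
    proof (rule prod.cong[OF refl])
      fix k assume k: "k \<in> K"
      then have "x k = -1 \<or> x k = 1" using x by blast
      then show "(spin \<xi> k * spin x k + 1) / 2 = (if \<xi> k = x k then 1 else 0)"
        using spins_cases[OF \<xi> k] by auto
    qed
    also have "\<dots> = (if \<forall>k\<in>K. \<xi> k = x k then 1 else 0)"
      using assms by (auto intro: prod_zero)
    also have "(\<forall>k\<in>K. \<xi> k = x k) \<longleftrightarrow> \<xi> = restrict x K"
      using \<xi> by (auto simp: spins_def PiE_def extensional_def fun_eq_iff)
    finally show ?thesis .
  qed
  have "restrict x K \<in> spins K" using x by (auto simp: spins_def)
  then have "g (restrict x K) = (\<Sum>\<xi>\<in>spins K. g \<xi> * (if \<xi> = restrict x K then 1 else 0))"
    using assms by (simp add: if_distrib sum.delta cong: if_cong)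
  also have "\<dots> = (\<Sum>\<xi>\<in>spins K. g \<xi> * (\<Sum>A\<in>Pow K. ?p * spin_prod A \<xi> * spin_prod A x))"
    by (intro sum.cong refl) (simp only: ind)
  also have "\<dots> = (\<Sum>A\<in>Pow K. (\<Sum>\<xi>\<in>spins K. g \<xi> * (?p * spin_prod A \<xi>)) * spin_prod A x)"
    unfolding sum_distrib_left sum_distrib_right by (subst sum.swap) (simp add: mult.assoc)
  finally show "g (restrict x K) = (\<Sum>A\<in>Pow K. (\<Sum>\<xi>\<in>spins K. g \<xi> * (?p * spin_prod A \<xi>)) * spin_prod A
    x)" .
qed

abbreviation word_corr :: "config measure \<Rightarrow> letter list set \<Rightarrow> real" where
  "word_corr \<mu> A \<equiv> \<integral>x. spin_prod A x \<partial>\<mu>"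

definition corr_close :: "letter list set set \<Rightarrow> real \<Rightarrow> config measure \<Rightarrow> config measure \<Rightarrow> bool" where
  "corr_close \<A> \<delta> \<mu> \<nu> \<longleftrightarrow> (\<forall>A\<in>\<A>. \<bar>word_corr \<nu> A - word_corr \<mu> A\<bar> < \<delta>)"

lemma integral_close_of_corr_close:
  assumes f: "continuous_map (config_top r) euclideanreal f" and \<mu>: "\<mu> \<in> borel_probs r" and e: "0 < e"
  shows "\<exists>\<A> \<delta>. finite \<A> \<and> \<A> \<subseteq> fin_words r \<and> 0 < \<delta> \<and>
    (\<forall>\<nu>\<in>borel_probs r. corr_close \<A> \<delta> \<mu> \<nu> \<longrightarrow> \<bar>(\<integral>x. f x \<partial>\<nu>) - (\<integral>x. f x \<partial>\<mu>)\<bar> < e)"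
proof -
  let ?C = "words r"
  obtain K where K: "K \<in> fin_words r"
    and loc: "\<And>x y. x \<in> spins ?C \<Longrightarrow> y \<in> spins ?C \<Longrightarrow> (\<forall>k\<in>K. x k = y k) \<Longrightarrow> \<bar>f x - f y\<bar> < e / 4"
    using continuous_config_local[OF f, of "e / 4"] e by auto
  \<comment> \<open>A pattern on \<open>K\<close> is completed by plus spins, so that
    \<open>f\<close> can be evaluated on it.\<close>
  define ext where "ext \<xi> = (\<lambda>k\<in>?C. if k \<in> K then \<xi> k else 1)" for \<xi> :: config
  obtain a where a: "\<And>x. (\<forall>k\<in>K. x k = -1 \<or> x k = 1) \<Longrightarrow>
      f (ext (restrict x K)) = (\<Sum>A\<in>Pow K. a A * spin_prod A x)"
    using local_function_expansion[of K "\<lambda>\<xi>. f (ext \<xi>)"] K by blast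
  let ?g = "\<lambda>x. \<Sum>A\<in>Pow K. a A * spin_prod A x"
  have close: "\<bar>f x - ?g x\<bar> < e / 4" if x: "x \<in> spins ?C" for x
  proof -
    have xK: "\<forall>k\<in>K. x k = -1 \<or> x k = 1" using K spins_cases[OF x] by blast
    then have "ext (restrict x K) \<in> spins ?C" using K by (auto simp: ext_def spins_def)
    moreover have "\<forall>k\<in>K. x k = ext (restrict x K) k" using K by (auto simp: ext_def)
    ultimately show ?thesis using loc[OF x] a[OF xK] by metis
  qed
  have PK: "A \<in> Pow K \<Longrightarrow> A \<in> fin_words r" for A using K by (auto intro: finite_subset)
  have app: "\<bar>(\<integral>x. f x \<partial>\<nu>) - (\<Sum>A\<in>Pow K. a A * word_corr \<nu> A)\<bar> \<le> e / 4"
    if \<nu>: "\<nu> \<in> borel_probs r" for \<nu>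
  proof -
    interpret prob_space \<nu> using \<nu> by (simp add: borel_probs_def)
    have ig: "integrable \<nu> ?g"
      using PK integrable_spin_prod[OF \<nu>] by (intro Bochner_Integration.integrable_sum
        integrable_mult_right) auto
    have bound: "AE x in \<nu>. norm (f x - ?g x) \<le> e / 4"
      using close borel_probs_space[OF \<nu>] by (intro AE_I2) (auto simp: less_imp_le)
    have meas: "(\<lambda>x. f x - ?g x) \<in> borel_measurable \<nu>"
      using borel_probs_measurable[OF \<nu> f] ig by auto
    have id: "integrable \<nu> (\<lambda>x. f x - ?g x)" by (rule integrable_const_bound[OF bound meas])
    have "integrable \<nu> (\<lambda>x. (f x - ?g x) + ?g x)" by (rule Bochner_Integration.integrable_add[OF id ig])
    then have if': "integrable \<nu> f" by simp
    have "(\<integral>x. ?g x \<partial>\<nu>) = (\<Sum>A\<in>Pow K. a A * word_corr \<nu> A)"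
      using PK integrable_spin_prod[OF \<nu>] by (subst Bochner_Integration.integral_sum) auto
    then have "(\<integral>x. f x \<partial>\<nu>) - (\<Sum>A\<in>Pow K. a A * word_corr \<nu> A) = (\<integral>x. f x - ?g x \<partial>\<nu>)"
      by (simp add: Bochner_Integration.integral_diff[OF if' ig])
    also have "\<bar>\<dots>\<bar> \<le> (\<integral>x. \<bar>f x - ?g x\<bar> \<partial>\<nu>)" by (rule integral_abs_bound)
    also have "\<dots> \<le> (\<integral>x. e / 4 \<partial>\<nu>)"
      by (rule integral_mono_AE) (use id bound in \<open>auto intro: integrable_abs\<close>)
    finally show ?thesis by (simp add: prob_space)
  qed
  define S where "S = (\<Sum>A\<in>Pow K. \<bar>a A\<bar>)"
  have S: "0 \<le> S" by (simp add: S_def sum_nonneg)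
  \<comment> \<open>The budget is \<open>e / 4\<close> for replacing \<open>f\<close> by its local
    version under each of the two measures, and \<open>e / 4\<close> for the difference of the
    correlations.\<close>
  define \<delta> where "\<delta> = e / (4 * (S + 1))"
  have \<delta>: "0 < \<delta>" "S * \<delta> \<le> e / 4"
    using e S by (auto simp: \<delta>_def field_simps)
  show ?thesis
  proof (intro exI conjI ballI impI)
    show "finite (Pow K)" "Pow K \<subseteq> fin_words r" using K PK by auto
    show "0 < \<delta>" by (rule \<delta>)
    fix \<nu> assume \<nu>: "\<nu> \<in> borel_probs r" and cl: "corr_close (Pow K) \<delta> \<mu> \<nu>"
    let ?I = "\<lambda>\<nu>. \<Sum>A\<in>Pow K. a A * word_corr \<nu> A"
    have "\<bar>?I \<nu> - ?I \<mu>\<bar> = \<bar>\<Sum>A\<in>Pow K. a A * (word_corr \<nu> A - word_corr \<mu> A)\<bar>"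
      by (simp add: sum_subtractf right_diff_distrib)
    also have "\<dots> \<le> (\<Sum>A\<in>Pow K. \<bar>a A\<bar> * \<delta>)"
      by (rule order_trans[OF sum_abs sum_mono])
        (use cl in \<open>auto simp: abs_mult corr_close_def less_imp_le intro!: mult_left_mono\<close>)
    also have "\<dots> = S * \<delta>" by (simp add: S_def sum_distrib_right)
    finally have "\<bar>?I \<nu> - ?I \<mu>\<bar> \<le> e / 4" using \<delta> by linarith
    then show "\<bar>(\<integral>x. f x \<partial>\<nu>) - (\<integral>x. f x \<partial>\<mu>)\<bar> < e" using app[OF \<nu>] app[OF \<mu>] e by linarith
  qed
qed

text \<open>Together with \<open>openin_weak_star_corr\<close> this says that finitely many
  correlations give a neighbourhood base at \<open>\<mu>\<close>. The subbasic case is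
  \<open>integral_close_of_corr_close\<close>; an intersection takes the union of the two
  families.\<close>

lemma weak_star_neighbourhood:
  assumes "openin (weak_star_top r) \<O>" "\<mu> \<in> \<O>" and \<mu>: "\<mu> \<in> borel_probs r"
  shows "\<exists>\<A> \<delta>. finite \<A> \<and> \<A> \<subseteq> fin_words r \<and> 0 < \<delta> \<and>
    (\<forall>\<nu>\<in>borel_probs r. corr_close \<A> \<delta> \<mu> \<nu> \<longrightarrow> \<nu> \<in> \<O>)"
  using assms(1)[unfolded weak_star_top_def openin_topology_generated_by_iff] assms(2)
proof (induction rule: generate_topology_on.induct)
  case (Int O1 O2)
  then obtain \<A>1 \<delta>1 \<A>2 \<delta>2 where *: "finite \<A>1" "\<A>1 \<subseteq> fin_words r" "0 < \<delta>1"
      "\<forall>\<nu>\<in>borel_probs r. corr_close \<A>1 \<delta>1 \<mu> \<nu> \<longrightarrow> \<nu> \<in> O1"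
      "finite \<A>2" "\<A>2 \<subseteq> fin_words r" "0 < \<delta>2"
      "\<forall>\<nu>\<in>borel_probs r. corr_close \<A>2 \<delta>2 \<mu> \<nu> \<longrightarrow> \<nu> \<in> O2"
    using Int.IH(1)[OF IntD1[OF Int.prems]] Int.IH(2)[OF IntD2[OF Int.prems]] by (elim exE conjE)
  then show ?case
    by (intro exI[of _ "\<A>1 \<union> \<A>2"] exI[of _ "min \<delta>1 \<delta>2"]) (auto simp: corr_close_def)
next
  case (UN \<K>)
  then obtain k where k: "k \<in> \<K>" "\<mu> \<in> k" by blast
  from UN(2)[OF k] show ?case using k(1) by blast
next
  case (Basis s)
  then obtain f U where fU: "s = {\<mu> \<in> borel_probs r. (\<integral>x. f x \<partial>\<mu>) \<in> U}"
      "continuous_map (config_top r) euclideanreal f" "open U" by blast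
  then obtain e where e: "0 < e" "\<And>y. dist y (\<integral>x. f x \<partial>\<mu>) < e \<Longrightarrow> y \<in> U"
    using Basis(2) unfolding open_dist by blast
  from integral_close_of_corr_close[OF fU(2) \<mu> e(1)]
  obtain \<A> \<delta> where "finite \<A>" "\<A> \<subseteq> fin_words r" "0 < \<delta>"
    "\<forall>\<nu>\<in>borel_probs r. corr_close \<A> \<delta> \<mu> \<nu> \<longrightarrow> \<bar>(\<integral>x. f x \<partial>\<nu>) - (\<integral>x. f x \<partial>\<mu>)\<bar> < e" by blast
  then show ?case using e(2) fU(1) by (intro exI[of _ \<A>] exI[of _ \<delta>]) (auto simp: dist_real_def)
qed auto

lemma openin_weak_star_corr:
  assumes "finite \<A>" "\<A> \<subseteq> fin_words r"
  shows "openin (weak_star_top r) {\<nu> \<in> borel_probs r. corr_close \<A> \<delta> \<mu> \<nu>}"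
proof -
  have basic: "openin (weak_star_top r) {\<nu> \<in> borel_probs r. (\<integral>x. f x \<partial>\<nu>) \<in> U}"
    if "continuous_map (config_top r) euclideanreal f" "open U" for f U
    unfolding weak_star_top_def openin_topology_generated_by_iff
    using that by (intro generate_topology_on.Basis) blast
  have top: "openin (weak_star_top r) (borel_probs r)"
    using basic[of "\<lambda>x. 0" UNIV] by simp
  show ?thesis
    using assms
  proof (induction \<A> rule: finite_induct)
    case empty
    then show ?case using top by (simp add: corr_close_def)
  next
    case (insert A \<A>)
    have "openin (weak_star_top r) {\<nu> \<in> borel_probs r. word_corr \<nu> A \<in> ball (word_corr \<mu> A) \<delta>}"
      using insert by (intro basic continuous_spin_prod) auto
    moreover have "openin (weak_star_top r) {\<nu> \<in> borel_probs r. corr_close \<A> \<delta> \<mu> \<nu>}"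
      using insert by simp
    ultimately have "openin (weak_star_top r)
      ({\<nu> \<in> borel_probs r. word_corr \<nu> A \<in> ball (word_corr \<mu> A) \<delta>} \<inter>
       {\<nu> \<in> borel_probs r. corr_close \<A> \<delta> \<mu> \<nu>})" by (rule openin_Int)
    also have "\<dots> = {\<nu> \<in> borel_probs r. corr_close (insert A \<A>) \<delta> \<mu> \<nu>}"
      by (auto simp: corr_close_def dist_real_def abs_minus_commute)
    finally show ?case .
  qed
qed

section \<open>Empirical measures and good models\<close>

context perm_model
begin

lemma pullback_in_space:
  assumes "x \<in> spins V" "v \<in> V"
  shows "pullback_name r \<sigma> x v \<in> spins (words r)"
  unfolding pullback_name_def spins_def
proof (rule restrict_PiE_iff[THEN iffD2], rule ballI)
  fix g assume "g \<in> words r"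
  then show "x (\<sigma> g v) \<in> {-1, 1}" using spins_cases[OF assms(1) in_V[OF _ assms(2)]] by simp
qed

lemma measurable_pullback:
  "x \<in> spins V \<Longrightarrow> pullback_name r \<sigma> x \<in> measurable (uniform_count_measure V) (config_borel r)"
  by (auto simp: measurable_def sets_uniform_count_measure space_uniform_count_measure
      space_config_borel pullback_in_space)

lemma empirical_in_borel_probs:
  assumes "V \<noteq> {}" "x \<in> spins V"
  shows "empirical r V \<sigma> x \<in> borel_probs r"
  using prob_space.prob_space_distr[OF prob_space_uniform_count_measure[OF finite_V assms(1)]
      measurable_pullback[OF assms(2)]]
  by (simp add: borel_probs_def empirical_def)

lemma integral_empirical:
  assumes "x \<in> spins V" "A \<in> fin_words r"
  shows "(\<integral>y. spin_prod A y \<partial>empirical r V \<sigma> x) = avg A x"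
proof -
  have "(\<integral>y. spin_prod A y \<partial>empirical r V \<sigma> x) =
      (\<integral>v. spin_prod A (pullback_name r \<sigma> x v) \<partial>uniform_count_measure V)"
    unfolding empirical_def
    by (rule integral_distr[OF measurable_pullback[OF assms(1)]])
      (rule borel_measurable_continuous_config[OF continuous_spin_prod[OF assms(2)]])
  also have "\<dots> = (\<Sum>v\<in>V. spin_prod A (pullback_name r \<sigma> x v)) / real (card V)"
    by (rule integral_uniform_count_measure[OF finite_V])
  also have "(\<Sum>v\<in>V. spin_prod A (pullback_name r \<sigma> x v)) = (\<Sum>v\<in>V. local_spin A v x)"
  proof (rule sum.cong[OF refl])
    fix v
    show "spin_prod A (pullback_name r \<sigma> x v) = local_spin A v x"
      unfolding spin_prod_def local_spin_def pullback_name_def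
      by (rule prod.cong) (use assms(2) in auto)
  qed
  finally show ?thesis by (simp add: avg_def)
qed

lemma near_models_corr_close:
  assumes "V \<noteq> {}" "\<A> \<subseteq> fin_words r"
  shows "near_models \<A> \<delta> (word_corr \<mu>) =
    good_models r V \<sigma> {\<nu> \<in> borel_probs r. corr_close \<A> \<delta> \<mu> \<nu>}"
  using assms(2) empirical_in_borel_probs[OF assms(1)]
  by (auto simp: near_models_def good_models_def corr_close_def spins_def[symmetric] integral_empirical
      subset_iff)

end

text \<open>The upper bound for the first approximation holds at every \<open>s\<close> from
  \<open>0\<close> up to but excluding \<open>J\<close>, the lower bound for the second at some such
  \<open>s\<close>; at this common \<open>s\<close> the exponents agree. Exchanging the
  approximations gives equality. The sign \<open>e\<close> covers the plus and the minus state
  together.\<close>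

lemma sofic_entropy_le:
  fixes V1 :: "nat \<Rightarrow> 'v set" and V2 :: "nat \<Rightarrow> 'w set"
  assumes s1: "sofic_approximation r V1 \<sigma>1" and s2: "sofic_approximation r V2 \<sigma>2"
    and pf: "plus_field r J t" and \<mu>: "\<mu> \<in> borel_probs r" and e: "e = 1 \<or> e = (-1::real)"
    and corr: "\<And>A. A \<in> fin_words r \<Longrightarrow> word_corr \<mu> A = e ^ card A * tree_corr r t J A"
  shows "sofic_entropy r V1 \<sigma>1 \<mu> \<le> sofic_entropy r V2 \<sigma>2 \<mu>"
proof -
  let ?m = "word_corr \<mu>" and ?c = "tree_corr r t J"
  \<comment> \<open>Both signs reduce to counting around \<open>tree_corr\<close>: trivially for
    \<open>e = 1\<close>, by the global flip for \<open>e = -1\<close>.\<close>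
  have card_eq: "card (perm_model.near_models V \<sigma> \<A> \<delta> ?m) = card (perm_model.near_models V \<sigma> \<A> \<delta> ?c)"
    if pm: "perm_model r V \<sigma>" and \<A>: "\<A> \<subseteq> fin_words r" for V :: "'x set" and \<sigma> \<A> \<delta>
  proof -
    interpret perm_model r V \<sigma> by (rule pm)
    have "near_models \<A> \<delta> ?m = near_models \<A> \<delta> (\<lambda>A. e ^ card A * ?c A)"
      unfolding near_models_def using corr \<A> by (auto simp: subset_iff)
    then show ?thesis using e card_flip_near_models[of \<A> \<delta> ?c] \<A> by auto
  qed
  have edge: "finite (edge_family r)" "edge_family r \<subseteq> fin_words r"
    using edge_words by (auto simp: edge_family_def)
  have upper: "sofic_entropy r V1 \<sigma>1 \<mu> \<le> ereal (entropy_bound r t J s + \<eta>)"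
    if s: "0 \<le> s" "s < J" and \<eta>: "0 < \<eta>" for s \<eta>
  proof -
    obtain \<epsilon> where \<epsilon>: "0 < \<epsilon>" and ev: "\<forall>\<^sub>F n in sequentially.
        real (card (perm_model.near_models (V1 n) (\<sigma>1 n) (edge_family r) \<epsilon> ?c))
        \<le> exp (real (card (V1 n)) * (entropy_bound r t J s + \<eta>))"
      using near_models_upper[OF s1 pf s \<eta>] by blast
    let ?O = "{\<nu> \<in> borel_probs r. corr_close (edge_family r) \<epsilon> \<mu> \<nu>}"
    have "openin (weak_star_top r) ?O" "\<mu> \<in> ?O"
      using openin_weak_star_corr[OF edge] \<mu> \<epsilon> by (auto simp: corr_close_def)
    then have "sofic_entropy r V1 \<sigma>1 \<mu> \<le>
        limsup (\<lambda>n. log_card (good_models r (V1 n) (\<sigma>1 n) ?O) / ereal (real (card (V1 n))))"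
      unfolding sofic_entropy_def by (intro INF_lower) simp
    also have "\<dots> \<le> ereal (entropy_bound r t J s + \<eta>)"
    proof (rule Limsup_bounded)
      show "\<forall>\<^sub>F n in sequentially. log_card (good_models r (V1 n) (\<sigma>1 n) ?O) / ereal (real (card (V1
        n)))
        \<le> ereal (entropy_bound r t J s + \<eta>)"
        using ev sofic_card_pos[OF s1]
      proof eventually_elim
        case (elim n)
        interpret perm_model r "V1 n" "\<sigma>1 n" by (rule sofic_perm_model[OF s1])
        let ?G = "good_models r (V1 n) (\<sigma>1 n) ?O" and ?n = "real (card (V1 n))"
        have "V1 n \<noteq> {}" using elim(2) by auto
        then have "card ?G = card (near_models (edge_family r) \<epsilon> ?c)"
          using near_models_corr_close[OF _ edge(2)] card_eq[OF sofic_perm_model[OF s1] edge(2)] by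
            metis
        then have le: "real (card ?G) \<le> exp (?n * (entropy_bound r t J s + \<eta>))" using elim(1) by simp
        show ?case
        \<comment> \<open>Without models the logarithm is \<open>-\<infinity>\<close>, below every
          real bound.\<close>
        proof (cases "card ?G = 0")
          case True
          then show ?thesis using elim(2) by (simp add: log_card_def)
        next
          case False
          then have "ln (real (card ?G)) \<le> ln (exp (?n * (entropy_bound r t J s + \<eta>)))"
            using le by (subst ln_le_cancel_iff) auto
          then have "ln (real (card ?G)) / ?n \<le> entropy_bound r t J s + \<eta>"
            using elim(2) by (simp add: pos_divide_le_eq mult.commute)
          then show ?thesis using False elim(2) by (simp add: log_card_def)
        qed
      qed
    qed
    finally show ?thesis .
  qed
  show ?thesis
    unfolding sofic_entropy_def[of r V2]
  proof (rule INF_greatest)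
    fix \<O> assume "\<O> \<in> {\<O>. openin (weak_star_top r) \<O> \<and> \<mu> \<in> \<O>}"
    then obtain \<A> \<delta> where \<A>: "finite \<A>" "\<A> \<subseteq> fin_words r" "0 < \<delta>"
      and sub: "\<And>\<nu>. \<nu> \<in> borel_probs r \<Longrightarrow> corr_close \<A> \<delta> \<mu> \<nu> \<Longrightarrow> \<nu> \<in> \<O>"
      using weak_star_neighbourhood[of r \<O> \<mu>] \<mu> by blast
    let ?l = "limsup (\<lambda>n. log_card (good_models r (V2 n) (\<sigma>2 n) \<O>) / ereal (real (card (V2 n))))"
    show "sofic_entropy r V1 \<sigma>1 \<mu> \<le> ?l"
    proof (rule ereal_le_epsilon2)
      fix \<eta> :: real assume \<eta>: "0 < \<eta>"
      \<comment> \<open>Of the allowance \<open>\<eta>\<close>, half is lost here and half in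
        \<open>upper\<close> at the same \<open>s\<close>.\<close>
      obtain s where s: "0 \<le> s" "s < J" and ev: "\<forall>\<^sub>F n in sequentially.
          exp (real (card (V2 n)) * (entropy_bound r t J s - \<eta> / 2)) \<le>
          real (card (perm_model.near_models (V2 n) (\<sigma>2 n) \<A> \<delta> ?c))"
        using near_models_lower[OF s2 pf \<A>(1) _ \<A>(3), of "\<eta> / 2"] \<A>(2) \<eta> by auto
      have low: "ereal (entropy_bound r t J s - \<eta> / 2) \<le> ?l"
      proof (rule le_Limsup)
        show "\<forall>\<^sub>F n in sequentially. ereal (entropy_bound r t J s - \<eta> / 2) \<le>
            log_card (good_models r (V2 n) (\<sigma>2 n) \<O>) / ereal (real (card (V2 n)))"
          using ev sofic_card_pos[OF s2]
        proof eventually_elim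
          case (elim n)
          interpret perm_model r "V2 n" "\<sigma>2 n" by (rule sofic_perm_model[OF s2])
          let ?G = "good_models r (V2 n) (\<sigma>2 n) \<O>" and ?n = "real (card (V2 n))"
          have ne: "V2 n \<noteq> {}" using elim(2) by auto
          have fin: "finite ?G"
            by (rule finite_subset[OF _ finite_spins[OF finite_V]]) (auto simp: good_models_def
              spins_def)
          have "near_models \<A> \<delta> ?m \<subseteq> ?G"
            unfolding near_models_corr_close[OF ne \<A>(2)] using sub by (auto simp: good_models_def)
          then have "card (near_models \<A> \<delta> ?c) \<le> card ?G"
            using card_mono[OF fin] card_eq[OF sofic_perm_model[OF s2] \<A>(2)] by metis
          then have le: "exp (?n * (entropy_bound r t J s - \<eta> / 2)) \<le> real (card ?G)" using elim(1)
            by linarith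
          then have pos: "0 < real (card ?G)" by (meson exp_gt_zero less_le_trans)
          have "ln (exp (?n * (entropy_bound r t J s - \<eta> / 2))) \<le> ln (real (card ?G))"
            using le pos by (subst ln_le_cancel_iff) auto
          then have "entropy_bound r t J s - \<eta> / 2 \<le> ln (real (card ?G)) / ?n"
            using elim(2) by (simp add: pos_le_divide_eq mult.commute)
          then show ?case using pos elim(2) by (simp add: log_card_def)
        qed
      qed simp
      have "sofic_entropy r V1 \<sigma>1 \<mu> \<le> ereal (entropy_bound r t J s + \<eta> / 2)"
        using upper[OF s, of "\<eta> / 2"] \<eta> by simp
      also have "\<dots> = ereal (entropy_bound r t J s - \<eta> / 2) + ereal \<eta>" by simp
      also have "\<dots> \<le> ?l + ereal \<eta>" using low by (rule add_right_mono)
      finally show "sofic_entropy r V1 \<sigma>1 \<mu> \<le> ?l + ereal \<eta>" .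
    qed
  qed
qed

section \<open>Correlations of the Ising chains\<close>

definition cylinder :: "nat \<Rightarrow> letter list set \<Rightarrow> config \<Rightarrow> config set" where
  "cylinder r T \<xi> = {x \<in> spins (words r). \<forall>w\<in>T. x w = \<xi> w}"

text \<open>\<open>\<tau>\<close> is the field at a vertex with one neighbour left out; that last
  neighbour adds \<open>cavity J \<tau>\<close>.\<close>

definition root_prob :: "real \<Rightarrow> real \<Rightarrow> int \<Rightarrow> real" where
  "root_prob J \<tau> a = exp ((\<tau> + cavity J \<tau>) * real_of_int a) / (2 * cosh (\<tau> + cavity J \<tau>))"

definition step_prob :: "real \<Rightarrow> real \<Rightarrow> int \<Rightarrow> int \<Rightarrow> real" where
  "step_prob J \<tau> a b = exp ((J * real_of_int a + \<tau>) * real_of_int b) / (2 * cosh (J * real_of_int a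
    + \<tau>))"

lemma exp_cavity: "exp (2 * cavity J \<tau>) = cosh (J + \<tau>) / cosh (J - \<tau>)"
  by (simp add: cavity_def)

lemma logistic: "exp (y * -1) / (2 * cosh y) = 1 / (exp (2 * y) + 1)"
  "exp y / (2 * cosh y) = 1 - 1 / (exp (2 * y) + 1)" for y :: real
proof -
  have pos: "exp (2 * y) + 1 > 0" by (simp add: add_pos_pos)
  have c: "2 * cosh y = exp (- y) * (exp (2 * y) + 1)"
    by (simp add: cosh_def distrib_left mult_exp_exp)
  show "exp (y * -1) / (2 * cosh y) = 1 / (exp (2 * y) + 1)" unfolding c by simp
  have "exp y = exp (- y) * exp (2 * y)" by (simp add: mult_exp_exp)
  then have "exp y / (2 * cosh y) = exp (2 * y) / (exp (2 * y) + 1)" unfolding c by simp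
  also have "\<dots> = 1 - 1 / (exp (2 * y) + 1)" using pos by (simp add: field_simps)
  finally show "exp y / (2 * cosh y) = 1 - 1 / (exp (2 * y) + 1)" .
qed

text \<open>\<open>root_prob\<close> is logistic in \<open>\<tau> + cavity J \<tau>\<close>, and
  \<open>exp (2 * (\<tau> + cavity J \<tau>))\<close> equals \<open>?p / ?q\<close>. Expanding the
  fraction \<open>?q / (?p + ?q)\<close> by \<open>exp (- J)\<close> produces the formula of
  \<open>ising_alpha\<close>.\<close>

lemma root_prob_eq:
  "ising_alpha J \<tau> = root_prob J \<tau> (-1)" "1 - ising_alpha J \<tau> = root_prob J \<tau> 1"
proof -
  let ?u = "cavity J \<tau>"
  let ?p = "exp J * exp (2 * \<tau>) + exp (- J)" and ?q = "exp J * exp (- 2 * \<tau>) + exp (- J)"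
  have pq: "?p > 0" "?q > 0" by (simp_all add: add_pos_pos)
  have p: "exp \<tau> * (2 * cosh (J + \<tau>)) = ?p" and q: "exp (- \<tau>) * (2 * cosh (J - \<tau>)) = ?q"
    by (simp_all add: cosh_def distrib_left exp_add[symmetric] mult_exp_exp)
  have "?p / ?q = exp (2 * \<tau>) * exp (2 * ?u)"
  proof -
    have "exp (2 * \<tau>) = exp \<tau> / exp (- \<tau>)" by (simp add: exp_diff[symmetric])
    then show ?thesis unfolding p[symmetric] q[symmetric] exp_cavity by simp
  qed
  then have ratio: "exp (2 * (\<tau> + ?u)) = ?p / ?q" by (simp add: exp_add distrib_left)
  have "root_prob J \<tau> (-1) = 1 / (exp (2 * (\<tau> + ?u)) + 1)"
    unfolding root_prob_def using logistic(1)[of "\<tau> + ?u"] by simp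
  also have "\<dots> = ?q / (?p + ?q)" unfolding ratio using pq by (simp add: field_simps)
  also have "\<dots> = (exp (- J) * ?q) / (exp (- J) * (?p + ?q))" by simp
  also have "\<dots> = ising_alpha J \<tau>"
  proof -
    have "exp (- J) * ?q = exp (- 2 * J) + exp (- 2 * \<tau>)"
      by (simp add: distrib_left mult_exp_exp flip: exp_add mult.assoc)
    moreover have "exp (- J) * (?p + ?q) = 2 * exp (- 2 * J) + 2 * cosh (2 * \<tau>)"
      by (simp add: distrib_left cosh_def mult_exp_exp flip: exp_add mult.assoc)
    ultimately show ?thesis by (simp add: ising_alpha_def)
  qed
  finally show a: "ising_alpha J \<tau> = root_prob J \<tau> (-1)" by simp
  have "root_prob J \<tau> (-1) + root_prob J \<tau> 1 = (exp (- (\<tau> + ?u)) + exp (\<tau> + ?u)) / (2 * cosh (\<tau> + ?u))"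
    by (simp add: root_prob_def add_divide_distrib)
  also have "exp (- (\<tau> + ?u)) + exp (\<tau> + ?u) = 2 * cosh (\<tau> + ?u)" by (simp add: cosh_def)
  finally have "root_prob J \<tau> (-1) + root_prob J \<tau> 1 = 1" by simp
  then show "1 - ising_alpha J \<tau> = root_prob J \<tau> 1" using a by linarith
qed

lemma step_prob_eq:
  "ising_beta J (- \<tau>) = step_prob J \<tau> (-1) 1" "1 - ising_beta J (- \<tau>) = step_prob J \<tau> (-1) (-1)"
  "ising_beta J \<tau> = step_prob J \<tau> 1 (-1)" "1 - ising_beta J \<tau> = step_prob J \<tau> 1 1"
proof -
  have c: "cosh (\<tau> - J) = cosh (J - \<tau>)" by (metis cosh_minus minus_diff_eq)
  show "ising_beta J \<tau> = step_prob J \<tau> 1 (-1)" "1 - ising_beta J \<tau> = step_prob J \<tau> 1 1"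
    using logistic[of "J + \<tau>"] by (simp_all add: ising_beta_def step_prob_def)
  show "ising_beta J (- \<tau>) = step_prob J \<tau> (-1) 1" "1 - ising_beta J (- \<tau>) = step_prob J \<tau> (-1) (-1)"
    using logistic[of "J - \<tau>"] by (simp_all add: ising_beta_def step_prob_def c)
qed

lemma root_prob_pos: "0 < root_prob J \<tau> a"
  by (simp add: root_prob_def)

section \<open>Cylinder probabilities from the Markov property\<close>

lemma cayley_edge_parent:
  assumes "w \<in> words r" "w \<noteq> []"
  shows "(tl w, w) \<in> cayley_edge r" "(w, tl w) \<in> cayley_edge r"
proof -
  obtain i b u where w: "w = (i, b) # u" using assms(2) by (cases w) auto
  have "w = free_gen i \<otimes>\<^bsub>free_group r\<^esub> u \<or> u = free_gen i \<otimes>\<^bsub>free_group r\<^esub> w"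
  proof (cases b)
    case True
    then have "w = push_letter (i, True) u"
      using assms(1) w by (cases u) (auto simp: Cons_in_carrier)
    then show ?thesis by (simp add: word_mult free_gen_def)
  next
    case False
    then show ?thesis using w by (simp add: word_mult free_gen_def inv_letter_def)
  qed
  moreover have "i < r" "u \<in> words r" using assms(1) w by (auto simp: Cons_in_carrier)
  ultimately show "(tl w, w) \<in> cayley_edge r" "(w, tl w) \<in> cayley_edge r"
    using assms(1) w by (auto simp: cayley_edge_def)
qed

text \<open>\<open>T\<close> is closed under taking parents, so its members are joined to
  \<open>[]\<close> inside \<open>T\<close>. As \<open>w\<close> is not in \<open>T\<close>, these
  paths avoid the removed edge.\<close>

lemma edge_side_parent:
  assumes w: "w \<in> words r" "w \<noteq> []" and T: "T \<subseteq> words r" "w \<notin> T"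
    "\<And>k. k \<in> T \<Longrightarrow> tl k \<in> T" "tl w \<in> T"
  shows "T \<subseteq> edge_side r (tl w) w"
proof
  fix k assume k: "k \<in> T"
  let ?R = "cayley_edge r - {(tl w, w), (w, tl w)}"
  have "k \<in> T \<Longrightarrow> ([], k) \<in> ?R\<^sup>* \<and> (k, []) \<in> ?R\<^sup>*" for k
  proof (induction k)
    case (Cons a u)
    then have u: "u \<in> T" using T(3)[OF Cons.prems] by simp
    have "(u, a # u) \<in> ?R" "(a # u, u) \<in> ?R"
      using cayley_edge_parent[of "a # u" r] Cons.prems u T(1,2) by auto
    then show ?case using Cons.IH[OF u] by (meson converse_rtrancl_into_rtrancl
      rtrancl.rtrancl_into_rtrancl)
  qed simp
  from this[OF T(4)] this[OF k] show "k \<in> edge_side r (tl w) w"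
    unfolding edge_side_def by (auto intro: rtrancl_trans)
qed

lemma cylinder_sigma_sets:
  assumes "finite T" "T \<noteq> {}" "T \<subseteq> U" "\<xi> \<in> spins T"
  shows "cylinder r T \<xi> \<in> sigma_sets (topspace (config_top r)) {spin_event r k c |k c. k \<in> U \<and> c \<in>
    {-1, 1}}"
proof -
  let ?G = "{spin_event r k c |k c. k \<in> U \<and> c \<in> {-1, 1}}"
  interpret sigma_algebra "topspace (config_top r)" "sigma_sets (topspace (config_top r)) ?G"
    by (rule sigma_algebra_sigma_sets) (auto simp: spin_event_def)
  have "cylinder r T \<xi> = (\<Inter>k\<in>T. spin_event r k (\<xi> k))"
    using assms(2) by (auto simp: cylinder_def spin_event_def topspace_config_top)
  also have "\<dots> \<in> sigma_sets (topspace (config_top r)) ?G"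
  proof (rule finite_INT[OF assms(1,2)])
    fix k assume "k \<in> T"
    then have "spin_event r k (\<xi> k) \<in> ?G" using assms(3) spins_cases[OF assms(4)] by blast
    then show "spin_event r k (\<xi> k) \<in> sigma_sets (topspace (config_top r)) ?G" by (rule
      sigma_sets.Basic)
  qed
  finally show ?thesis .
qed

text \<open>Induction by removing a longest word of \<open>T\<close>, which is a leaf: the rest of
  \<open>T\<close> lies on the side of its parent, so the Markov property contributes one factor
  \<open>step_prob\<close>.\<close>

lemma measure_cylinder:
  assumes chain: "ising_chain r J \<tau> \<mu>"
    and "finite T" "T \<subseteq> words r" "[] \<in> T" "\<And>w. w \<in> T \<Longrightarrow> tl w \<in> T"
    and "\<xi> \<in> spins T"
  shows "measure \<mu> (cylinder r T \<xi>) = root_prob J \<tau> (\<xi> []) * (\<Prod>w\<in>T - {[]}. step_prob J \<tau> (\<xi> (tl w))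
    (\<xi> w))"
  using assms(2-)
proof (induction "card T" arbitrary: T \<xi> rule: less_induct)
  case less
  have \<mu>: "\<mu> \<in> borel_probs r" using chain by (simp add: ising_chain_def tree_markov_chain_def)
  have sp: "space \<mu> = spins (words r)" by (rule borel_probs_space[OF \<mu>])
  have se: "spin_event r g a = {x \<in> space \<mu>. x g = a}" for g a
    by (simp add: spin_event_def sp topspace_config_top)
  have single: "measure \<mu> (spin_event r g a) = root_prob J \<tau> a"
    if "g \<in> words r" "a = -1 \<or> a = 1" for g a
    using chain that unfolding ising_chain_def se by (auto simp: root_prob_eq[symmetric])
  show ?case
  proof (cases "T = {[]}")
    case True
    have "\<xi> [] = -1 \<or> \<xi> [] = 1" using less.prems by (intro spins_cases) auto
    moreover have "cylinder r T \<xi> = spin_event r [] (\<xi> [])"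
      unfolding True by (auto simp: cylinder_def se sp)
    ultimately show ?thesis using single[of "[]" "\<xi> []"] True by simp
  next
    case False
    have fin: "finite T" by fact
    have "Max (length ` T) \<in> length ` T" by (rule Max_in) (use fin less.prems in auto)
    then obtain w where w: "w \<in> T" "length w = Max (length ` T)" by auto
    then have w: "w \<in> T" "\<And>k. k \<in> T \<Longrightarrow> length k \<le> length w" using fin by auto
    obtain k where "k \<in> T" "k \<noteq> []" using False less.prems by auto
    then have wne: "w \<noteq> []" using w(2)[of k] by auto
    let ?S = "T - {w}"
    have wc: "w \<in> words r" using w less.prems by blast
    have S: "finite ?S" "?S \<subseteq> words r" "[] \<in> ?S" using less.prems wne by auto
    have Stl: "tl k \<in> ?S" if "k \<in> T" for k
    proof -
      have "tl k \<noteq> w" using w(2)[OF that] wne by (cases k) auto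
      then show ?thesis using less.prems(4)[OF that] by simp
    qed
    let ?\<xi> = "restrict \<xi> ?S"
    have \<xi>S: "?\<xi> \<in> spins ?S" by (rule restrict_spins[OF less.prems(5)]) auto
    have tlS: "tl w \<in> ?S" by (rule Stl[OF w(1)])
    have "card ?S < card T" using w fin by (intro psubset_card_mono) auto
    then have IH: "measure \<mu> (cylinder r ?S ?\<xi>) =
        root_prob J \<tau> (?\<xi> []) * (\<Prod>k\<in>?S - {[]}. step_prob J \<tau> (?\<xi> (tl k)) (?\<xi> k))"
      using S Stl \<xi>S by (intro less.hyps) auto
    let ?a = "\<xi> (tl w)" and ?b = "\<xi> w" and ?A = "cylinder r ?S ?\<xi>"
    have ab: "?a = -1 \<or> ?a = 1" "?b = -1 \<or> ?b = 1"
      using spins_cases[OF less.prems(5)] w(1) tlS by auto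
    have tlc: "tl w \<in> words r" using S tlS by blast
    have edge: "(tl w, w) \<in> cayley_edge r" by (rule cayley_edge_parent[OF wc wne])
    have side: "?S \<subseteq> edge_side r (tl w) w"
      by (rule edge_side_parent[OF wc wne S(2)]) (use Stl tlS in auto)
    have "?A \<in> sigma_sets (topspace (config_top r)) {spin_event r k c |k c. k \<in> edge_side r (tl w) w
      \<and> c \<in> {-1, 1}}"
      by (rule cylinder_sigma_sets[OF S(1) _ side \<xi>S]) (use S in auto)
    then have markov: "measure \<mu> (spin_event r w ?b \<inter> spin_event r (tl w) ?a \<inter> ?A) * measure \<mu>
      (spin_event r (tl w) ?a) =
        measure \<mu> (spin_event r w ?b \<inter> spin_event r (tl w) ?a) * measure \<mu> (spin_event r (tl w) ?a \<inter>
          ?A)"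
      using chain edge ab unfolding ising_chain_def tree_markov_chain_def by blast
    have 1: "spin_event r (tl w) ?a \<inter> ?A = ?A"
      using tlS by (auto simp: cylinder_def se sp)
    have 2: "spin_event r w ?b \<inter> spin_event r (tl w) ?a \<inter> ?A = cylinder r T \<xi>"
      using tlS w(1) by (auto simp: cylinder_def se sp)
    have "\<P>(x in \<mu>. x w = ?b \<bar> x (tl w) = ?a) = step_prob J \<tau> ?a ?b"
      using chain edge ab unfolding ising_chain_def by (auto simp: step_prob_eq[symmetric])
    moreover have "spin_event r w ?b \<inter> spin_event r (tl w) ?a = {x \<in> space \<mu>. x w = ?b \<and> x (tl w) = ?a}"
      by (auto simp: se)
    ultimately have 3: "measure \<mu> (spin_event r w ?b \<inter> spin_event r (tl w) ?a) =
        step_prob J \<tau> ?a ?b * root_prob J \<tau> ?a"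
      using single[OF tlc ab(1)] root_prob_pos[of J \<tau> ?a] by (simp add: cond_prob_def se field_simps)
    have "measure \<mu> (cylinder r T \<xi>) = step_prob J \<tau> ?a ?b * measure \<mu> ?A"
      using markov root_prob_pos[of J \<tau> ?a] unfolding 1 2 3 single[OF tlc ab(1)] by simp
    also have "\<dots> = root_prob J \<tau> (\<xi> []) *
        (step_prob J \<tau> ?a ?b * (\<Prod>k\<in>?S - {[]}. step_prob J \<tau> (\<xi> (tl k)) (\<xi> k)))"
    proof -
      have "(\<Prod>k\<in>?S - {[]}. step_prob J \<tau> (?\<xi> (tl k)) (?\<xi> k)) =
          (\<Prod>k\<in>?S - {[]}. step_prob J \<tau> (\<xi> (tl k)) (\<xi> k))"
        by (intro prod.cong refl) (use Stl in auto)
      then show ?thesis unfolding IH using S(3) by simp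
    qed
    also have "step_prob J \<tau> ?a ?b * (\<Prod>k\<in>?S - {[]}. step_prob J \<tau> (\<xi> (tl k)) (\<xi> k)) =
        (\<Prod>k\<in>T - {[]}. step_prob J \<tau> (\<xi> (tl k)) (\<xi> k))"
    proof -
      have "T - {[]} = insert w (?S - {[]})" using w wne by auto
      then show ?thesis using S(1) by simp
    qed
    finally show ?thesis .
  qed
qed

lemma card_word_sphere_1: "card (word_sphere r 1) = 2 * r"
proof -
  have "word_sphere r 1 = (\<lambda>a. [a]) ` ({..<r} \<times> UNIV)"
    by (auto simp: word_sphere_def length_Suc_conv Cons_in_carrier)
  then show ?thesis by (simp add: card_image inj_on_def card_cartesian_product)
qed

text \<open>Every word of the smaller ball is counted once for each child; the root has one child
  more than the others, hence the separate \<open>f []\<close>.\<close>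

lemma sum_parents:
  assumes "r \<ge> 1"
  shows "(\<Sum>w\<in>word_ball r (Suc m) - {[]}. f (tl w)) = f [] + real (2 * r - 1) * (\<Sum>w\<in>word_ball r m. f w)"
proof (induction m)
  case 0
  have "word_ball r (Suc 0) - {[]} = word_sphere r 1" by (auto simp: word_ball_def word_sphere_def
    le_Suc_eq)
  moreover have "(\<Sum>w\<in>word_sphere r 1. f (tl w)) = (\<Sum>w\<in>word_sphere r 1. f [])"
    by (rule sum.cong) (auto simp: word_sphere_def length_Suc_conv)
  moreover have "word_ball r 0 = {[]}" by (auto simp: word_ball_def)
  ultimately show ?case using assms by (simp add: card_word_sphere_1[simplified] of_nat_diff
    algebra_simps)
next
  case (Suc m)
  have "word_ball r (Suc (Suc m)) - {[]} = (word_ball r (Suc m) - {[]}) \<union> word_sphere r (Suc (Suc m))"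
    by (auto simp: word_ball_def word_sphere_def)
  moreover have "(word_ball r (Suc m) - {[]}) \<inter> word_sphere r (Suc (Suc m)) = {}"
    using word_ball_Suc(2)[of r "Suc m"] by blast
  ultimately have "(\<Sum>w\<in>word_ball r (Suc (Suc m)) - {[]}. f (tl w)) =
      (\<Sum>w\<in>word_ball r (Suc m) - {[]}. f (tl w)) + (\<Sum>w\<in>word_sphere r (Suc (Suc m)). f (tl w))"
    by (simp add: sum.union_disjoint)
  also have "(\<Sum>w\<in>word_sphere r (Suc (Suc m)). f (tl w)) = real (2 * r - 1) * (\<Sum>w\<in>word_sphere r (Suc
    m). f w)"
    by (rule sum_word_sphere_Suc) simp
  moreover have "(\<Sum>w\<in>word_ball r (Suc m). f w) =
      (\<Sum>w\<in>word_ball r m. f w) + (\<Sum>w\<in>word_sphere r (Suc m). f w)"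
    unfolding word_ball_Suc(1) by (rule sum.union_disjoint) (use word_ball_Suc(2) in auto)
  ultimately show ?case unfolding Suc by (simp add: distrib_left)
qed

text \<open>The normaliser \<open>2 * cosh (J * a + \<tau>)\<close> of a step is a constant times
  \<open>exp (cavity J \<tau> * a)\<close>, so dividing by it puts the field
  \<open>- cavity J \<tau>\<close> on the parent. Inner words are left with
  \<open>\<tau> - real (2 * r - 1) * cavity J \<tau>\<close>, which is \<open>cavity_field\<close>,
  boundary words with \<open>\<tau>\<close>; the additional child of the root is balanced by
  \<open>root_prob\<close>.\<close>

lemma chain_tree_weight:
  assumes r: "r \<ge> 1" and R: "R = Suc m"
  shows "\<exists>c. \<forall>\<xi>\<in>spins (word_ball r R).
    root_prob J \<tau> (\<xi> []) * (\<Prod>w\<in>word_ball r R - {[]}. step_prob J \<tau> (\<xi> (tl w)) (\<xi> w)) =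
    c * tree_weight r R J (cavity_field r \<tau> J) \<tau> \<xi>"
proof (intro exI ballI)
  let ?u = "cavity J \<tau>" and ?D = "word_ball r R - {[]}" and ?k = "real (2 * r - 1)"
  let ?C = "2 * sqrt (cosh (J + \<tau>) * cosh (J - \<tau>))"
  fix \<xi> :: config assume \<xi>: "\<xi> \<in> spins (word_ball r R)"
  have C: "2 * cosh (J * real_of_int a + \<tau>) = ?C * exp (?u * real_of_int a)" if "a = 1 \<or> a = -1" for
    a :: int
    using cavity_sum[OF that, of J \<tau>] by (simp add: cosh_def algebra_simps)
  let ?x = "\<lambda>w. spin \<xi> w"
  have st: "step_prob J \<tau> (\<xi> (tl w)) (\<xi> w) = exp (J * (?x w * ?x (tl w)) + \<tau> * ?x w - ?u * ?x (tl
    w)) * (1 / ?C)"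
    if w: "w \<in> ?D" for w
  proof -
    have "\<xi> (tl w) = 1 \<or> \<xi> (tl w) = -1"
      using spins_cases[OF \<xi>, of "tl w"] w tl_in_word_ball by blast
    then have "step_prob J \<tau> (\<xi> (tl w)) (\<xi> w) =
        exp ((J * ?x (tl w) + \<tau>) * ?x w) / (?C * exp (?u * ?x (tl w)))"
      unfolding step_prob_def by (simp only: C)
    also have "\<dots> = exp ((J * ?x (tl w) + \<tau>) * ?x w) / exp (?u * ?x (tl w)) * (1 / ?C)"
      by (simp only: times_divide_eq_right mult_1_right divide_divide_eq_left mult.commute)
    also have "exp ((J * ?x (tl w) + \<tau>) * ?x w) / exp (?u * ?x (tl w)) =
        exp ((J * ?x (tl w) + \<tau>) * ?x w - ?u * ?x (tl w))"
      by (rule exp_diff[symmetric])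
    also have "(J * ?x (tl w) + \<tau>) * ?x w = J * (?x w * ?x (tl w)) + \<tau> * ?x w"
      by (simp add: algebra_simps)
    finally show ?thesis .
  qed
  have "(\<Prod>w\<in>?D. step_prob J \<tau> (\<xi> (tl w)) (\<xi> w)) =
      (\<Prod>w\<in>?D. exp (J * (?x w * ?x (tl w)) + \<tau> * ?x w - ?u * ?x (tl w)) * (1 / ?C))"
    by (intro prod.cong refl st)
  also have "\<dots> = exp (\<Sum>w\<in>?D. J * (?x w * ?x (tl w)) + \<tau> * ?x w - ?u * ?x (tl w)) * (1 / ?C) ^ card ?D"
    by (simp only: prod.distrib prod_constant exp_sum[symmetric, OF finite_Diff[OF finite_word_ball]])
  also have "(\<Sum>w\<in>?D. J * (?x w * ?x (tl w)) + \<tau> * ?x w - ?u * ?x (tl w)) =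
      J * (\<Sum>w\<in>?D. ?x w * ?x (tl w)) + \<tau> * (\<Sum>w\<in>?D. ?x w) - ?u * (\<Sum>w\<in>?D. ?x (tl w))"
    by (simp only: sum.distrib sum_subtractf sum_distrib_left)
  also have "(\<Sum>w\<in>?D. ?x (tl w)) = ?x [] + ?k * (\<Sum>w\<in>word_ball r m. ?x w)"
    unfolding R by (rule sum_parents[OF r])
  also have "(\<Sum>w\<in>?D. ?x w) = (\<Sum>w\<in>word_ball r R. ?x w) - ?x []"
    using sum.remove[OF finite_word_ball, of "[]" r R ?x] by (simp add: word_ball_def[of r R])
  also have "(\<Sum>w\<in>word_ball r R. ?x w) = (\<Sum>w\<in>word_ball r m. ?x w) + (\<Sum>w\<in>word_sphere r R. ?x w)"
    unfolding R word_ball_Suc(1) by (rule sum.union_disjoint) (use word_ball_Suc(2) in auto)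
  finally have prod: "(\<Prod>w\<in>?D. step_prob J \<tau> (\<xi> (tl w)) (\<xi> w)) =
      exp (J * (\<Sum>w\<in>?D. ?x w * ?x (tl w)) +
        \<tau> * ((\<Sum>w\<in>word_ball r m. ?x w) + (\<Sum>w\<in>word_sphere r R. ?x w) - ?x []) -
        ?u * (?x [] + ?k * (\<Sum>w\<in>word_ball r m. ?x w))) * (1 / ?C) ^ card ?D" .
  have ball: "word_ball r R - word_sphere r R = word_ball r m"
    unfolding R by (auto simp: word_ball_def word_sphere_def)
  show "root_prob J \<tau> (\<xi> []) * (\<Prod>w\<in>?D. step_prob J \<tau> (\<xi> (tl w)) (\<xi> w)) =
    ((1 / ?C) ^ card ?D / (2 * cosh (\<tau> + ?u))) * tree_weight r R J (cavity_field r \<tau> J) \<tau> \<xi>"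
    unfolding prod root_prob_def tree_weight_def ball cavity_field_def
    by (simp add: exp_add[symmetric] algebra_simps)
qed

lemma openin_spin_event:
  assumes "g \<in> words r"
  shows "openin (config_top r) (spin_event r g a)"
proof -
  have "openin (config_top r) {x \<in> topspace (config_top r). spin x g \<in> ball (real_of_int a) 1}"
    by (intro openin_continuous_map_preimage[OF continuous_spin[OF assms]]) simp
  moreover have "real_of_int b \<in> ball (real_of_int a) 1 \<longleftrightarrow> b = a" for b :: int
    by (auto simp: dist_real_def)
  ultimately show ?thesis by (simp add: spin_event_def)
qed

lemma integral_spin_prod_cylinder:
  assumes \<mu>: "\<mu> \<in> borel_probs r" and T: "finite T" "T \<noteq> {}" "T \<subseteq> words r" and A: "A \<subseteq> T"
  shows "word_corr \<mu> A = (\<Sum>\<xi>\<in>spins T. spin_prod A \<xi> * measure \<mu> (cylinder r T \<xi>))"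
proof -
  interpret prob_space \<mu> using \<mu> by (simp add: borel_probs_def)
  have ev: "spin_event r g a \<in> sets \<mu>" if "g \<in> T" for g a
    unfolding borel_probs_sets[OF \<mu>] sets_config_borel
    using openin_spin_event[of g r a] T that by (intro sigma_sets.Basic) auto
  have cyl: "cylinder r T \<xi> \<in> sets \<mu>" for \<xi>
  proof -
    have "cylinder r T \<xi> = (\<Inter>k\<in>T. spin_event r k (\<xi> k))"
      using T(2) by (auto simp: cylinder_def spin_event_def topspace_config_top)
    then show ?thesis using ev T by (auto intro: sets.finite_INT)
  qed
  have "word_corr \<mu> A = (\<integral>x. (\<Sum>\<xi>\<in>spins T. spin_prod A \<xi> * indicator (cylinder r T \<xi>) x) \<partial>\<mu>)"
  proof (rule Bochner_Integration.integral_cong[OF refl])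
    fix x assume "x \<in> space \<mu>"
    then have x: "x \<in> spins (words r)" using borel_probs_space[OF \<mu>] by simp
    have xT: "restrict x T \<in> spins T" by (rule restrict_spins[OF x T(3)])
    have ind: "indicator (cylinder r T \<xi>) x = (if \<xi> = restrict x T then 1 else 0 :: real)" if "\<xi> \<in>
      spins T" for \<xi>
    proof -
      have "(\<forall>w\<in>T. \<xi> w = x w) \<longleftrightarrow> \<xi> = restrict x T"
        using that by (auto simp: spins_def PiE_def extensional_def fun_eq_iff)
      then show ?thesis using x by (auto simp: cylinder_def indicator_def)
    qed
    have "(\<Sum>\<xi>\<in>spins T. spin_prod A \<xi> * indicator (cylinder r T \<xi>) x) =
        (\<Sum>\<xi>\<in>spins T. if \<xi> = restrict x T then spin_prod A \<xi> else 0)"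
      by (rule sum.cong) (auto simp: ind)
    also have "\<dots> = spin_prod A (restrict x T)" using xT T(1) by simp
    also have "\<dots> = spin_prod A x" by (rule spin_prod_restrict[OF A])
    finally show "spin_prod A x = (\<Sum>\<xi>\<in>spins T. spin_prod A \<xi> * indicator (cylinder r T \<xi>) x)" by simp
  qed
  also have "\<dots> = (\<Sum>\<xi>\<in>spins T. \<integral>x. spin_prod A \<xi> * indicator (cylinder r T \<xi>) x \<partial>\<mu>)"
    by (rule Bochner_Integration.integral_sum)
      (use cyl in \<open>auto intro!: integrable_mult_right integrable_real_indicator simp:
        emeasure_eq_measure\<close>)
  also have "\<dots> = (\<Sum>\<xi>\<in>spins T. spin_prod A \<xi> * measure \<mu> (cylinder r T \<xi>))"
    using cyl by simp
  finally show ?thesis .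
qed

lemma chain_correlation:
  assumes chain: "ising_chain r J \<tau> \<mu>" and r: "r \<ge> 1" and A: "A \<in> fin_words r"
  shows "word_corr \<mu> A = tree_corr r \<tau> J A"
proof -
  let ?R = "word_radius A"
  let ?T = "word_ball r ?R" and ?w = "tree_weight r ?R J (cavity_field r \<tau> J) \<tau>"
  have \<mu>: "\<mu> \<in> borel_probs r" using chain by (simp add: ising_chain_def tree_markov_chain_def)
  have AT: "A \<subseteq> ?T" using A subset_word_ball_radius by blast
  have T: "finite ?T" "?T \<subseteq> words r" "[] \<in> ?T"
    by (rule finite_word_ball) (auto simp: word_ball_def)
  obtain c where c: "\<And>\<xi>. \<xi> \<in> spins ?T \<Longrightarrow>
      root_prob J \<tau> (\<xi> []) * (\<Prod>w\<in>?T - {[]}. step_prob J \<tau> (\<xi> (tl w)) (\<xi> w)) = c * ?w \<xi>"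
    using chain_tree_weight[OF r, of ?R "Max (insert 0 (length ` A))" J \<tau>] unfolding word_radius_def
      by blast
  have cyl: "measure \<mu> (cylinder r ?T \<xi>) = c * ?w \<xi>" if "\<xi> \<in> spins ?T" for \<xi>
    using measure_cylinder[OF chain T tl_in_word_ball that] c[OF that] by simp
  have int: "word_corr \<mu> B = c * (\<Sum>\<xi>\<in>spins ?T. spin_prod B \<xi> * ?w \<xi>)" if "B \<subseteq> ?T" for B
    using integral_spin_prod_cylinder[OF \<mu> T(1) _ T(2) that] T(3) cyl
    by (auto simp: sum_distrib_left mult_ac)
  interpret prob_space \<mu> using \<mu> by (simp add: borel_probs_def)
  \<comment> \<open>The empty product identifies \<open>c\<close> through the total mass.\<close>
  have "1 = c * (\<Sum>\<xi>\<in>spins ?T. ?w \<xi>)"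
    using int[of "{}"] prob_space by (simp add: spin_prod_def)
  moreover have "(\<Sum>\<xi>\<in>spins ?T. ?w \<xi>) > 0" by (intro sum_pos_spins) auto
  ultimately show ?thesis
    unfolding int[OF AT] tree_corr_def tree_mean_def gibbs_def by (simp add: field_simps)
qed

section \<open>Spin flip and the uniqueness threshold\<close>

lemma tree_corr_minus:
  assumes A: "A \<in> fin_words r"
  shows "tree_corr r (- t) J A = (-1) ^ card A * tree_corr r t J A"
proof -
  let ?R = "word_radius A"
  let ?T = "word_ball r ?R"
  let ?f = "spin_flip ?T"
  have AT: "A \<subseteq> ?T" using A subset_word_ball_radius by blast
  have B: "cavity_field r (- t) J = - cavity_field r t J" by (simp add: cavity_field_def cavity_minus)
  have reindex: "(\<Sum>x\<in>spins ?T. g (?f x)) = (\<Sum>x\<in>spins ?T. g x)" for g :: "config \<Rightarrow> real"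
    by (rule sum.reindex_bij_witness[of _ ?f ?f]) (auto simp: spin_flip_in spin_flip_flip)
  have w: "tree_weight r ?R J (- b) (- h) (?f x) = tree_weight r ?R J b h x" for b h x
  proof -
    have "(\<Sum>w\<in>?T - {[]}. real_of_int (?f x w) * real_of_int (?f x (tl w))) =
        (\<Sum>w\<in>?T - {[]}. spin x w * spin x (tl w))"
      by (intro sum.cong refl) (simp add: spin_flip_def tl_in_word_ball)
    moreover have "(\<Sum>w\<in>?T - word_sphere r ?R. real_of_int (?f x w)) = - (\<Sum>w\<in>?T - word_sphere r ?R.
      spin x w)"
      unfolding sum_negf[symmetric] by (intro sum.cong refl) (simp add: spin_flip_def)
    moreover have "(\<Sum>w\<in>word_sphere r ?R. real_of_int (?f x w)) = - (\<Sum>w\<in>word_sphere r ?R. spin x w)"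
      unfolding sum_negf[symmetric] by (intro sum.cong refl) (simp add: spin_flip_def
        word_sphere_def word_ball_def)
    ultimately show ?thesis by (simp only: tree_weight_def) simp
  qed
  have p: "spin_prod A (?f x) = (-1) ^ card A * spin_prod A x" for x
    using spin_prod_flip[of "\<lambda>a. a" A ?T x] AT by simp
  have "(\<Sum>x\<in>spins ?T. spin_prod A x * tree_weight r ?R J (- cavity_field r t J) (- t) x) =
      (\<Sum>x\<in>spins ?T. (-1) ^ card A * spin_prod A x * tree_weight r ?R J (cavity_field r t J) t x)"
    by (subst reindex[symmetric]) (simp only: p w)
  moreover have "(\<Sum>x\<in>spins ?T. tree_weight r ?R J (- cavity_field r t J) (- t) x) =
      (\<Sum>x\<in>spins ?T. tree_weight r ?R J (cavity_field r t J) t x)"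
    by (subst reindex[symmetric]) (simp only: w)
  ultimately show ?thesis
    by (simp add: tree_corr_def tree_mean_def gibbs_def B sum_distrib_left mult.assoc)
qed

text \<open>Above the threshold the fixed-point equation reads
  \<open>real (2 * r - 1) * cavity J t = t\<close>, since \<open>cosh\<close> is even. At or below
  it, for \<open>r > 1\<close>, the condition \<open>J \<le> artanh (1 / (2 * r - 1))\<close> says
  that the recursion has slope at most \<open>1\<close> at \<open>0\<close>.\<close>

lemma plus_param_plus_field:
  assumes "r \<ge> 1" "J > 0" "plus_param r J t"
  shows "plus_field r J t"
proof (cases "ereal J > J_uniq r")
  case True
  then have t: "t > 0" "ising_fixed_point r J t" using assms(3) by (auto simp: plus_param_def)
  have "cosh (t - J) = cosh (J - t)" by (metis cosh_minus minus_diff_eq)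
  then have "real (2 * r - 1) * cavity J t = t"
    using t(2) assms(1) by (simp add: ising_fixed_point_def cavity_def of_nat_diff add.commute)
  then show ?thesis using t assms by (simp add: plus_field_def)
next
  case False
  then have t: "t = 0" and J: "ereal J \<le> J_uniq r" using assms(3) by (auto simp: plus_param_def)
  have "real (2 * r - 1) * tanh J \<le> 1"
  \<comment> \<open>For \<open>r = 1\<close> the threshold is infinite, and the slope bound is
    \<open>tanh J < 1\<close>.\<close>
  proof (cases "r = 1")
    case True
    then show ?thesis using tanh_real_lt_1[of J] by simp
  next
    case False
    define x where "x = 1 / (2 * real r - 1)"
    have r: "r \<ge> 2" using False assms(1) by simp
    then have x: "0 < x" "x < 1" by (auto simp: x_def field_simps)
    have le: "J \<le> artanh x" using J False by (simp add: J_uniq_def x_def)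
    have "tanh J \<le> x"
    proof (rule ccontr)
      assume "\<not> tanh J \<le> x"
      then have lt: "x < tanh J" "tanh J < 1" using tanh_real_lt_1[of J] by auto
      then have "(1 + x) / (1 - x) < (1 + tanh J) / (1 - tanh J)"
        using x by (intro frac_less) auto
      then have "ln ((1 + x) / (1 - x)) < ln ((1 + tanh J) / (1 - tanh J))"
        using x lt by (subst ln_less_cancel_iff) auto
      then have "artanh x < artanh (tanh J)" by (simp add: artanh_def)
      then show False using le by (simp add: artanh_tanh_real)
    qed
    then show ?thesis using r by (simp add: x_def of_nat_diff field_simps)
  qed
  then show ?thesis using t assms by (simp add: plus_field_def)
qed

theorem corollary1p2:
  fixes r :: nat and J :: real
    and V1 :: "nat \<Rightarrow> 'v set" and \<sigma>1 :: "nat \<Rightarrow> letter list \<Rightarrow> 'v \<Rightarrow> 'v"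
    and V2 :: "nat \<Rightarrow> 'w set" and \<sigma>2 :: "nat \<Rightarrow> letter list \<Rightarrow> 'w \<Rightarrow> 'w"
    and \<mu>p \<mu>m :: "config measure"
  assumes "r \<ge> 1" and "J > 0"
    and "plus_state r J \<mu>p" and "minus_state r J \<mu>m"
    and "sofic_approximation r V1 \<sigma>1" and "sofic_approximation r V2 \<sigma>2"
  shows "sofic_entropy r V1 \<sigma>1 \<mu>p = sofic_entropy r V2 \<sigma>2 \<mu>p \<and>
         sofic_entropy r V1 \<sigma>1 \<mu>m = sofic_entropy r V2 \<sigma>2 \<mu>m"
proof
  note s = assms(5,6)
  have borel: "ising_chain r J \<tau> \<mu> \<Longrightarrow> \<mu> \<in> borel_probs r" for \<tau> \<mu>
    by (simp add: ising_chain_def tree_markov_chain_def)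
  obtain t where t: "plus_param r J t" "ising_chain r J t \<mu>p"
    using assms(3) by (auto simp: plus_state_def)
  have pf: "plus_field r J t" by (rule plus_param_plus_field[OF assms(1,2) t(1)])
  have c: "word_corr \<mu>p A = 1 ^ card A * tree_corr r t J A" if "A \<in> fin_words r" for A
    using chain_correlation[OF t(2) assms(1) that] by simp
  show "sofic_entropy r V1 \<sigma>1 \<mu>p = sofic_entropy r V2 \<sigma>2 \<mu>p"
    by (rule antisym; rule sofic_entropy_le[OF _ _ pf borel[OF t(2)], where e = 1])
      (use s c in auto)
  obtain t' where t': "plus_param r J t'" "ising_chain r J (- t') \<mu>m"
    using assms(4) by (auto simp: minus_state_def)
  have pf': "plus_field r J t'" by (rule plus_param_plus_field[OF assms(1,2) t'(1)])
  have c': "word_corr \<mu>m A = (-1) ^ card A * tree_corr r t' J A" if "A \<in> fin_words r" for A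
    using chain_correlation[OF t'(2) assms(1) that] tree_corr_minus[OF that] by simp
  show "sofic_entropy r V1 \<sigma>1 \<mu>m = sofic_entropy r V2 \<sigma>2 \<mu>m"
    by (rule antisym; rule sofic_entropy_le[OF _ _ pf' borel[OF t'(2)], where e = "-1"])
      (use s c' in auto)
qed

end
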